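(* Let $(T_t)_{t\ge 0}=(e^{-tA})_{t\ge 0}$ be a symmetric Markov semigroup on $L^2(X,d\mu)$, where $(X,d\mu)$ is a $\sigma$-finite measure space, and let $\beta$ be a continuous real-valued function on $(0,+\infty)$. Suppose that for all $\epsilon>0$ and all $0\le f\in \mathrm{Quad}(A)\cap L^1\cap L^\infty$, $$\int f^2\log f\,d\mu\le \epsilon\, Q(f)+\beta(\epsilon)\|f\|_2^2+\|f\|_2^2\log\|f\|_2 .$$ Then for every $\eta>-1$ such that $$M_\eta(t)=(\eta+1)\,t^{-(\eta+1)}\int_0^t s^\eta\,\beta\!\left(\frac{s}{\eta+1}\right)ds$$ is finite for all $t>0$, one has $$\|e^{-At}\|_{\infty,2}\le e^{M_\eta(t)}\qquad\text{for all }0<t<\infty .$$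
   Context: $A$ is the (nonnegative self-adjoint) generator of the symmetric Markov semigroup, with $T_t=e^{-tA}$; symmetric Markov means that the $T_t$ are symmetric on $L^2$, positivity preserving and contractive on every $L^p$, $1\le p\le\infty$. $\mathrm{Quad}(A)$ is the domain of $\sqrt A$ in $L^2(X,d\mu)$ and $Q(f)=(\sqrt A f,\sqrt A f)$ for $f\in\mathrm{Quad}(A)$. $\|T\|_{\infty,2}$ is the operator norm of $T$ from $L^2$ to $L^\infty$. *)

theory Defs
  imports "HOL-Probability.Essential_Supremum"
begin

text \<open>
  Elements of $L^p$ are represented by measurable real functions, and equality of classes by
  equality almost everywhere.
\<close>

definition Lp_space :: "'a measure \<Rightarrow> real \<Rightarrow> ('a \<Rightarrow> real) set" where
  "Lp_space M p = {f \<in> borel_measurable M. integrable M (\<lambda>x. \<bar>f x\<bar> powr p)}"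

definition Lp_norm :: "'a measure \<Rightarrow> real \<Rightarrow> ('a \<Rightarrow> real) \<Rightarrow> real" where
  "Lp_norm M p f = (LINT x|M. \<bar>f x\<bar> powr p) powr (1 / p)"

definition Linf_norm :: "'a measure \<Rightarrow> ('a \<Rightarrow> real) \<Rightarrow> ennreal" where
  "Linf_norm M f = esssup M (\<lambda>x. ennreal \<bar>f x\<bar>)"

definition Linf_space :: "'a measure \<Rightarrow> ('a \<Rightarrow> real) set" where
  "Linf_space M = {f \<in> borel_measurable M. Linf_norm M f < \<infinity>}"

definition L2_inner :: "'a measure \<Rightarrow> ('a \<Rightarrow> real) \<Rightarrow> ('a \<Rightarrow> real) \<Rightarrow> real" where
  "L2_inner M f g = (LINT x|M. f x * g x)"

definition opnorm_2_inf :: "'a measure \<Rightarrow> (('a \<Rightarrow> real) \<Rightarrow> ('a \<Rightarrow> real)) \<Rightarrow> ennreal" where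
  "opnorm_2_inf M S = (SUP f \<in> {f \<in> Lp_space M 2. Lp_norm M 2 f \<le> 1}. Linf_norm M (S f))"


text \<open>
  The contraction property on $L^p$ is stated on the subspace $L^2 \cap L^p$, where the operators
  are defined. The case \<open>p = 2\<close> makes each \<open>T t\<close> a bounded operator on $L^2$.
\<close>

locale symmetric_markov_semigroup =
  fixes M :: "'a measure" and T :: "real \<Rightarrow> ('a \<Rightarrow> real) \<Rightarrow> ('a \<Rightarrow> real)"
  assumes maps_L2: "\<lbrakk>0 \<le> t; f \<in> Lp_space M 2\<rbrakk> \<Longrightarrow> T t f \<in> Lp_space M 2"
    and respects_AE: "\<lbrakk>0 \<le> t; f \<in> Lp_space M 2; g \<in> Lp_space M 2; AE x in M. f x = g x\<rbrakk>
      \<Longrightarrow> AE x in M. T t f x = T t g x"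
    and linear: "\<lbrakk>0 \<le> t; f \<in> Lp_space M 2; g \<in> Lp_space M 2\<rbrakk>
      \<Longrightarrow> AE x in M. T t (\<lambda>y. a * f y + b * g y) x = a * T t f x + b * T t g x"
    and T_zero: "f \<in> Lp_space M 2 \<Longrightarrow> AE x in M. T 0 f x = f x"
    and T_add: "\<lbrakk>0 \<le> s; 0 \<le> t; f \<in> Lp_space M 2\<rbrakk>
      \<Longrightarrow> AE x in M. T (s + t) f x = T s (T t f) x"
    and strongly_continuous: "f \<in> Lp_space M 2
      \<Longrightarrow> ((\<lambda>t. Lp_norm M 2 (\<lambda>x. T t f x - f x)) \<longlongrightarrow> 0) (at_right 0)"
    and symmetric: "\<lbrakk>0 \<le> t; f \<in> Lp_space M 2; g \<in> Lp_space M 2\<rbrakk>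
      \<Longrightarrow> L2_inner M (T t f) g = L2_inner M f (T t g)"
    and positivity_preserving: "\<lbrakk>0 \<le> t; f \<in> Lp_space M 2; AE x in M. 0 \<le> f x\<rbrakk>
      \<Longrightarrow> AE x in M. 0 \<le> T t f x"
    and contractive_Lp: "\<lbrakk>0 \<le> t; 1 \<le> p; f \<in> Lp_space M 2 \<inter> Lp_space M p\<rbrakk>
      \<Longrightarrow> T t f \<in> Lp_space M p \<and> Lp_norm M p (T t f) \<le> Lp_norm M p f"
    and contractive_Linf: "\<lbrakk>0 \<le> t; f \<in> Lp_space M 2 \<inter> Linf_space M\<rbrakk>
      \<Longrightarrow> T t f \<in> Linf_space M \<and> Linf_norm M (T t f) \<le> Linf_norm M f"


text \<open>
  An unbounded operator on $L^2$ is represented by its graph, a set of pairs \<open>(f, g)\<close> of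
  representatives; its domain is \<open>Domain\<close> of that relation. All the graphs below are closed
  under changing \<open>f\<close> and \<open>g\<close> on null sets.
\<close>

type_synonym 'a L2_graph = "(('a \<Rightarrow> real) \<times> ('a \<Rightarrow> real)) set"

text \<open>
  The operator $A$ with $T_t = e^{-tA}$, that is $A f = \lim_{t \to 0+} (f - T_t f) / t$ in $L^2$,
  on the domain where this limit exists.
\<close>

definition semigroup_generator ::
  "'a measure \<Rightarrow> (real \<Rightarrow> ('a \<Rightarrow> real) \<Rightarrow> ('a \<Rightarrow> real)) \<Rightarrow> 'a L2_graph" where
  "semigroup_generator M T = {(f, g). f \<in> Lp_space M 2 \<and> g \<in> Lp_space M 2 \<and>
     ((\<lambda>t. Lp_norm M 2 (\<lambda>x. (f x - T t f x) / t - g x)) \<longlongrightarrow> 0) (at_right 0)}"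

definition densely_defined :: "'a measure \<Rightarrow> 'a L2_graph \<Rightarrow> bool" where
  "densely_defined M S \<longleftrightarrow>
     (\<forall>f \<in> Lp_space M 2. \<forall>e > 0. \<exists>u \<in> Domain S \<inter> Lp_space M 2. Lp_norm M 2 (\<lambda>x. f x - u x) < e)"

definition adjoint_graph :: "'a measure \<Rightarrow> 'a L2_graph \<Rightarrow> 'a L2_graph" where
  "adjoint_graph M S = {(f, g). f \<in> Lp_space M 2 \<and> g \<in> Lp_space M 2 \<and>
     (\<forall>(u, v) \<in> S. L2_inner M v f = L2_inner M u g)}"

text \<open>
  Linearity, closedness and single-valuedness up to null sets all follow from this definition;
  density of the domain is what excludes multivalued relations.
\<close>

definition selfadjoint :: "'a measure \<Rightarrow> 'a L2_graph \<Rightarrow> bool" where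
  "selfadjoint M S \<longleftrightarrow> densely_defined M S \<and> adjoint_graph M S = S"

definition nonneg_operator :: "'a measure \<Rightarrow> 'a L2_graph \<Rightarrow> bool" where
  "nonneg_operator M S \<longleftrightarrow> (\<forall>(f, g) \<in> S. 0 \<le> L2_inner M f g)"

text \<open>
  \<open>S\<close> is the nonnegative self-adjoint operator with $S^2 = A$, where the domain of $S^2$ consists of
  all \<open>f\<close> in the domain of \<open>S\<close> with \<open>S f\<close> in the domain of \<open>S\<close>. For a nonnegative self-adjoint
  \<open>A\<close>, exactly one \<open>S\<close> satisfies this.
\<close>

definition is_sqrt_operator :: "'a measure \<Rightarrow> 'a L2_graph \<Rightarrow> 'a L2_graph \<Rightarrow> bool" where
  "is_sqrt_operator M A S \<longleftrightarrow> selfadjoint M S \<and> nonneg_operator M S \<and> S O S = A"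

text \<open>Some representative of $S f$; for a self-adjoint \<open>S\<close> it is determined up to null sets.\<close>

definition op_apply :: "'a L2_graph \<Rightarrow> ('a \<Rightarrow> real) \<Rightarrow> ('a \<Rightarrow> real)" where
  "op_apply S f = (SOME g. (f, g) \<in> S)"

text \<open>In the next two definitions \<open>R\<close> stands for the operator $\sqrt A$.\<close>

definition Quad :: "'a L2_graph \<Rightarrow> ('a \<Rightarrow> real) set" where
  "Quad R = Domain R"

definition Q_form :: "'a measure \<Rightarrow> 'a L2_graph \<Rightarrow> ('a \<Rightarrow> real) \<Rightarrow> real" where
  "Q_form M R f = L2_inner M (op_apply R f) (op_apply R f)"

definition M_fun :: "(real \<Rightarrow> real) \<Rightarrow> real \<Rightarrow> real \<Rightarrow> real" where
  "M_fun \<beta> \<eta> t = (\<eta> + 1) * t powr (- (\<eta> + 1)) *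
     (LBINT s:{0<..<t}. s powr \<eta> * \<beta> (s / (\<eta> + 1)))"

text \<open>
  Finiteness of the expression above, which by itself would be silently zero for a divergent
  integral.
\<close>

definition M_fun_finite :: "(real \<Rightarrow> real) \<Rightarrow> real \<Rightarrow> real \<Rightarrow> bool" where
  "M_fun_finite \<beta> \<eta> t \<longleftrightarrow>
     set_integrable lborel {0<..<t} (\<lambda>s. s powr \<eta> * \<beta> (s / (\<eta> + 1)))"

end

theory Submission
  imports Defs "HOL-Real_Asymp.Real_Asymp"
begin

text \<open>
  Let \<open>u s = T s f\<close> for a bounded integrable \<open>f \<ge> 0\<close>, and let \<open>p s = 2 * (t / (t - s)) powr a\<close> with
  \<open>a = \<eta> + 1\<close>, so that \<open>p\<close> runs from 2 to infinity on $[0, t)$ and \<open>p / p' = (t - s) / a\<close>.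
  Applying the logarithmic Sobolev inequality with \<open>\<epsilon> = p / p'\<close> to \<open>u powr (p / 2)\<close>, and the
  Stroock-Varopoulos inequality $Q(u^{p/2}) \le (p/2)\,(Au, u^{p-1})$, the Dirichlet form cancels in
  the derivative of $\log \|u_s\|_{p(s)}$, which is thus at most $2 \beta(p/p')\, p'/p^2$. The
  integral of this bound over $(0, t)$ is $M_\eta(t)$, and $\|u_t\|_p \to \|u_t\|_\infty$.

  No spectral theorem is used: $r \mapsto (T_r f, f)$ and its decrements are convex, which gives
  $T_s f \in \mathrm{Dom}(A)$ with norm bounds, and $Q$ is only evaluated on vectors \<open>T s f\<close>. Forms of
  other functions are replaced by difference quotients $(f - T_h f, f) / h$.
\<close>

section \<open>The space $L^2$\<close>

text \<open>Two obstacles shape the proof. It is not known beforehand that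
  \<open>u powr (p / 2)\<close> lies in \<open>Quad\<close>, so the logarithmic Sobolev inequality
  is applied to its image under \<open>T d\<close>, which lies in the domain of the generator;
  convexity of the autocorrelation bounds the form there by a difference quotient of the original
  function, and \<open>d\<close> tends to 0. Nor is the norm of \<open>u s\<close> in L^p with
  \<open>p = p s\<close> shown to be differentiable in \<open>s\<close>: only its upper right Dini
  derivative is estimated, which is enough for monotonicity and asks only for one-sided convexity
  inequalities. The remainders are o(h) because the orbit is Lipschitz in L^2 away from time 0.

  As the measure may be infinite, boundedness alone does not give integrability, so the pointwise
  estimates keep a factor \<open>u\<close> (integrable), \<open>sqrt u\<close> (in L^2) or a
  difference in L^2. The path \<open>p\<close> solves \<open>p / p' = (t - s) / a\<close> with
  \<open>p 0 = 2\<close>: \<beta> is then evaluated where \<open>M_fun\<close> evaluates it after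
  time reversal, and \<eta> only selects the path. General \<open>f\<close> in L^2 are reached
  through truncations of |f|.\<close>

lemma Lp_space_2_iff:
  "f \<in> Lp_space M 2 \<longleftrightarrow> f \<in> borel_measurable M \<and> integrable M (\<lambda>x. (f x)\<^sup>2)"
proof -
  have "\<bar>y\<bar> powr 2 = y\<^sup>2" for y :: real
    by (cases "y = 0") auto
  then show ?thesis by (simp add: Lp_space_def)
qed

lemma Lp_norm_2: "Lp_norm M 2 f = sqrt (L2_inner M f f)"
proof -
  have "\<bar>y\<bar> powr 2 = y * y" for y :: real
    by (cases "y = 0") (auto simp: power2_eq_square)
  moreover have "0 \<le> (LINT x|M. f x * f x)" by simp
  ultimately show ?thesis by (simp add: Lp_norm_def L2_inner_def powr_half_sqrt)
qed

lemma L2_inner_self_nonneg: "0 \<le> L2_inner M f f"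
  by (simp add: L2_inner_def)

lemma Lp_norm_2_nonneg: "0 \<le> Lp_norm M 2 f"
  by (simp add: Lp_norm_2 L2_inner_self_nonneg)

lemma Lp_norm_2_sq: "(Lp_norm M 2 f)\<^sup>2 = L2_inner M f f"
  by (simp add: Lp_norm_2 L2_inner_self_nonneg)

lemma L2_measurable: "f \<in> Lp_space M 2 \<Longrightarrow> f \<in> borel_measurable M"
  by (simp add: Lp_space_2_iff)

lemma L2_integrable_mult:
  assumes "f \<in> Lp_space M 2" "g \<in> Lp_space M 2"
  shows "integrable M (\<lambda>x. f x * g x)"
proof (rule Bochner_Integration.integrable_bound)
  show "integrable M (\<lambda>x. (f x)\<^sup>2 + (g x)\<^sup>2)"
    using assms by (simp add: Lp_space_2_iff)
  show "(\<lambda>x. f x * g x) \<in> borel_measurable M"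
    using assms by (auto simp: Lp_space_2_iff)
  have "\<bar>a * b\<bar> \<le> a\<^sup>2 + b\<^sup>2" for a b :: real
  proof -
    have "2 * \<bar>a * b\<bar> \<le> a\<^sup>2 + b\<^sup>2"
      using sum_squares_bound[of "\<bar>a\<bar>" "\<bar>b\<bar>"] by (simp add: abs_mult)
    then show ?thesis by linarith
  qed
  then show "AE x in M. norm (f x * g x) \<le> norm ((f x)\<^sup>2 + (g x)\<^sup>2)"
    by (intro AE_I2) simp
qed

lemma L2_lin:
  assumes "f \<in> Lp_space M 2" "g \<in> Lp_space M 2"
  shows "(\<lambda>x. a * f x + b * g x) \<in> Lp_space M 2"
proof -
  have "integrable M (\<lambda>x. a\<^sup>2 * (f x)\<^sup>2 + 2 * a * b * (f x * g x) + b\<^sup>2 * (g x)\<^sup>2)"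
    using assms L2_integrable_mult[OF assms] by (auto simp: Lp_space_2_iff)
  moreover have "(a * f x + b * g x)\<^sup>2 = a\<^sup>2 * (f x)\<^sup>2 + 2 * a * b * (f x * g x) + b\<^sup>2 * (g x)\<^sup>2" for x
    by (simp add: power2_eq_square algebra_simps)
  ultimately show ?thesis using assms by (auto simp: Lp_space_2_iff)
qed

lemma L2_add: "f \<in> Lp_space M 2 \<Longrightarrow> g \<in> Lp_space M 2 \<Longrightarrow> (\<lambda>x. f x + g x) \<in> Lp_space M 2"
  using L2_lin[of f M g 1 1] by simp

lemma L2_diff: "f \<in> Lp_space M 2 \<Longrightarrow> g \<in> Lp_space M 2 \<Longrightarrow> (\<lambda>x. f x - g x) \<in> Lp_space M 2"
  using L2_lin[of f M g 1 "-1"] by simp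

lemma L2_cmult: "f \<in> Lp_space M 2 \<Longrightarrow> (\<lambda>x. c * f x) \<in> Lp_space M 2"
  using L2_lin[of f M f c 0] by simp

lemma L2_divide: "f \<in> Lp_space M 2 \<Longrightarrow> (\<lambda>x. f x / c) \<in> Lp_space M 2"
  using L2_cmult[of f M "1 / c"] by simp

lemma L2_bound:
  assumes "g \<in> Lp_space M 2" "f \<in> borel_measurable M" "AE x in M. \<bar>f x\<bar> \<le> \<bar>g x\<bar>"
  shows "f \<in> Lp_space M 2"
  unfolding Lp_space_2_iff
proof (intro conjI)
  show "integrable M (\<lambda>x. (f x)\<^sup>2)"
  proof (rule Bochner_Integration.integrable_bound)
    show "integrable M (\<lambda>x. (g x)\<^sup>2)" using assms by (simp add: Lp_space_2_iff)
    show "AE x in M. norm ((f x)\<^sup>2) \<le> norm ((g x)\<^sup>2)"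
      using assms(3) by eventually_elim (simp add: abs_le_square_iff)
  qed (use assms(2) in simp)
qed fact

lemma L2_inner_commute: "L2_inner M f g = L2_inner M g f"
  by (simp add: L2_inner_def mult.commute)

lemma L2_inner_lin_left:
  assumes "f \<in> Lp_space M 2" "g \<in> Lp_space M 2" "h \<in> Lp_space M 2"
  shows "L2_inner M (\<lambda>x. a * f x + b * g x) h = a * L2_inner M f h + b * L2_inner M g h"
proof -
  have "L2_inner M (\<lambda>x. a * f x + b * g x) h = (LINT x|M. a * (f x * h x) + b * (g x * h x))"
    unfolding L2_inner_def by (rule Bochner_Integration.integral_cong) (auto simp: algebra_simps)
  also have "\<dots> = a * L2_inner M f h + b * L2_inner M g h"
    unfolding L2_inner_def using L2_integrable_mult[OF assms(1,3)] L2_integrable_mult[OF assms(2,3)]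
    by simp
  finally show ?thesis .
qed

lemma L2_inner_diff_left:
  "f \<in> Lp_space M 2 \<Longrightarrow> g \<in> Lp_space M 2 \<Longrightarrow> h \<in> Lp_space M 2 \<Longrightarrow>
    L2_inner M (\<lambda>x. f x - g x) h = L2_inner M f h - L2_inner M g h"
  using L2_inner_lin_left[of f M g h 1 "-1"] by simp

lemma L2_inner_diff_right:
  "f \<in> Lp_space M 2 \<Longrightarrow> g \<in> Lp_space M 2 \<Longrightarrow> h \<in> Lp_space M 2 \<Longrightarrow>
    L2_inner M h (\<lambda>x. f x - g x) = L2_inner M h f - L2_inner M h g"
  using L2_inner_diff_left[of f M g h] by (simp add: L2_inner_commute)

lemma L2_inner_divide_left: "L2_inner M (\<lambda>x. f x / c) h = L2_inner M f h / c"
  by (simp add: L2_inner_def)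

lemma L2_inner_divide_right: "L2_inner M h (\<lambda>x. f x / c) = L2_inner M h f / c"
  by (simp add: L2_inner_def)

lemma L2_inner_cong_AE:
  assumes "f \<in> borel_measurable M" "f' \<in> borel_measurable M"
    "g \<in> borel_measurable M" "g' \<in> borel_measurable M"
    "AE x in M. f x = f' x" "AE x in M. g x = g' x"
  shows "L2_inner M f g = L2_inner M f' g'"
  unfolding L2_inner_def by (rule integral_cong_AE) (use assms in auto)

lemma Cauchy_Schwarz_L2:
  assumes f: "f \<in> Lp_space M 2" and g: "g \<in> Lp_space M 2"
  shows "\<bar>L2_inner M f g\<bar> \<le> Lp_norm M 2 f * Lp_norm M 2 g"
proof -
  define a b c where "a = L2_inner M f f" and "b = L2_inner M f g" and "c = L2_inner M g g"
  \<comment> \<open>Nonnegativity of ||f - l g||^2. It is used at the minimiser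
    \<open>l = b / c\<close>; for \<open>c = 0\<close> the expression is affine in \<open>l\<close>,
    and \<open>l = (a + 1) / (2 * b)\<close> would make it negative.\<close>
  have q: "0 \<le> a - 2 * l * b + l\<^sup>2 * c" for l
  proof -
    have "0 \<le> L2_inner M (\<lambda>x. 1 * f x + (-l) * g x) (\<lambda>x. 1 * f x + (-l) * g x)"
      by (rule L2_inner_self_nonneg)
    also have "\<dots> = a - 2 * l * b + l\<^sup>2 * c"
      using f g L2_lin[OF f g, of 1 "-l"]
      by (subst L2_inner_lin_left, simp_all only: L2_inner_commute[of M _ "\<lambda>x. 1 * f x + (-l) * g x"])
        (simp_all add: L2_inner_lin_left[of _ M _ _ 1 "-l", simplified] a_def b_def c_def
           L2_inner_commute[of M g f] power2_eq_square algebra_simps)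
    finally show ?thesis .
  qed
  have c0: "0 \<le> c" "0 \<le> a" unfolding c_def a_def by (simp_all add: L2_inner_self_nonneg)
  have "b\<^sup>2 \<le> a * c"
  proof (cases "c = 0")
    case True
    then have b: "2 * l * b \<le> a" for l using q[of l] by simp
    have "b = 0"
      using b[of "(a + 1) / (2 * b)"] by (cases "b = 0") auto
    then show ?thesis using True by simp
  next
    case False
    then show ?thesis using q[of "b / c"] c0
      by (simp add: field_simps power2_eq_square)
  qed
  then have "\<bar>b\<bar> \<le> sqrt (a * c)" by (simp add: real_le_rsqrt)
  then show ?thesis by (simp add: Lp_norm_2 a_def b_def c_def real_sqrt_mult)
qed

lemma Lp_norm_2_add_le:
  assumes f: "f \<in> Lp_space M 2" and g: "g \<in> Lp_space M 2"
  shows "Lp_norm M 2 (\<lambda>x. f x + g x) \<le> Lp_norm M 2 f + Lp_norm M 2 g"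
proof (rule power2_le_imp_le)
  have "(Lp_norm M 2 (\<lambda>x. f x + g x))\<^sup>2 = (LINT x|M. f x * f x + 2 * (f x * g x) + g x * g x)"
    unfolding Lp_norm_2_sq L2_inner_def by (simp add: algebra_simps)
  also have "\<dots> = (Lp_norm M 2 f)\<^sup>2 + 2 * L2_inner M f g + (Lp_norm M 2 g)\<^sup>2"
    unfolding Lp_norm_2_sq L2_inner_def
    using L2_integrable_mult[OF f f] L2_integrable_mult[OF f g] L2_integrable_mult[OF g g] by simp
  also have "\<dots> \<le> (Lp_norm M 2 f + Lp_norm M 2 g)\<^sup>2"
    using Cauchy_Schwarz_L2[OF f g] by (simp add: power2_sum)
  finally show "(Lp_norm M 2 (\<lambda>x. f x + g x))\<^sup>2 \<le> (Lp_norm M 2 f + Lp_norm M 2 g)\<^sup>2" .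
qed (simp add: Lp_norm_2_nonneg)

lemma Lp_norm_2_cmult: "Lp_norm M 2 (\<lambda>x. c * f x) = \<bar>c\<bar> * Lp_norm M 2 f"
proof -
  have "L2_inner M (\<lambda>x. c * f x) (\<lambda>x. c * f x) = c\<^sup>2 * L2_inner M f f"
    unfolding L2_inner_def by (simp add: power2_eq_square mult.assoc mult.left_commute)
  then show ?thesis by (simp add: Lp_norm_2 real_sqrt_mult)
qed

lemma Lp_norm_2_minus_commute: "Lp_norm M 2 (\<lambda>x. f x - g x) = Lp_norm M 2 (\<lambda>x. g x - f x)"
  using Lp_norm_2_cmult[of M "-1" "\<lambda>x. f x - g x"] by simp

lemma Lp_norm_2_triangle:
  assumes "f \<in> Lp_space M 2" "g \<in> Lp_space M 2" "h \<in> Lp_space M 2"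
  shows "Lp_norm M 2 (\<lambda>x. f x - h x) \<le> Lp_norm M 2 (\<lambda>x. f x - g x) + Lp_norm M 2 (\<lambda>x. g x - h x)"
  using Lp_norm_2_add_le[OF L2_diff[OF assms(1,2)] L2_diff[OF assms(2,3)]] by simp

lemma Lp_norm_2_cong_AE:
  assumes "f \<in> borel_measurable M" "f' \<in> borel_measurable M" "AE x in M. f x = f' x"
  shows "Lp_norm M 2 f = Lp_norm M 2 f'"
  using assms by (simp add: Lp_norm_2 L2_inner_cong_AE[of f M f' f f'])

lemma Lp_norm_2_le_sqrt:
  assumes "(LINT x|M. (f x)\<^sup>2) \<le> c"
  shows "Lp_norm M 2 f \<le> sqrt c"
  using assms by (simp add: Lp_norm_2 L2_inner_def power2_eq_square)

lemma L2_inner_tendsto: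
  assumes "\<forall>\<^sub>F i in F. f i \<in> Lp_space M 2" "f0 \<in> Lp_space M 2" "g \<in> Lp_space M 2"
    and "((\<lambda>i. Lp_norm M 2 (\<lambda>x. f i x - f0 x)) \<longlongrightarrow> 0) F"
  shows "((\<lambda>i. L2_inner M g (f i)) \<longlongrightarrow> L2_inner M g f0) F"
proof (rule LIM_zero_cancel)
  show "((\<lambda>i. L2_inner M g (f i) - L2_inner M g f0) \<longlongrightarrow> 0) F"
  proof (rule Lim_null_comparison)
    show "((\<lambda>i. Lp_norm M 2 g * Lp_norm M 2 (\<lambda>x. f i x - f0 x)) \<longlongrightarrow> 0) F"
      using tendsto_mult_left[OF assms(4)] by simp
    show "\<forall>\<^sub>F i in F. norm (L2_inner M g (f i) - L2_inner M g f0)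
        \<le> Lp_norm M 2 g * Lp_norm M 2 (\<lambda>x. f i x - f0 x)"
      using assms(1)
    proof eventually_elim
      case (elim i)
      have "L2_inner M g (f i) - L2_inner M g f0 = L2_inner M g (\<lambda>x. f i x - f0 x)"
        by (simp add: L2_inner_diff_right elim assms)
      then show ?case
        using Cauchy_Schwarz_L2[OF assms(3) L2_diff[OF elim assms(2)]] by simp
    qed
  qed
qed

lemma L2_AE_zero:
  assumes "f \<in> Lp_space M 2" "L2_inner M f f = 0"
  shows "AE x in M. f x = 0"
proof -
  have "AE x in M. (f x)\<^sup>2 = 0"
    using assms integral_nonneg_eq_0_iff_AE[of M "\<lambda>x. (f x)\<^sup>2"]
    by (simp add: Lp_space_2_iff L2_inner_def power2_eq_square)
  then show ?thesis by simp
qed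

section \<open>Completeness of L^2 (Riesz-Fischer)\<close>

text \<open>The weights \<open>2 ^ n\<close> turn the bound \<open>(1/4) ^ n\<close> into a summable
  \<open>(1/2) ^ n\<close>, so the weighted series of squares is finite almost everywhere. Hence
  each squared increment is at most \<open>S * (1/2) ^ n\<close>, and the increments are dominated
  by a geometric series of ratio \<open>sqrt (1/2)\<close>. Working with squares avoids the L^1
  norms of the increments, which may be infinite.\<close>

lemma L2_fast_Cauchy_convergent_AE:
  assumes f: "\<And>n. f n \<in> Lp_space M 2"
    and fast: "\<And>n. L2_inner M (\<lambda>x. f (Suc n) x - f n x) (\<lambda>x. f (Suc n) x - f n x) \<le> (1/4) ^ n"
  shows "AE x in M. convergent (\<lambda>n. f n x)"
proof -
  note [measurable] = L2_measurable[OF f]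
  define g where "g n x = (f (Suc n) x - f n x)\<^sup>2" for n x
  have [measurable]: "g n \<in> borel_measurable M" for n unfolding g_def by measurable
  have g0: "0 \<le> g n x" for n x unfolding g_def by simp
  have gi: "integrable M (g n)" for n
    using L2_diff[OF f[of "Suc n"] f[of n]] by (simp add: g_def[abs_def] Lp_space_2_iff)
  have "(\<integral>\<^sup>+x. (\<Sum>n. ennreal (2 ^ n * g n x)) \<partial>M) = (\<Sum>n. \<integral>\<^sup>+x. ennreal (2 ^ n * g n x) \<partial>M)"
    by (rule nn_integral_suminf) simp
  also have "\<dots> \<le> (\<Sum>n. ennreal ((1/2) ^ n))"
  proof (rule suminf_le[OF _ summableI summableI])
    fix n
    have "(LINT x|M. g n x) \<le> (1/4) ^ n"
      using fast[of n] by (simp add: g_def L2_inner_def power2_eq_square)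
    then have "2 ^ n * (LINT x|M. g n x) \<le> 2 ^ n * (1/4) ^ n" by (intro mult_left_mono) auto
    also have "\<dots> = (1/2 :: real) ^ n" by (simp flip: power_mult_distrib)
    finally show "(\<integral>\<^sup>+x. ennreal (2 ^ n * g n x) \<partial>M) \<le> ennreal ((1/2) ^ n)"
      using gi[of n] g0 by (subst nn_integral_eq_integral) (auto intro!: ennreal_leI)
  qed
  also have "\<dots> = ennreal (\<Sum>n. (1/2) ^ n)"
    by (rule suminf_ennreal_eq) (auto intro!: summable_sums)
  also have "\<dots> < \<infinity>" by simp
  finally have "AE x in M. (\<Sum>n. ennreal (2 ^ n * g n x)) \<noteq> \<infinity>"
    by (intro nn_integral_PInf_AE) auto
  then show ?thesis
  proof eventually_elim
    case (elim x)
    define S where "S = enn2real (\<Sum>n. ennreal (2 ^ n * g n x))"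
    have S: "2 ^ n * g n x \<le> S" for n
    proof -
      have "ennreal (2 ^ n * g n x) \<le> (\<Sum>n. ennreal (2 ^ n * g n x))"
        using sum_le_suminf[of "\<lambda>n. ennreal (2 ^ n * g n x)" "{n}"] by simp
      then show ?thesis unfolding S_def using elim g0
        by (metis enn2real_ennreal enn2real_mono infinity_ennreal_def mult_nonneg_nonneg
            top.not_eq_extremum zero_le_numeral zero_le_power)
    qed
    have bd: "\<bar>f (Suc n) x - f n x\<bar> \<le> sqrt S * (sqrt (1/2)) ^ n" for n
    proof -
      have "g n x \<le> S * (1/2) ^ n"
        using S[of n] by (simp add: field_simps power_one_over)
      then have "sqrt (g n x) \<le> sqrt (S * (1/2) ^ n)" by (rule real_sqrt_le_mono)
      moreover have "sqrt (g n x) = \<bar>f (Suc n) x - f n x\<bar>"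
        unfolding g_def by (rule real_sqrt_abs)
      ultimately show ?thesis by (simp only: real_sqrt_mult real_sqrt_power)
    qed
    have "summable (\<lambda>n. sqrt S * (sqrt (1/2)) ^ n)"
      by (intro summable_mult summable_geometric) (simp add: real_sqrt_lt_1_iff)
    then have "summable (\<lambda>n. f (Suc n) x - f n x)"
      by (rule summable_comparison_test'[where N = 0]) (simp only: real_norm_def bd)
    then have "convergent (\<lambda>n. \<Sum>i<n. f (Suc i) x - f i x)"
      by (simp add: summable_iff_convergent)
    then have "convergent (\<lambda>n. f n x - f 0 x)"
      by (simp add: sum_lessThan_telescope[of "\<lambda>n. f n x"])
    then show ?case by (simp add: convergent_diff_const_right_iff)
  qed
qed

lemma L2_complete:
  assumes f: "\<And>n. f n \<in> Lp_space M 2"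
    and Cau: "\<And>e. 0 < e \<Longrightarrow> \<exists>N. \<forall>m\<ge>N. \<forall>n\<ge>N. Lp_norm M 2 (\<lambda>x. f m x - f n x) < e"
  shows "\<exists>F \<in> Lp_space M 2. (\<lambda>n. Lp_norm M 2 (\<lambda>x. f n x - F x)) \<longlonglongrightarrow> 0"
proof -
  note [measurable] = L2_measurable[OF f]
  have "\<forall>k. \<exists>N. \<forall>m\<ge>N. \<forall>n\<ge>N. Lp_norm M 2 (\<lambda>x. f m x - f n x) < (1/2) ^ k"
    using Cau by simp
  then obtain N where N: "\<And>k m n. m \<ge> N k \<Longrightarrow> n \<ge> N k \<Longrightarrow> Lp_norm M 2 (\<lambda>x. f m x - f n x) < (1/2) ^ k"
    by metis
  \<comment> \<open>Summing all \<open>N i\<close> makes the indices monotone as well as at least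
    \<open>N k\<close>; the summand \<open>k\<close> makes them tend to infinity.\<close>
  define r where "r k = (\<Sum>i\<le>k. N i) + k" for k
  have rN: "r k \<ge> N k" for k
    unfolding r_def by (intro trans_le_add1 member_le_sum) auto
  have rSuc: "r (Suc k) \<ge> r k" for k unfolding r_def by simp
  have rk: "r k \<ge> k" for k unfolding r_def by simp
  have "AE x in M. convergent (\<lambda>n. f (r n) x)"
  proof (rule L2_fast_Cauchy_convergent_AE)
    fix n
    have "Lp_norm M 2 (\<lambda>x. f (r (Suc n)) x - f (r n) x) < (1/2) ^ n"
      using N[of n "r (Suc n)" "r n"] rN rSuc order_trans by blast
    then have "(Lp_norm M 2 (\<lambda>x. f (r (Suc n)) x - f (r n) x))\<^sup>2 \<le> ((1/2) ^ n)\<^sup>2"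
      by (intro power_mono) (auto simp: Lp_norm_2_nonneg)
    then show "L2_inner M (\<lambda>x. f (r (Suc n)) x - f (r n) x) (\<lambda>x. f (r (Suc n)) x - f (r n) x) \<le> (1/4) ^ n"
      by (simp add: Lp_norm_2_sq flip: power_mult) (simp add: power_mult power2_eq_square flip: power_mult_distrib)
  qed (rule f)
  then have lim: "AE x in M. (\<lambda>n. f (r n) x) \<longlonglongrightarrow> lim (\<lambda>n. f (r n) x)"
    by (simp add: convergent_LIMSEQ_iff)
  define F where "F x = lim (\<lambda>n. f (r n) x)" for x
  have Fm[measurable]: "F \<in> borel_measurable M" unfolding F_def by measurable
  \<comment> \<open>Fatou's lemma along the subsequence transfers the Cauchy bound from the
    functions \<open>f n\<close> to their pointwise limit.\<close>
  have key: "(\<integral>\<^sup>+x. ennreal ((F x - f m x)\<^sup>2) \<partial>M) \<le> ennreal (e\<^sup>2)"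
    if e: "0 < e" and m: "\<And>n. n \<ge> K \<Longrightarrow> Lp_norm M 2 (\<lambda>x. f n x - f m x) < e" for e m K
  proof -
    have "(\<integral>\<^sup>+x. ennreal ((F x - f m x)\<^sup>2) \<partial>M) = (\<integral>\<^sup>+x. liminf (\<lambda>n. ennreal ((f (r n) x - f m x)\<^sup>2)) \<partial>M)"
    proof (rule nn_integral_cong_AE)
      show "AE x in M. ennreal ((F x - f m x)\<^sup>2) = liminf (\<lambda>n. ennreal ((f (r n) x - f m x)\<^sup>2))"
        using lim
      proof eventually_elim
        case (elim x)
        then have "(\<lambda>n. ennreal ((f (r n) x - f m x)\<^sup>2)) \<longlonglongrightarrow> ennreal ((F x - f m x)\<^sup>2)"
          unfolding F_def by (intro tendsto_intros)
        then show ?case by (rule lim_imp_Liminf[OF sequentially_bot, symmetric])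
      qed
    qed
    also have "\<dots> \<le> liminf (\<lambda>n. \<integral>\<^sup>+x. ennreal ((f (r n) x - f m x)\<^sup>2) \<partial>M)"
      by (rule nn_integral_liminf) simp
    also have "\<dots> \<le> ennreal (e\<^sup>2)"
    proof (rule Liminf_le)
      show "\<forall>\<^sub>F n in sequentially. (\<integral>\<^sup>+x. ennreal ((f (r n) x - f m x)\<^sup>2) \<partial>M) \<le> ennreal (e\<^sup>2)"
        using eventually_ge_at_top[of K]
      proof eventually_elim
        case (elim n)
        then have "Lp_norm M 2 (\<lambda>x. f (r n) x - f m x) < e" using m rk order_trans by blast
        then have "(Lp_norm M 2 (\<lambda>x. f (r n) x - f m x))\<^sup>2 \<le> e\<^sup>2"
          by (intro power_mono) (auto simp: Lp_norm_2_nonneg)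
        then have "(LINT x|M. (f (r n) x - f m x)\<^sup>2) \<le> e\<^sup>2"
          unfolding Lp_norm_2_sq L2_inner_def by (simp add: power2_eq_square)
        moreover have "integrable M (\<lambda>x. (f (r n) x - f m x)\<^sup>2)"
          using L2_diff[OF f f] by (simp add: Lp_space_2_iff)
        ultimately show ?case by (simp add: nn_integral_eq_integral ennreal_leI)
      qed
    qed simp
    finally show ?thesis .
  qed
  have diffL2: "(\<lambda>x. F x - f m x) \<in> Lp_space M 2"
    and diffle: "Lp_norm M 2 (\<lambda>x. F x - f m x) \<le> e"
    if e: "0 < e" and m: "\<And>n. n \<ge> K \<Longrightarrow> Lp_norm M 2 (\<lambda>x. f n x - f m x) < e" for e m K
  proof -
    have k: "(\<integral>\<^sup>+x. ennreal ((F x - f m x)\<^sup>2) \<partial>M) \<le> ennreal (e\<^sup>2)"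
      by (rule key[where K = K]) (use that in auto)
    have i: "integrable M (\<lambda>x. (F x - f m x)\<^sup>2)"
      by (rule integrableI_bounded) (use le_less_trans[OF k ennreal_less_top] in auto)
    then show "(\<lambda>x. F x - f m x) \<in> Lp_space M 2" by (simp add: Lp_space_2_iff)
    have "ennreal (LINT x|M. (F x - f m x)\<^sup>2) \<le> ennreal (e\<^sup>2)"
      using k i by (simp add: nn_integral_eq_integral)
    then have "(LINT x|M. (F x - f m x)\<^sup>2) \<le> e\<^sup>2" by (simp add: ennreal_le_iff)
    then show "Lp_norm M 2 (\<lambda>x. F x - f m x) \<le> e"
      using Lp_norm_2_le_sqrt e by fastforce
  qed
  have FL2: "F \<in> Lp_space M 2"
  proof -
    have "(\<lambda>x. F x - f (N 0) x) \<in> Lp_space M 2"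
      by (rule diffL2[of 1 "N 0"]) (use N[of 0] in auto)
    from L2_add[OF this f[of "N 0"]] show ?thesis by simp
  qed
  moreover have "(\<lambda>n. Lp_norm M 2 (\<lambda>x. f n x - F x)) \<longlonglongrightarrow> 0"
  proof (rule LIMSEQ_I)
    fix e :: real assume e: "0 < e"
    then obtain K where K: "\<forall>m\<ge>K. \<forall>n\<ge>K. Lp_norm M 2 (\<lambda>x. f m x - f n x) < e / 2"
      using Cau[of "e / 2"] by auto
    have "Lp_norm M 2 (\<lambda>x. F x - f m x) \<le> e / 2" if "m \<ge> K" for m
      by (rule diffle[of _ K]) (use that K e in auto)
    then have "norm (Lp_norm M 2 (\<lambda>x. f m x - F x) - 0) < e" if "m \<ge> K" for m
      using that e by (subst Lp_norm_2_minus_commute) (force simp: Lp_norm_2_nonneg)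
    then show "\<exists>no. \<forall>n\<ge>no. norm (Lp_norm M 2 (\<lambda>x. f n x - F x) - 0) < e" by blast
  qed
  ultimately show ?thesis by blast
qed

section \<open>Convexity of autocorrelations and the domain of the generator\<close>

text \<open>Subtract the chord from \<open>f\<close>. If the difference \<open>g\<close> had a
  positive maximum on [x, y], its leftmost maximiser \<open>c\<close> would be interior, and
  \<open>g (c - d) < g c\<close> together with \<open>g (c + d) \<le> g c\<close> would contradict
  midpoint convexity. Continuity enters through the existence of \<open>c\<close>.\<close>

lemma midpoint_convex_imp_convex_on:
  fixes f :: "real \<Rightarrow> real"
  assumes cont: "continuous_on {0..} f"
    and mid: "\<And>r k. 0 \<le> r \<Longrightarrow> 0 \<le> k \<Longrightarrow> 0 \<le> f r - 2 * f (r + k) + f (r + 2 * k)"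
  shows "convex_on {0..} f"
proof (rule convex_on_linorderI)
  fix t x y :: real
  assume t: "0 < t" "t < 1" and xy: "x \<in> {0..}" "y \<in> {0..}" "x < y"
  define l where "l = (f y - f x) / (y - x)"
  define g where "g z = f z - f x - l * (z - x)" for z
  have gx: "g x = 0" "g y = 0" using xy by (auto simp: g_def l_def)
  have cg: "continuous_on {x..y} g"
    unfolding g_def by (intro continuous_intros continuous_on_subset[OF cont]) (use xy in auto)
  have "\<exists>c\<in>{x..y}. \<forall>z\<in>{x..y}. g z \<le> g c"
    by (rule continuous_attains_sup) (use xy cg in auto)
  then obtain c0 where c0: "c0 \<in> {x..y}" "\<And>z. z \<in> {x..y} \<Longrightarrow> g z \<le> g c0" by blast
  have "closed ({x..y} \<inter> g -` {g c0})"
    by (rule continuous_closed_preimage[OF cg]) auto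
  then have "compact ({x..y} \<inter> g -` {g c0})"
    by (metis compact_Icc compact_Int_closed inf.left_idem)
  moreover have "{x..y} \<inter> g -` {g c0} \<noteq> {}" using c0(1) by blast
  ultimately have "\<exists>c\<in>{x..y} \<inter> g -` {g c0}. \<forall>z\<in>{x..y} \<inter> g -` {g c0}. c \<le> z"
    by (rule compact_attains_inf)
  then obtain c where c: "c \<in> {x..y}" "g c = g c0" "\<And>z. z \<in> {x..y} \<Longrightarrow> g z = g c0 \<Longrightarrow> c \<le> z"
    by blast
  have "g c \<le> 0"
  proof (rule ccontr)
    assume "\<not> g c \<le> 0"
    then have "c \<noteq> x" "c \<noteq> y" using gx by auto
    then have cxy: "x < c" "c < y" using c(1) by auto
    define d where "d = min (c - x) (y - c)"
    have d: "0 < d" "x \<le> c - d" "c + d \<le> y" using cxy by (auto simp: d_def)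
    have "g (c - d) < g c"
      using c0(2)[of "c - d"] c(2) c(3)[of "c - d"] d cxy by fastforce
    moreover have "g (c + d) \<le> g c" using c0(2)[of "c + d"] c(2) d cxy by simp
    moreover have "0 \<le> g (c - d) - 2 * g c + g (c + d)"
      using mid[of "c - d" d] xy d by (simp add: g_def algebra_simps)
    ultimately show False by simp
  qed
  then have "g ((1 - t) * x + t * y) \<le> 0"
  proof -
    have "(1 - t) * x + t * y \<in> {x..y}"
      using t xy convex_bound_le[of x y y "1 - t" t] mult_left_mono[of x y t]
      by (auto simp: algebra_simps)
    from c0(2)[OF this] show ?thesis using \<open>g c \<le> 0\<close> c(2) by simp
  qed
  moreover have "l * ((1 - t) * x + t * y - x) = t * (f y - f x)"
    using xy by (simp add: l_def field_simps)
  ultimately show "f ((1 - t) *\<^sub>R x + t *\<^sub>R y) \<le> (1 - t) * f x + t * f y"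
    by (simp add: g_def algebra_simps)
qed simp

section \<open>Slopes of convex functions on the half-line\<close>

lemma convex_decrement_antimono:
  fixes f :: "real \<Rightarrow> real"
  assumes f: "convex_on {0..} f" and "0 \<le> x" "x \<le> y" "0 < k"
  shows "f y - f (y + k) \<le> f x - f (x + k)"
proof (cases "x = y")
  case False
  then have xy: "x < y" using assms by simp
  have "(f x - f (x + k)) / (x - (x + k)) \<le> (f x - f (y + k)) / (x - (y + k))"
    by (rule convex_on_slope_le(1)[OF f]) (use assms xy in auto)
  also have "\<dots> \<le> (f y - f (y + k)) / (y - (y + k))"
    by (rule convex_on_slope_le(2)[OF f]) (use assms xy in auto)
  finally have "(f x - f (x + k)) / (- k) \<le> (f y - f (y + k)) / (- k)" by simp
  then show ?thesis using \<open>0 < k\<close> unfolding divide_le_cancel by simp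
qed simp

lemma convex_decrement_quotient_antimono:
  fixes f :: "real \<Rightarrow> real"
  assumes f: "convex_on {0..} f" and "0 \<le> x" "0 < k" "k \<le> k'"
  shows "(f x - f (x + k')) / k' \<le> (f x - f (x + k)) / k"
proof (cases "k = k'")
  case False
  have "(f x - f (x + k)) / (x - (x + k)) \<le> (f x - f (x + k')) / (x - (x + k'))"
    by (rule convex_on_slope_le(1)[OF f]) (use assms False in auto)
  then show ?thesis using assms by (simp add: field_simps)
qed simp

text \<open>A later slope is compared with the mean slope over an earlier interval. This trades a
  derivative at \<open>y\<close> for a difference of values over a fixed length, and is where the
  negative powers of time come from.\<close>

lemma convex_decrement_quotient_le:
  fixes f :: "real \<Rightarrow> real"
  assumes f: "convex_on {0..} f" and "0 \<le> x" "x < y" "0 < k"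
  shows "(f y - f (y + k)) / k \<le> (f x - f y) / (y - x)"
proof -
  have "(f x - f y) / (x - y) \<le> (f x - f (y + k)) / (x - (y + k))"
    by (rule convex_on_slope_le(1)[OF f]) (use assms in auto)
  also have "\<dots> \<le> (f y - f (y + k)) / (y - (y + k))"
    by (rule convex_on_slope_le(2)[OF f]) (use assms in auto)
  finally show ?thesis using assms by (simp add: field_simps)
qed

text \<open>A discrete second derivative with two independent steps. For \<phi> the autocorrelation
  of \<open>f\<close> it is the inner product of the difference quotients of
  \<open>T (r / 2) f\<close> with steps \<open>h\<close> and \<open>k\<close>.\<close>

definition second_quotient :: "(real \<Rightarrow> real) \<Rightarrow> real \<Rightarrow> real \<Rightarrow> real \<Rightarrow> real" where
  "second_quotient \<phi> r h k = (\<phi> r - \<phi> (r + h) - \<phi> (r + k) + \<phi> (r + h + k)) / (h * k)"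

lemma second_quotient_eq:
  "second_quotient \<phi> r h k = ((\<phi> r - \<phi> (r + h)) - (\<phi> (r + k) - \<phi> (r + k + h))) / k / h"
  by (simp add: second_quotient_def algebra_simps)

lemma second_quotient_commute: "second_quotient \<phi> r h k = second_quotient \<phi> r k h"
  by (simp add: second_quotient_def algebra_simps)

section \<open>Bounds and monotonicity of discrete second derivatives\<close>

context
  fixes \<phi> :: "real \<Rightarrow> real"
  assumes nonneg: "\<And>r. 0 \<le> r \<Longrightarrow> 0 \<le> \<phi> r"
    and convex: "convex_on {0..} \<phi>"
    and convex': "\<And>h. 0 \<le> h \<Longrightarrow> convex_on {0..} (\<lambda>r. \<phi> r - \<phi> (r + h))"
    and decr: "\<And>r h. 0 \<le> r \<Longrightarrow> 0 \<le> h \<Longrightarrow> \<phi> (r + h) \<le> \<phi> r"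
begin

text \<open>Up to the factor \<open>1 / h\<close> this is the decrement quotient, with step
  \<open>k\<close>, of the convex function \<open>\<lambda>r. \<phi> r - \<phi> (r + h)\<close>;
  such quotients shrink as the step grows.\<close>

lemma second_quotient_antimono_right:
  assumes "0 \<le> r" "0 < h" "0 < k" "k \<le> k'"
  shows "second_quotient \<phi> r h k' \<le> second_quotient \<phi> r h k"
proof -
  have "((\<phi> r - \<phi> (r + h)) - (\<phi> (r + k') - \<phi> (r + k' + h))) / k'
      \<le> ((\<phi> r - \<phi> (r + h)) - (\<phi> (r + k) - \<phi> (r + k + h))) / k"
    using convex_decrement_quotient_antimono[OF convex'[of h], of r k k'] assms by simp
  then show ?thesis
    unfolding second_quotient_eq using \<open>0 < h\<close> by (intro divide_right_mono) auto
qed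

lemma second_quotient_antimono:
  assumes "0 \<le> r" "0 < h" "h \<le> h'" "0 < k" "k \<le> k'"
  shows "second_quotient \<phi> r h' k' \<le> second_quotient \<phi> r h k"
  using second_quotient_antimono_right[of r h' k k'] second_quotient_antimono_right[of r k h h'] assms
  by (simp add: second_quotient_commute[of \<phi> r _ k])

text \<open>Time is moved back by \<open>r / 2\<close> twice, from \<open>r\<close> to
  \<open>r / 2\<close> and from \<open>r / 2\<close> to 0. Each move trades one derivative for a
  difference of values at the cost of a factor \<open>2 / r\<close>, hence
  \<open>4 / r^2\<close>.\<close>

lemma second_quotient_le:
  assumes "0 < r" "0 < h" "0 < k"
  shows "second_quotient \<phi> r h k \<le> 4 * \<phi> 0 / r\<^sup>2"
proof -
  have "((\<phi> r - \<phi> (r + h)) - (\<phi> (r + k) - \<phi> (r + k + h))) / k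
      \<le> ((\<phi> (r/2) - \<phi> (r/2 + h)) - (\<phi> r - \<phi> (r + h))) / (r - r/2)"
    using convex_decrement_quotient_le[OF convex'[of h], of "r/2" r k] assms by simp
  also have "\<dots> \<le> (\<phi> (r/2) - \<phi> (r/2 + h)) / (r - r/2)"
    using decr[of r h] assms by (intro divide_right_mono) auto
  finally have "second_quotient \<phi> r h k \<le> (\<phi> (r/2) - \<phi> (r/2 + h)) / (r - r/2) / h"
    unfolding second_quotient_eq using assms by (intro divide_right_mono) auto
  also have "\<dots> = ((\<phi> (r/2) - \<phi> (r/2 + h)) / h) * (2 / r)"
    by simp
  finally have le: "second_quotient \<phi> r h k \<le> ((\<phi> (r/2) - \<phi> (r/2 + h)) / h) * (2 / r)" .
  have "(\<phi> (r/2) - \<phi> (r/2 + h)) / h \<le> (\<phi> 0 - \<phi> (r/2)) / (r/2 - 0)"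
    by (rule convex_decrement_quotient_le[OF convex]) (use assms in auto)
  also have "\<dots> \<le> \<phi> 0 / (r/2)"
    using nonneg[of "r/2"] assms by (simp add: divide_right_mono)
  finally have "((\<phi> (r/2) - \<phi> (r/2 + h)) / h) * (2 / r) \<le> \<phi> 0 / (r/2) * (2 / r)"
    using assms by (intro mult_right_mono) auto
  then show ?thesis
    using le by (simp add: power2_eq_square)
qed

text \<open>
  The expression below is the squared distance between difference quotients of \<open>T\<close> with steps \<open>h\<close>
  and \<open>k\<close>; it is small because \<open>second_quotient\<close> is bounded and monotone in both steps.
\<close>

lemma second_quotient_Cauchy:
  assumes r: "0 < r" and e: "0 < e"
  shows "\<exists>d>0. \<forall>h k. 0 < h \<longrightarrow> h \<le> d \<longrightarrow> 0 < k \<longrightarrow> k \<le> d \<longrightarrow>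
    second_quotient \<phi> r h h - 2 * second_quotient \<phi> r h k + second_quotient \<phi> r k k < e"
proof -
  define A where "A = (\<lambda>(h, k). second_quotient \<phi> r h k) ` ({0<..} \<times> {0<..})"
  have bdd: "bdd_above A"
    unfolding A_def by (rule bdd_aboveI[of _ "4 * \<phi> 0 / r\<^sup>2"]) (use second_quotient_le r in auto)
  have ne: "A \<noteq> {}" unfolding A_def by (auto intro!: exI[of _ 1])
  have up: "second_quotient \<phi> r h k \<le> Sup A" if "0 < h" "0 < k" for h k
    by (rule cSup_upper[OF _ bdd]) (use that in \<open>auto simp: A_def\<close>)
  have "\<exists>a\<in>A. Sup A - e / 2 < a"
    by (rule less_cSup_iff[OF ne bdd, THEN iffD1]) (use e in simp)
  then obtain h0 k0 where hk: "0 < h0" "0 < k0" "Sup A - e / 2 < second_quotient \<phi> r h0 k0"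
    by (auto simp: A_def)
  \<comment> \<open>The slack \<open>e / 2\<close> is chosen because the mixed term counts twice:
    the two pure terms are at most \<open>Sup A\<close> each, and twice the mixed one exceeds
    \<open>2 * Sup A - e\<close>.\<close>
  have low: "Sup A - e / 2 < second_quotient \<phi> r h k"
    if "0 < h" "h \<le> min h0 k0" "0 < k" "k \<le> min h0 k0" for h k
    using second_quotient_antimono[of r h h0 k k0] that hk r by simp
  show ?thesis
  proof (intro exI[of _ "min h0 k0"] conjI allI impI)
    fix h k assume "0 < h" "h \<le> min h0 k0" "0 < k" "k \<le> min h0 k0"
    then show "second_quotient \<phi> r h h - 2 * second_quotient \<phi> r h k + second_quotient \<phi> r k k < e"
      using up[of h h] up[of k k] low[of h k] by simp
  qed (use hk in simp)
qed

end

section \<open>The semigroup on L^2: continuity, autocorrelations, smoothing\<close>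

context symmetric_markov_semigroup
begin

lemma T_measurable: "0 \<le> t \<Longrightarrow> f \<in> Lp_space M 2 \<Longrightarrow> T t f \<in> borel_measurable M"
  by (intro L2_measurable maps_L2)

lemma T_contraction: "0 \<le> t \<Longrightarrow> f \<in> Lp_space M 2 \<Longrightarrow> Lp_norm M 2 (T t f) \<le> Lp_norm M 2 f"
  using contractive_Lp[of t 2 f] by simp

lemma T_diff:
  "0 \<le> t \<Longrightarrow> f \<in> Lp_space M 2 \<Longrightarrow> g \<in> Lp_space M 2 \<Longrightarrow>
    AE x in M. T t (\<lambda>y. f y - g y) x = T t f x - T t g x"
  using linear[of t f g 1 "-1"] by simp

lemma T_norm_diff_le:
  assumes "0 \<le> t" "f \<in> Lp_space M 2" "g \<in> Lp_space M 2"
  shows "Lp_norm M 2 (\<lambda>x. T t f x - T t g x) \<le> Lp_norm M 2 (\<lambda>x. f x - g x)"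
proof -
  have "Lp_norm M 2 (\<lambda>x. T t f x - T t g x) = Lp_norm M 2 (T t (\<lambda>y. f y - g y))"
    using T_diff[OF assms] assms
    by (intro Lp_norm_2_cong_AE)
      (auto intro!: borel_measurable_diff T_measurable L2_diff elim: eventually_mono)
  also have "\<dots> \<le> Lp_norm M 2 (\<lambda>x. f x - g x)"
    by (intro T_contraction L2_diff assms)
  finally show ?thesis .
qed

lemma inner_T_T:
  assumes "0 \<le> s" "0 \<le> t" "f \<in> Lp_space M 2" "g \<in> Lp_space M 2"
  shows "L2_inner M (T s f) (T t g) = L2_inner M f (T (s + t) g)"
proof -
  have "L2_inner M (T s f) (T t g) = L2_inner M f (T s (T t g))"
    by (intro symmetric maps_L2 assms)
  also have "\<dots> = L2_inner M f (T (s + t) g)"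
    using T_add[OF assms(1,2,4)] assms
    by (intro L2_inner_cong_AE) (auto intro!: T_measurable maps_L2 L2_measurable elim: eventually_mono)
  finally show ?thesis .
qed

lemma T_norm_diff_time:
  assumes "0 \<le> s" "s \<le> r" "f \<in> Lp_space M 2"
  shows "Lp_norm M 2 (\<lambda>x. T r f x - T s f x) \<le> Lp_norm M 2 (\<lambda>x. T (r - s) f x - f x)"
proof -
  have "AE x in M. T r f x = T s (T (r - s) f) x"
    using T_add[of s "r - s" f] assms by simp
  then have "Lp_norm M 2 (\<lambda>x. T r f x - T s f x) = Lp_norm M 2 (\<lambda>x. T s (T (r - s) f) x - T s f x)"
    using assms by (intro Lp_norm_2_cong_AE)
      (auto intro!: borel_measurable_diff T_measurable maps_L2 elim: eventually_mono)
  also have "\<dots> \<le> Lp_norm M 2 (\<lambda>x. T (r - s) f x - f x)"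
    using assms by (intro T_norm_diff_le maps_L2) auto
  finally show ?thesis .
qed

text \<open>\<open>strongly_continuous\<close> gives only right continuity at 0. By contractivity
  the distance between the orbit at times \<open>s\<close> and \<open>r\<close> is at most that
  between times 0 and \<open>|r - s|\<close>, which covers both sides of \<open>s\<close>.\<close>

lemma T_continuous:
  assumes f: "f \<in> Lp_space M 2" and s: "0 \<le> s"
  shows "((\<lambda>r. Lp_norm M 2 (\<lambda>x. T r f x - T s f x)) \<longlongrightarrow> 0) (at s within {0..})"
proof (rule tendstoI)
  fix e :: real assume e: "0 < e"
  have "\<forall>\<^sub>F h in at_right 0. dist (Lp_norm M 2 (\<lambda>x. T h f x - f x)) 0 < e"
    by (rule tendstoD[OF strongly_continuous[OF f] e])
  then obtain d where d: "0 < d" "\<And>h. 0 < h \<Longrightarrow> h < d \<Longrightarrow> Lp_norm M 2 (\<lambda>x. T h f x - f x) < e"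
    by (auto simp: eventually_at_right_field Lp_norm_2_nonneg)
  show "\<forall>\<^sub>F r in at s within {0..}. dist (Lp_norm M 2 (\<lambda>x. T r f x - T s f x)) 0 < e"
    unfolding eventually_at
  proof (intro exI[of _ d] conjI ballI impI d(1))
    fix r assume r: "r \<in> {0..}" "r \<noteq> s \<and> dist r s < d"
    show "dist (Lp_norm M 2 (\<lambda>x. T r f x - T s f x)) 0 < e"
    proof (cases "s < r")
      case True
      then show ?thesis
        using T_norm_diff_time[OF s _ f, of r] d(2)[of "r - s"] r
        by (simp add: dist_real_def Lp_norm_2_nonneg)
    next
      case False
      then show ?thesis
        using T_norm_diff_time[of r s f] f d(2)[of "s - r"] r
        by (simp add: dist_real_def Lp_norm_2_nonneg Lp_norm_2_minus_commute[of M "T r f"])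
    qed
  qed
qed

text \<open>In spectral terms this is the Laplace transform of the spectral measure of
  \<open>f\<close>, hence completely monotone. Only the signs of its differences up to order three
  are used, and they are derived from the semigroup law, symmetry and contractivity.\<close>

definition autocorr :: "('a \<Rightarrow> real) \<Rightarrow> real \<Rightarrow> real" where
  "autocorr f r = L2_inner M f (T r f)"

lemma autocorr_half:
  "f \<in> Lp_space M 2 \<Longrightarrow> 0 \<le> r \<Longrightarrow> autocorr f r = L2_inner M (T (r / 2) f) (T (r / 2) f)"
  by (simp add: inner_T_T autocorr_def)

lemma autocorr_0: "f \<in> Lp_space M 2 \<Longrightarrow> autocorr f 0 = L2_inner M f f"
  unfolding autocorr_def using T_zero[of f]
  by (intro L2_inner_cong_AE) (auto intro!: L2_measurable maps_L2)

lemma autocorr_nonneg: "f \<in> Lp_space M 2 \<Longrightarrow> 0 \<le> r \<Longrightarrow> 0 \<le> autocorr f r"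
  by (simp add: autocorr_half L2_inner_self_nonneg)

text \<open>With \<open>w = T (r / 2) f\<close>, symmetry rewrites the left side as
  \<open>(w, T h w)\<close>, to which Cauchy-Schwarz and contractivity of \<open>T h\<close>
  apply.\<close>

lemma autocorr_decreasing:
  assumes f: "f \<in> Lp_space M 2" and "0 \<le> r" "0 \<le> h"
  shows "autocorr f (r + h) \<le> autocorr f r"
proof -
  define w where "w = T (r / 2) f"
  have w: "w \<in> Lp_space M 2" using assms by (simp add: w_def maps_L2)
  have "autocorr f (r + h) = L2_inner M w (T (r / 2 + h) f)"
    using inner_T_T[of "r/2" "r/2 + h" f f] assms by (simp add: autocorr_def w_def)
  also have "\<dots> = L2_inner M w (T h w)"
    using T_add[of h "r/2" f] assms w unfolding w_def
    by (intro L2_inner_cong_AE) (auto intro!: T_measurable maps_L2 L2_measurable simp: add.commute)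
  also have "\<dots> \<le> Lp_norm M 2 w * Lp_norm M 2 (T h w)"
    using Cauchy_Schwarz_L2[of w M "T h w"] w assms by (auto simp: maps_L2)
  also have "\<dots> \<le> Lp_norm M 2 w * Lp_norm M 2 w"
    by (intro mult_left_mono T_contraction w assms Lp_norm_2_nonneg)
  also have "\<dots> = autocorr f r"
    using assms by (simp add: autocorr_half w_def Lp_norm_2_sq flip: power2_eq_square)
  finally show ?thesis .
qed

text \<open>By symmetry and the semigroup law, inner products of orbit increments are combinations
  of values of one function of time. This reduces the study of the generator to convexity of real
  functions.\<close>

lemma inner_increments:
  assumes f: "f \<in> Lp_space M 2" and "0 \<le> s" "0 \<le> h" "0 \<le> k"
  shows "L2_inner M (\<lambda>x. T s f x - T (s + h) f x) (\<lambda>x. T s f x - T (s + k) f x) =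
    autocorr f (2 * s) - autocorr f (2 * s + h) - autocorr f (2 * s + k) + autocorr f (2 * s + h + k)"
proof -
  have [simp]: "T s f \<in> Lp_space M 2" "T (s + h) f \<in> Lp_space M 2" "T (s + k) f \<in> Lp_space M 2"
    using assms by (auto simp: maps_L2)
  show ?thesis using assms
    by (simp add: L2_inner_diff_left L2_inner_diff_right L2_diff inner_T_T autocorr_def)
      (simp add: algebra_simps)
qed

text \<open>A second difference of an autocorrelation is again an autocorrelation, of an increment.
  So each known sign yields the sign two orders higher: nonnegativity gives convexity, and
  monotonicity gives convexity of the decrement.\<close>

lemma autocorr_increment:
  assumes f: "f \<in> Lp_space M 2" and "0 \<le> r" "0 \<le> k"
  shows "autocorr (\<lambda>x. f x - T k f x) r = autocorr f r - 2 * autocorr f (r + k) + autocorr f (r + 2 * k)"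
proof -
  let ?v = "\<lambda>x. f x - T k f x"
  have v: "?v \<in> Lp_space M 2" using assms by (intro L2_diff maps_L2)
  have "AE x in M. T (r/2) ?v x = T (r/2) f x - T (r/2 + k) f x"
    using T_diff[of "r/2" f "T k f"] T_add[of "r/2" k f] assms
    by (auto simp: maps_L2 elim!: eventually_elim2)
  then have "autocorr ?v r = L2_inner M (\<lambda>x. T (r/2) f x - T (r/2 + k) f x) (\<lambda>x. T (r/2) f x - T (r/2 + k) f x)"
    unfolding autocorr_half[OF v \<open>0 \<le> r\<close>] using assms v
    by (intro L2_inner_cong_AE) (auto intro!: T_measurable borel_measurable_diff)
  also have "\<dots> = autocorr f r - 2 * autocorr f (r + k) + autocorr f (r + 2 * k)"
    using inner_increments[OF f, of "r / 2" k k] assms by (simp add: add.assoc)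
  finally show ?thesis .
qed

lemma continuous_on_autocorr:
  assumes f: "f \<in> Lp_space M 2"
  shows "continuous_on {0..} (autocorr f)"
  unfolding continuous_on_def autocorr_def
proof (intro ballI L2_inner_tendsto)
  fix s :: real assume "s \<in> {0..}"
  then have s: "0 \<le> s" by simp
  show "T s f \<in> Lp_space M 2" by (intro maps_L2 s f)
  show "\<forall>\<^sub>F r in at s within {0..}. T r f \<in> Lp_space M 2"
    using f by (auto simp: eventually_at_filter maps_L2)
  show "((\<lambda>r. Lp_norm M 2 (\<lambda>x. T r f x - T s f x)) \<longlongrightarrow> 0) (at s within {0..})"
    by (rule T_continuous[OF f s])
qed (rule f)

lemma convex_on_autocorr:
  assumes f: "f \<in> Lp_space M 2"
  shows "convex_on {0..} (autocorr f)"
proof (rule midpoint_convex_imp_convex_on[OF continuous_on_autocorr[OF f]])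
  fix r k :: real assume "0 \<le> r" "0 \<le> k"
  then show "0 \<le> autocorr f r - 2 * autocorr f (r + k) + autocorr f (r + 2 * k)"
    using autocorr_nonneg[of "\<lambda>x. f x - T k f x" r] f
    by (simp add: autocorr_increment L2_diff maps_L2)
qed

lemma convex_on_autocorr_decrement:
  assumes f: "f \<in> Lp_space M 2" and h: "0 \<le> h"
  shows "convex_on {0..} (\<lambda>r. autocorr f r - autocorr f (r + h))"
proof (rule midpoint_convex_imp_convex_on)
  have "continuous_on {0..} (\<lambda>r. autocorr f (r + h))"
    by (rule continuous_on_compose2[OF continuous_on_autocorr[OF f]])
      (use h in \<open>auto intro!: continuous_intros\<close>)
  then show "continuous_on {0..} (\<lambda>r. autocorr f r - autocorr f (r + h))"
    by (intro continuous_intros continuous_on_autocorr f)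
  fix r k :: real assume "0 \<le> r" "0 \<le> k"
  then show "0 \<le> (autocorr f r - autocorr f (r + h)) - 2 * (autocorr f (r + k) - autocorr f (r + k + h))
      + (autocorr f (r + 2 * k) - autocorr f (r + 2 * k + h))"
    using autocorr_decreasing[of "\<lambda>x. f x - T k f x" r h] f h
    by (simp add: autocorr_increment L2_diff maps_L2 add_ac)
qed

lemmas autocorr_axioms = autocorr_nonneg convex_on_autocorr convex_on_autocorr_decrement
  autocorr_decreasing

text \<open>The bound \<open>4 / r^2\<close> on second quotients becomes \<open>1 / s^2\<close> at
  \<open>r = 2 * s\<close>. This replaces the spectral estimate of ||A T_s f|| by a multiple of
  ||f|| / s.\<close>

lemma T_increment_norm_le:
  assumes f: "f \<in> Lp_space M 2" and s: "0 < s" and h: "0 < h"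
  shows "Lp_norm M 2 (\<lambda>x. T s f x - T (s + h) f x) \<le> h / s * Lp_norm M 2 f"
proof (rule power2_le_imp_le)
  have "(Lp_norm M 2 (\<lambda>x. T s f x - T (s + h) f x))\<^sup>2 = h\<^sup>2 * second_quotient (autocorr f) (2 * s) h h"
    using assms unfolding Lp_norm_2_sq second_quotient_def
    by (subst inner_increments) (auto simp: power2_eq_square)
  also have "\<dots> \<le> h\<^sup>2 * (4 * autocorr f 0 / (2 * s)\<^sup>2)"
    using assms by (intro mult_left_mono second_quotient_le autocorr_axioms) auto
  also have "\<dots> = (h / s * Lp_norm M 2 f)\<^sup>2"
    using f by (simp add: power_mult_distrib power_divide Lp_norm_2_sq autocorr_0)
  finally show "(Lp_norm M 2 (\<lambda>x. T s f x - T (s + h) f x))\<^sup>2 \<le> (h / s * Lp_norm M 2 f)\<^sup>2" .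
qed (use assms in \<open>simp add: Lp_norm_2_nonneg\<close>)

text \<open>The inner products of the difference quotients \<open>D h\<close> and \<open>D k\<close>
  are second quotients of the autocorrelation at \<open>2 * s\<close>, so the quotients form a
  Cauchy family as the steps shrink. Completeness supplies a limit along the steps
  \<open>1 / (n + 1)\<close>, and the Cauchy property extends it to all steps.\<close>

lemma T_in_generator_domain:
  assumes f: "f \<in> Lp_space M 2" and s: "0 < s"
  shows "\<exists>g. (T s f, g) \<in> semigroup_generator M T"
proof -
  define D where "D h x = (T s f x - T (s + h) f x) / h" for h x
  have D_L2: "D h \<in> Lp_space M 2" if "0 < h" for h
    unfolding D_def using that s f by (intro L2_divide L2_diff maps_L2) auto
  have D_inner: "L2_inner M (D h) (D k) = second_quotient (autocorr f) (2 * s) h k"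
    if "0 < h" "0 < k" for h k
    unfolding D_def second_quotient_def L2_inner_divide_left L2_inner_divide_right
    using that s f by (subst inner_increments) auto
  have Cauchy: "\<exists>d>0. \<forall>h k. 0 < h \<longrightarrow> h \<le> d \<longrightarrow> 0 < k \<longrightarrow> k \<le> d \<longrightarrow> Lp_norm M 2 (\<lambda>x. D h x - D k x) < e"
    if e: "0 < e" for e
  proof -
    obtain d where d: "0 < d" and dd: "\<And>h k. 0 < h \<Longrightarrow> h \<le> d \<Longrightarrow> 0 < k \<Longrightarrow> k \<le> d \<Longrightarrow>
      second_quotient (autocorr f) (2 * s) h h - 2 * second_quotient (autocorr f) (2 * s) h k
        + second_quotient (autocorr f) (2 * s) k k < e\<^sup>2"
      using second_quotient_Cauchy[of "autocorr f" "2 * s" "e\<^sup>2"] autocorr_axioms f s e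
      by (metis (no_types, lifting) mult_pos_pos zero_less_numeral zero_less_power)
    have "Lp_norm M 2 (\<lambda>x. D h x - D k x) < e" if hk: "0 < h" "h \<le> d" "0 < k" "k \<le> d" for h k
    proof -
      have "(Lp_norm M 2 (\<lambda>x. D h x - D k x))\<^sup>2 =
          L2_inner M (D h) (D h) - 2 * L2_inner M (D h) (D k) + L2_inner M (D k) (D k)"
        using D_L2 hk by (simp add: Lp_norm_2_sq L2_inner_diff_left L2_inner_diff_right L2_diff
            L2_inner_commute[of M "D k" "D h"])
      also have "\<dots> < e\<^sup>2" using dd[OF hk] hk by (simp add: D_inner)
      finally show ?thesis using e by (simp add: power_less_imp_less_base)
    qed
    then show ?thesis using d by blast
  qed
  define h where "h n = inverse (real (Suc n))" for n
  have h0: "0 < h n" for n by (simp add: h_def)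
  have hlim: "h \<longlonglongrightarrow> 0" unfolding h_def by (rule LIMSEQ_inverse_real_of_nat)
  have "\<exists>G \<in> Lp_space M 2. (\<lambda>n. Lp_norm M 2 (\<lambda>x. D (h n) x - G x)) \<longlonglongrightarrow> 0"
  proof (rule L2_complete)
    fix e :: real assume "0 < e"
    then obtain d where d: "0 < d" "\<And>h k. 0 < h \<Longrightarrow> h \<le> d \<Longrightarrow> 0 < k \<Longrightarrow> k \<le> d \<Longrightarrow>
      Lp_norm M 2 (\<lambda>x. D h x - D k x) < e" using Cauchy by metis
    have "\<forall>\<^sub>F n in sequentially. h n < d" by (rule order_tendstoD(2)[OF hlim d(1)])
    then obtain N where "\<And>n. n \<ge> N \<Longrightarrow> h n < d" by (auto simp: eventually_sequentially)
    then show "\<exists>N. \<forall>m\<ge>N. \<forall>n\<ge>N. Lp_norm M 2 (\<lambda>x. D (h m) x - D (h n) x) < e"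
      using d(2) h0 by (meson less_imp_le)
  qed (use D_L2 h0 in auto)
  then obtain G where G: "G \<in> Lp_space M 2" "(\<lambda>n. Lp_norm M 2 (\<lambda>x. D (h n) x - G x)) \<longlonglongrightarrow> 0" by blast
  have DG: "((\<lambda>k. Lp_norm M 2 (\<lambda>x. D k x - G x)) \<longlongrightarrow> 0) (at_right 0)"
  proof (rule tendstoI)
    fix e :: real assume e: "0 < e"
    then obtain d where d: "0 < d" "\<And>h k. 0 < h \<Longrightarrow> h \<le> d \<Longrightarrow> 0 < k \<Longrightarrow> k \<le> d \<Longrightarrow>
      Lp_norm M 2 (\<lambda>x. D h x - D k x) < e / 2" using Cauchy[of "e / 2"] by (metis half_gt_zero)
    have "\<forall>\<^sub>F n in sequentially. h n < d \<and> Lp_norm M 2 (\<lambda>x. D (h n) x - G x) < e / 2"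
      using order_tendstoD(2)[OF hlim d(1)] order_tendstoD(2)[OF G(2), of "e / 2"] e
      by (auto elim: eventually_elim2)
    then obtain n where n: "h n < d" "Lp_norm M 2 (\<lambda>x. D (h n) x - G x) < e / 2"
      by (auto simp: eventually_sequentially)
    have "Lp_norm M 2 (\<lambda>x. D k x - G x) < e" if k: "0 < k" "k < d" for k
      using Lp_norm_2_triangle[OF D_L2[OF k(1)] D_L2[OF h0[of n]] G(1)] d(2)[of k "h n"] n h0[of n] k
      by simp
    then show "\<forall>\<^sub>F k in at_right 0. dist (Lp_norm M 2 (\<lambda>x. D k x - G x)) 0 < e"
      using d(1) by (auto simp: eventually_at_right_field Lp_norm_2_nonneg)
  qed
  have eq: "Lp_norm M 2 (\<lambda>x. (T s f x - T k (T s f) x) / k - G x) = Lp_norm M 2 (\<lambda>x. D k x - G x)"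
    if "0 < k" for k
  proof (rule Lp_norm_2_cong_AE)
    show "AE x in M. (T s f x - T k (T s f) x) / k - G x = D k x - G x"
      using T_add[of k s f] that s f by (auto simp: D_def add.commute elim!: eventually_mono)
    show "(\<lambda>x. (T s f x - T k (T s f) x) / k - G x) \<in> borel_measurable M"
      using that s f G(1)
      by (intro L2_measurable[OF L2_diff] L2_divide L2_diff maps_L2) auto
    show "(\<lambda>x. D k x - G x) \<in> borel_measurable M"
      using that by (intro L2_measurable[OF L2_diff] D_L2 G)
  qed
  have "((\<lambda>k. Lp_norm M 2 (\<lambda>x. (T s f x - T k (T s f) x) / k - G x)) \<longlongrightarrow> 0) (at_right 0)"
    by (rule Lim_transform_eventually[OF DG]) (auto simp: eq eventually_at_right_less eventually_at_filter)
  then show ?thesis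
    using G(1) f s by (auto simp: semigroup_generator_def maps_L2)
qed

end

section \<open>Real inequalities\<close>

text \<open>Convexity of \<open>z powr q\<close>: the graph lies above its tangent at
  \<open>v\<close>. The point 0 is split off because the derivative is available only at positive
  arguments; for \<open>v = 0\<close> the right side is 0 also when \<open>q = 1\<close>, as
  \<open>0 powr 0 = 0\<close>.\<close>

lemma powr_tangent_le:
  fixes u v q :: real
  assumes "0 \<le> u" "0 \<le> v" "1 \<le> q"
  shows "v powr q - u powr q \<le> q * v powr (q - 1) * (v - u)"
proof -
  have der: "((\<lambda>x. x powr q) has_real_derivative q * z powr (q - 1)) (at z)" if "0 < z" for z
    using that by (auto intro!: derivative_eq_intros)
  consider "v = 0" | "u = 0" "0 < v" | "0 < u" "u < v" | "0 < v" "v < u" | "u = v"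
    using assms by linarith
  then show ?thesis
  proof cases
    case 2
    then have "v powr q = v powr (q - 1) * v"
      using powr_add[of v "q - 1" 1] by simp
    then show ?thesis using 2 assms mult_right_mono[of 1 q "v powr (q - 1) * v"] by simp
  next
    case 3
    then obtain z where z: "u < z" "z < v" "v powr q - u powr q = (v - u) * (q * z powr (q - 1))"
      using MVT2[of u v "\<lambda>x. x powr q" "\<lambda>z. q * z powr (q - 1)"] der by auto
    moreover have "z powr (q - 1) \<le> v powr (q - 1)"
      using z 3 assms by (intro powr_mono2) auto
    ultimately show ?thesis using 3 assms
      by (simp add: mult.commute[of _ "v - u"] mult_left_mono)
  next
    case 4
    then obtain z where z: "v < z" "z < u" "u powr q - v powr q = (u - v) * (q * z powr (q - 1))"
      using MVT2[of v u "\<lambda>x. x powr q" "\<lambda>z. q * z powr (q - 1)"] der by auto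
    moreover have "v powr (q - 1) \<le> z powr (q - 1)"
      using z 4 assms by (intro powr_mono2) auto
    ultimately have "(u - v) * (q * v powr (q - 1)) \<le> u powr q - v powr q" using 4 assms
      by (simp add: mult_left_mono)
    then show ?thesis by (simp add: algebra_simps)
  qed auto
qed

text \<open>The pointwise Stroock-Varopoulos inequality. For \<open>b \<le> a\<close> one factor of
  the square is bounded by the tangent at \<open>a\<close>, and the factor
  \<open>a powr (c - 1)\<close> is then absorbed by monotonicity of powers. The sharp constant would
  be \<open>c^2 / (2 * c - 1)\<close>; the cruder \<open>c\<close> is exactly what
  \<open>\<epsilon> = p / p'\<close> requires at \<open>c = p / 2\<close>.\<close>

lemma powr_square_diff_le:
  fixes a b c :: real
  assumes "0 \<le> a" "0 \<le> b" "1 \<le> c"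
  shows "(a powr c - b powr c)\<^sup>2 \<le> c * ((a - b) * (a powr (2 * c - 1) - b powr (2 * c - 1)))"
proof -
  have *: "(a powr c - b powr c)\<^sup>2 \<le> c * ((a - b) * (a powr (2 * c - 1) - b powr (2 * c - 1)))"
    if "0 \<le> b" "b \<le> a" for a b :: real
  proof -
    have mono: "b powr r \<le> a powr r" if "0 \<le> r" for r
      using that \<open>0 \<le> b\<close> \<open>b \<le> a\<close> by (intro powr_mono2) auto
    have split: "z powr (2 * c - 1) = z powr (c - 1) * z powr c" for z :: real
      by (simp add: powr_add[symmetric])
    have "(a powr c - b powr c)\<^sup>2 \<le> (c * a powr (c - 1) * (a - b)) * (a powr c - b powr c)"
      unfolding power2_eq_square using that assms(3) mono[of c]
      by (intro mult_right_mono powr_tangent_le) auto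
    also have "\<dots> = c * ((a - b) * (a powr (c - 1) * a powr c - a powr (c - 1) * b powr c))"
      by (simp add: algebra_simps)
    also have "\<dots> \<le> c * ((a - b) * (a powr (2 * c - 1) - b powr (2 * c - 1)))"
      unfolding split using that assms(3) mono[of "c - 1"]
      by (intro mult_left_mono diff_left_mono mult_right_mono) auto
    finally show ?thesis .
  qed
  show ?thesis
  proof (cases "b \<le> a")
    case True
    then show ?thesis using * assms by blast
  next
    case False
    have "(b - a) * (b powr (2 * c - 1) - a powr (2 * c - 1)) = (a - b) * (a powr (2 * c - 1) - b powr (2 * c - 1))"
      by (simp add: algebra_simps)
    then show ?thesis using *[of a b] False assms
      by (simp add: power2_commute[of "b powr c"])
  qed
qed

section \<open>Bounds for powers and logarithms on [0, K], uniform in exponents up to P\<close>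

lemma powr_le_powr_bound:
  fixes x K r P :: real
  assumes "0 \<le> x" "x \<le> K" "1 \<le> K" "0 \<le> r" "r \<le> P"
  shows "x powr r \<le> K powr P"
proof -
  have "x powr r \<le> K powr r" using assms by (intro powr_mono2) auto
  also have "\<dots> \<le> K powr P" using assms by (intro powr_mono) auto
  finally show ?thesis .
qed

text \<open>\<open>|ln x|\<close> is at most \<open>4 * (x powr (1/4) + x powr (-1/4))\<close>, so a
  quarter of the exponent is given away at each end: \<open>1/4 \<le> r\<close> tames the
  singularity at 0, and \<open>r + 1/4 \<le> P\<close> the growth up to \<open>K\<close>.\<close>

lemma powr_mult_abs_ln_le:
  fixes x K r P :: real
  assumes "0 < x" "x \<le> K" "1 \<le> K" "1/4 \<le> r" "r + 1/4 \<le> P"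
  shows "x powr r * \<bar>ln x\<bar> \<le> 8 * K powr P"
proof -
  have ln_le: "ln y \<le> 4 * y powr (1/4)" if "0 < y" for y :: real
    using ln_le_minus_one[of "y powr (1/4)"] that by (simp add: ln_powr)
  have "\<bar>ln x\<bar> \<le> 4 * (x powr (1/4) + x powr (-1/4))"
  proof -
    have "- ln x = ln (1 / x)" using assms by (simp add: ln_div)
    also have "\<dots> \<le> 4 * (1 / x) powr (1/4)" using assms by (intro ln_le) auto
    also have "(1 / x) powr (1/4) = x powr (-1/4)"
      using assms by (simp add: powr_divide powr_minus_divide)
    finally show ?thesis using ln_le[of x] assms
      by (smt (verit) powr_ge_zero)
  qed
  then have "x powr r * \<bar>ln x\<bar> \<le> x powr r * (4 * (x powr (1/4) + x powr (-1/4)))"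
    by (intro mult_left_mono) auto
  also have "\<dots> = 4 * x powr (r + 1/4) + 4 * x powr (r - 1/4)"
    using powr_add[of x r "1/4"] powr_add[of x r "-1/4"] by (simp add: algebra_simps)
  also have "\<dots> \<le> 4 * K powr P + 4 * K powr P"
    using assms by (intro add_mono mult_left_mono powr_le_powr_bound) auto
  finally show ?thesis by simp
qed

lemma powr_exponent_MVT:
  fixes x p q :: real
  assumes "0 < x" "p < q"
  shows "\<exists>r. p < r \<and> r < q \<and> x powr q - x powr p = (q - p) * (x powr r * ln x)"
proof -
  have "((\<lambda>r. x powr r) has_real_derivative x powr r * ln x) (at r)" for r
    using \<open>0 < x\<close> by (auto intro!: derivative_eq_intros)
  then show ?thesis
    using MVT2[OF \<open>p < q\<close>, of "\<lambda>r. x powr r" "\<lambda>r. x powr r * ln x"] by blast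
qed

context
  fixes K P x :: real
  assumes K: "1 \<le> K" and x: "0 \<le> x" "x \<le> K"
begin

text \<open>One factor \<open>x\<close> is split off before the logarithm is absorbed. With an
  integrable function in place of \<open>x\<close> this is an integrable majorant, which a constant
  is not on an infinite measure space.\<close>

lemma powr_mult_abs_ln_le_linear:
  assumes "2 \<le> p" "p \<le> P"
  shows "\<bar>x powr p * ln x\<bar> \<le> 8 * K powr P * x"
proof (cases "x = 0")
  case False
  have "x powr p = x powr (p - 1) * x"
    using False x powr_add[of x "p - 1" 1] by simp
  then have "\<bar>x powr p * ln x\<bar> = (x powr (p - 1) * \<bar>ln x\<bar>) * x"
    using x by (simp add: abs_mult)
  also have "\<dots> \<le> (8 * K powr P) * x"
    using False x K assms by (intro mult_right_mono powr_mult_abs_ln_le) auto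
  finally show ?thesis .
qed simp

lemma powr_exponent_diff_le:
  assumes "2 \<le> p" "p \<le> q" "q \<le> P"
  shows "\<bar>x powr q - x powr p\<bar> \<le> 8 * K powr P * (q - p) * x"
proof (cases "x = 0 \<or> p = q")
  case False
  then obtain r where r: "p < r" "r < q" "x powr q - x powr p = (q - p) * (x powr r * ln x)"
    using powr_exponent_MVT[of x p q] x assms by auto
  have "\<bar>x powr q - x powr p\<bar> \<le> (q - p) * (8 * K powr P * x)"
    unfolding r(3) abs_mult[of "q - p"] using r(1,2) assms
    by (intro mult_mono powr_mult_abs_ln_le_linear) auto
  then show ?thesis by (simp add: mult_ac)
qed auto

text \<open>This difference is later multiplied by an increment that lies in L^2, so the factor kept
  is \<open>sqrt x\<close>, which lies in L^2 once \<open>x\<close> is an integrable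
  function.\<close>

lemma powr_exponent_diff_le_sqrt:
  assumes "2 \<le> p" "p \<le> q" "q \<le> P"
  shows "\<bar>x powr (q - 1) - x powr (p - 1)\<bar> \<le> 8 * K powr P * (q - p) * sqrt x"
proof (cases "x = 0 \<or> p = q")
  case False
  then obtain r where r: "p - 1 < r" "r < q - 1"
    "x powr (q - 1) - x powr (p - 1) = (q - p) * (x powr r * ln x)"
    using powr_exponent_MVT[of x "p - 1" "q - 1"] x assms by auto
  have "x powr r = x powr (r - 1/2) * sqrt x"
    using False x by (simp add: powr_half_sqrt[symmetric] flip: powr_add)
  then have "\<bar>x powr (q - 1) - x powr (p - 1)\<bar> = (q - p) * ((x powr (r - 1/2) * \<bar>ln x\<bar>) * sqrt x)"
    using r x assms by (simp add: abs_mult)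
  also have "\<dots> \<le> (q - p) * ((8 * K powr P) * sqrt x)"
    using False r x K assms by (intro mult_left_mono mult_right_mono powr_mult_abs_ln_le) auto
  finally show ?thesis by (simp add: mult_ac)
qed auto

text \<open>Two uses of the mean value theorem give a remainder with
  \<open>x powr s * (ln x)^2\<close>. Written as the square of
  \<open>x powr ((s - 1) / 2) * ln x\<close> times \<open>x\<close>, it splits into a bounded part
  and an integrable one.\<close>

lemma powr_exponent_Taylor:
  assumes "2 \<le> p" "p \<le> q" "q \<le> P"
  shows "x powr q - x powr p \<le> (q - p) * (x powr p * ln x) + (8 * K powr P)\<^sup>2 * (q - p)\<^sup>2 * x"
proof (cases "x = 0 \<or> p = q")
  case False
  then obtain r where r: "p < r" "r < q" "x powr q - x powr p = (q - p) * (x powr r * ln x)"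
    using powr_exponent_MVT[of x p q] x assms by auto
  obtain s where s: "p < s" "s < r" "x powr r - x powr p = (r - p) * (x powr s * ln x)"
    using powr_exponent_MVT[of x p r] x False r by auto
  have x0: "0 < x" using False x by simp
  have sq: "x powr s = (x powr ((s - 1) / 2))\<^sup>2 * x"
    using x0 powr_add[of x "s - 1" 1] powr_add[of x "(s - 1) / 2" "(s - 1) / 2"]
    by (simp add: power2_eq_square)
  have "(s - 1) / 2 + 1/4 \<le> P" using r(1,2) s(1,2) assms by argo
  moreover have "1/4 \<le> (s - 1) / 2" using s(1) assms by simp
  ultimately have "(x powr ((s - 1) / 2) * \<bar>ln x\<bar>)\<^sup>2 \<le> (8 * K powr P)\<^sup>2"
    by (intro power_mono powr_mult_abs_ln_le) (use x x0 K in auto)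
  then have "(r - p) * ((x powr ((s - 1) / 2) * \<bar>ln x\<bar>)\<^sup>2 * x) \<le> (q - p) * ((8 * K powr P)\<^sup>2 * x)"
    using r s x by (intro mult_mono mult_right_mono) auto
  moreover have "(x powr r - x powr p) * ln x = (r - p) * ((x powr ((s - 1) / 2) * \<bar>ln x\<bar>)\<^sup>2 * x)"
    unfolding s(3) sq by (simp add: power_mult_distrib power2_eq_square mult_ac)
  ultimately have "x powr r * ln x \<le> x powr p * ln x + (8 * K powr P)\<^sup>2 * (q - p) * x"
    by (simp add: algebra_simps)
  then have "(q - p) * (x powr r * ln x) \<le> (q - p) * (x powr p * ln x + (8 * K powr P)\<^sup>2 * (q - p) * x)"
    using assms by (intro mult_left_mono) auto
  then show ?thesis using r(3) by (simp add: algebra_simps power2_eq_square)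
qed auto

lemma powr_diff_le:
  assumes p: "2 \<le> p" "p \<le> P" and y: "0 \<le> y" "y \<le> K"
  shows "\<bar>x powr p - y powr p\<bar> \<le> P * K powr P * ((x + y) * \<bar>x - y\<bar>)"
    and "\<bar>x powr (p - 1) - y powr (p - 1)\<bar> \<le> P * K powr P * \<bar>x - y\<bar>"
proof -
  have 1: "b powr p \<le> a powr p \<and> a powr p - b powr p \<le> P * K powr P * ((a + b) * (a - b))"
    if "0 \<le> b" "b \<le> a" "a \<le> K" for a b
  proof
    show "b powr p \<le> a powr p" using that p by (intro powr_mono2) auto
    have "a powr p - b powr p \<le> p * a powr (p - 1) * (a - b)"
      using that p by (intro powr_tangent_le) auto
    also have "a powr (p - 1) = a powr (p - 2) * a"
      using that powr_add[of a "p - 2" 1] by (cases "a = 0") auto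
    also have "p * (a powr (p - 2) * a) * (a - b) \<le> P * (K powr P * (a + b)) * (a - b)"
      using that p K by (intro mult_mono mult_right_mono powr_le_powr_bound) auto
    finally show "a powr p - b powr p \<le> P * K powr P * ((a + b) * (a - b))"
      by (simp add: mult_ac)
  qed
  show "\<bar>x powr p - y powr p\<bar> \<le> P * K powr P * ((x + y) * \<bar>x - y\<bar>)"
    using 1[of y x] 1[of x y] x y by (cases "y \<le> x") (auto simp: add.commute)
  have 2: "b powr (p - 1) \<le> a powr (p - 1) \<and> a powr (p - 1) - b powr (p - 1) \<le> P * K powr P * (a - b)"
    if "0 \<le> b" "b \<le> a" "a \<le> K" for a b
  proof
    show "b powr (p - 1) \<le> a powr (p - 1)" using that p by (intro powr_mono2) auto
    have "a powr (p - 1) - b powr (p - 1) \<le> (p - 1) * a powr (p - 1 - 1) * (a - b)"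
      using that p by (intro powr_tangent_le) auto
    also have "\<dots> \<le> P * K powr P * (a - b)"
      using that p K by (intro mult_mono mult_right_mono powr_le_powr_bound) auto
    finally show "a powr (p - 1) - b powr (p - 1) \<le> P * K powr P * (a - b)" .
  qed
  show "\<bar>x powr (p - 1) - y powr (p - 1)\<bar> \<le> P * K powr P * \<bar>x - y\<bar>"
    using 2[of y x] 2[of x y] x y by (cases "y \<le> x") auto
qed

end

text \<open>The derivative \<open>2 * z * ln z + z\<close> is
  \<open>sqrt z * (2 * (sqrt z * ln z) + sqrt z)\<close>, and the bracket is at most
  \<open>2 * (8 * K) + K\<close>, whence 17. The point 0 is treated apart, as \<open>ln\<close> is
  not differentiable there.\<close>

lemma square_ln_diff_le:
  fixes x y K :: real
  assumes K: "1 \<le> K" and x: "0 \<le> x" "x \<le> K" and y: "0 \<le> y" "y \<le> K"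
  shows "\<bar>x\<^sup>2 * ln x - y\<^sup>2 * ln y\<bar> \<le> 17 * K * ((sqrt x + sqrt y) * \<bar>x - y\<bar>)"
proof -
  have bd: "sqrt z * \<bar>ln z\<bar> \<le> 8 * K" if "0 < z" "z \<le> K" for z
    using powr_mult_abs_ln_le[of z K "1/2" 1] that K by (simp add: powr_half_sqrt)
  have sq: "sqrt z \<le> K" if "z \<le> K" for z
  proof -
    have "sqrt z \<le> sqrt K" using that by simp
    also have "\<dots> \<le> K" using K by (simp add: real_le_lsqrt power2_eq_square)
    finally show ?thesis .
  qed
  have *: "\<bar>a\<^sup>2 * ln a - b\<^sup>2 * ln b\<bar> \<le> 17 * K * ((sqrt a + sqrt b) * (a - b))"
    if "0 \<le> b" "b < a" "a \<le> K" for a b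
  proof (cases "b = 0")
    case True
    have "\<bar>a\<^sup>2 * ln a\<bar> = (sqrt a * \<bar>ln a\<bar>) * (sqrt a * a)"
      using that by (simp add: abs_mult power2_eq_square)
    also have "\<dots> \<le> (17 * K) * (sqrt a * a)"
      using that bd[of a] K True by (intro mult_right_mono) auto
    finally show ?thesis using True by simp
  next
    case False
    have "\<exists>z. b < z \<and> z < a \<and> a\<^sup>2 * ln a - b\<^sup>2 * ln b = (a - b) * (2 * z * ln z + z)"
      using that False
      by (intro MVT2) (auto intro!: derivative_eq_intros simp: power2_eq_square)
    then obtain z where z: "b < z" "z < a" "a\<^sup>2 * ln a - b\<^sup>2 * ln b = (a - b) * (2 * z * ln z + z)"
      by blast
    have "\<bar>2 * z * ln z + z\<bar> \<le> 2 * z * \<bar>ln z\<bar> + z"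
      using z that by (simp add: abs_mult abs_triangle_ineq order.trans[OF abs_triangle_ineq])
    also have "\<dots> = sqrt z * (2 * (sqrt z * \<bar>ln z\<bar>) + sqrt z)"
      using z that by (simp add: algebra_simps)
    also have "\<dots> \<le> sqrt z * (2 * (8 * K) + K)"
      using z that bd[of z] sq[of z] by (intro mult_left_mono add_mono) auto
    also have "\<dots> \<le> (sqrt a + sqrt b) * (2 * (8 * K) + K)"
      using z that K by (intro mult_right_mono) (auto intro: add_increasing2)
    finally have "(a - b) * \<bar>2 * z * ln z + z\<bar> \<le> (a - b) * ((sqrt a + sqrt b) * (17 * K))"
      using that by (intro mult_left_mono) auto
    then show ?thesis unfolding z(3) abs_mult using that by (simp add: mult_ac)
  qed
  consider "x = y" | "y < x" | "x < y" by linarith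
  then show ?thesis
    using *[of y x] *[of x y] x y by cases (auto simp: add.commute abs_minus_commute)
qed

text \<open>Tilting \<open>G\<close> by a small slope \<open>e\<close> gives slack: at the last
  point \<open>c\<close> where the tilted function is still at most \<open>G a\<close>, the Dini
  condition would carry it further right unless \<open>c = b\<close>. The \<open>+ 1\<close> in
  \<open>e\<close> keeps the denominator positive when \<open>a = b\<close>.\<close>

lemma Dini_nonincreasing:
  fixes G :: "real \<Rightarrow> real"
  assumes ab: "a \<le> b" and cont: "continuous_on {a..b} G"
    and Dini: "\<And>s e. a \<le> s \<Longrightarrow> s < b \<Longrightarrow> 0 < e \<Longrightarrow> \<forall>\<^sub>F h in at_right 0. G (s + h) \<le> G s + e * h"
  shows "G b \<le> G a"
proof (rule field_le_epsilon)
  fix d :: real assume d: "0 < d"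
  define e where "e = d / (b - a + 1)"
  have e: "0 < e" using d ab by (simp add: e_def)
  define g where "g s = G s - e * (s - a)" for s
  have cg: "continuous_on {a..b} g" unfolding g_def by (intro continuous_intros cont)
  have "closed ({a..b} \<inter> g -` {..G a})" by (rule continuous_closed_preimage[OF cg]) auto
  then have "compact ({a..b} \<inter> g -` {..G a})"
    by (metis compact_Icc compact_Int_closed inf.left_idem)
  moreover have "a \<in> {a..b} \<inter> g -` {..G a}" using ab by (simp add: g_def)
  ultimately have "\<exists>c\<in>{a..b} \<inter> g -` {..G a}. \<forall>z\<in>{a..b} \<inter> g -` {..G a}. z \<le> c"
    by (intro compact_attains_sup) auto
  then obtain c where c: "a \<le> c" "c \<le> b" "g c \<le> G a"
    and max: "\<And>z. a \<le> z \<Longrightarrow> z \<le> b \<Longrightarrow> g z \<le> G a \<Longrightarrow> z \<le> c" by auto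
  have "c = b"
  proof (rule ccontr)
    assume "c \<noteq> b"
    then have "\<forall>\<^sub>F h in at_right 0. G (c + h) \<le> G c + e * h \<and> 0 < h \<and> h < b - c"
      using Dini[of c e] c e eventually_at_right[of 0 "b - c"]
      by (intro eventually_conj eventually_at_right_less)
        (auto simp: eventually_at_right_field intro: exI[of _ "b - c"])
    then obtain h where h: "G (c + h) \<le> G c + e * h" "0 < h" "h < b - c"
      using eventually_happens'[of "at_right (0::real)"] by (auto simp: trivial_limit_at_right_real)
    have "g (c + h) \<le> G a" using h c(3) by (simp add: g_def algebra_simps)
    then show False using max[of "c + h"] h c by simp
  qed
  then have "G b \<le> G a + e * (b - a)" using c(3) by (simp add: g_def)
  also have "e * (b - a) \<le> d" using d ab by (simp add: e_def field_simps)
  finally show "G b \<le> G a + d" by simp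
qed

section \<open>The logarithmic Sobolev inequality for difference quotients\<close>

context symmetric_markov_semigroup
begin

text \<open>With \<open>u = T s f\<close> in the domain of \<open>A = S O S\<close>, the form is
  \<open>(S u, S u) = (u, A u)\<close>, the limit of decrement quotients of the autocorrelation at
  \<open>2 * s\<close>; by convexity these are at most the quotients at 0. The bound
  \<open>E\<close> is assumed only frequently because it will come from negating an eventual
  statement.\<close>

lemma generator_in_sqrt_domain:
  assumes S: "is_sqrt_operator M (semigroup_generator M T) S"
    and f: "f \<in> Lp_space M 2" and s: "0 < s"
    and E: "\<exists>\<^sub>F h in at_right 0. (autocorr f 0 - autocorr f h) / h \<le> E"
  shows "T s f \<in> Quad S" and "Q_form M S (T s f) \<le> E"
proof -
  define u where "u = T s f"
  have u: "u \<in> Lp_space M 2" using f s by (simp add: u_def maps_L2)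
  obtain g where g: "(u, g) \<in> semigroup_generator M T"
    using T_in_generator_domain[OF f s] by (auto simp: u_def)
  then have "(u, g) \<in> S O S" using S by (simp add: is_sqrt_operator_def)
  then obtain w where w: "(u, w) \<in> S" "(w, g) \<in> S" by blast
  show "T s f \<in> Quad S" using w(1) by (auto simp: Quad_def u_def)
  \<comment> \<open>\<open>op_apply\<close> may select another function than the \<open>w\<close>
    with \<open>(w, g) \<in> S\<close>. Their difference is orthogonal to the domain of
    \<open>S\<close>, which is dense, so it vanishes in L^2.\<close>
  define w' where "w' = op_apply S u"
  have w': "(u, w') \<in> S" unfolding w'_def op_apply_def by (rule someI[of _ w]) (rule w(1))
  have adj: "S = adjoint_graph M S" and dense: "densely_defined M S"
    using S by (auto simp: is_sqrt_operator_def selfadjoint_def)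
  have mem: "x \<in> Lp_space M 2 \<and> y \<in> Lp_space M 2" if "(x, y) \<in> S" for x y
    using that adj by (auto simp: adjoint_graph_def)
  have sym: "L2_inner M y a = L2_inner M x b" if "(x, y) \<in> S" "(a, b) \<in> S" for x y a b
  proof -
    have "(a, b) \<in> adjoint_graph M S" using that(2) adj by blast
    then show ?thesis using that(1) unfolding adjoint_graph_def by blast
  qed
  have L2: "w \<in> Lp_space M 2" "w' \<in> Lp_space M 2" "g \<in> Lp_space M 2"
    using mem[OF w(1)] mem[OF w'] mem[OF w(2)] by auto
  define d where "d x = w' x - w x" for x
  have d: "d \<in> Lp_space M 2" unfolding d_def by (intro L2_diff L2)
  have orth: "L2_inner M d x = 0" if "(x, y) \<in> S" for x y
    unfolding d_def using sym[OF that w(1)] sym[OF that w'] L2 mem[OF that]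
    by (simp add: L2_inner_diff_left L2_inner_commute[of M w x] L2_inner_commute[of M w' x])
  have d0: "L2_inner M d d \<le> 0"
  proof (rule field_le_epsilon)
    fix e :: real assume e: "0 < e"
    define c where "c = e / (Lp_norm M 2 d + 1)"
    have c: "0 < c" using e Lp_norm_2_nonneg[of M d] by (simp add: c_def)
    then obtain x where x: "x \<in> Domain S" "x \<in> Lp_space M 2" "Lp_norm M 2 (\<lambda>y. d y - x y) < c"
      using dense d unfolding densely_defined_def by blast
    have "L2_inner M d d = L2_inner M d (\<lambda>y. d y - x y)"
      using orth x d by (auto simp: L2_inner_diff_right)
    also have "\<dots> \<le> Lp_norm M 2 d * Lp_norm M 2 (\<lambda>y. d y - x y)"
      using Cauchy_Schwarz_L2[OF d L2_diff[OF d x(2)]] by simp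
    also have "\<dots> \<le> Lp_norm M 2 d * c"
      using x(3) by (intro mult_left_mono) (auto simp: Lp_norm_2_nonneg)
    also have "\<dots> \<le> e"
      using e Lp_norm_2_nonneg[of M d] by (simp add: c_def field_simps)
    finally show "L2_inner M d d \<le> 0 + e" by simp
  qed
  have "L2_inner M w' d \<le> 0"
  proof -
    have "Lp_norm M 2 d = 0" using d0 L2_inner_self_nonneg[of M d] by (simp add: Lp_norm_2)
    then show ?thesis using Cauchy_Schwarz_L2[OF L2(2) d] by simp
  qed
  then have "Q_form M S u \<le> L2_inner M w' w"
    using L2 unfolding Q_form_def w'_def[symmetric] d_def by (simp add: L2_inner_diff_right)
  also have "\<dots> = L2_inner M u g" by (rule sym[OF w' w(2)])
  also have "\<dots> \<le> E"
  proof (rule ccontr)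
    assume "\<not> L2_inner M u g \<le> E"
    define D where "D h x = (u x - T h u x) / h" for h x
    have "((\<lambda>h. L2_inner M u (D h)) \<longlongrightarrow> L2_inner M u g) (at_right 0)"
    proof (rule L2_inner_tendsto)
      show "\<forall>\<^sub>F h in at_right 0. D h \<in> Lp_space M 2"
        using u unfolding D_def eventually_at_filter
        by (intro always_eventually allI impI L2_divide L2_diff maps_L2) auto
      show "((\<lambda>h. Lp_norm M 2 (\<lambda>x. D h x - g x)) \<longlongrightarrow> 0) (at_right 0)"
        using g by (simp add: semigroup_generator_def D_def)
    qed (use u L2 in auto)
    then have "\<forall>\<^sub>F h in at_right 0. E < L2_inner M u (D h)"
      by (rule order_tendstoD(1)) (use \<open>\<not> L2_inner M u g \<le> E\<close> in simp)
    moreover have "\<forall>\<^sub>F h in at_right 0. (0::real) < h" by (rule eventually_at_right_less)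
    ultimately have "\<forall>\<^sub>F h in at_right 0. \<not> (autocorr f 0 - autocorr f h) / h \<le> E"
    proof eventually_elim
      case (elim h)
      have "AE x in M. T h u x = T (s + h) f x"
        using T_add[of h s f] s f elim(2) by (auto simp: u_def add.commute elim!: eventually_mono)
      then have "L2_inner M u (T h u) = L2_inner M u (T (s + h) f)"
        using u f s elim(2) by (intro L2_inner_cong_AE) (auto intro!: L2_measurable maps_L2)
      also have "\<dots> = autocorr f (2 * s + h)"
        unfolding u_def autocorr_def using s f elim(2) by (subst inner_T_T) (auto simp: add.assoc)
      finally have "L2_inner M u (D h) = (L2_inner M u u - autocorr f (2 * s + h)) / h"
        using u elim(2) unfolding D_def L2_inner_divide_right
        by (simp add: L2_inner_diff_right maps_L2)
      also have "L2_inner M u u = autocorr f (2 * s)"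
        unfolding u_def using s f by (subst autocorr_half) auto
      also have "(autocorr f (2 * s) - autocorr f (2 * s + h)) / h \<le> (autocorr f 0 - autocorr f (0 + h)) / h"
        using s elim(2) by (intro divide_right_mono convex_decrement_antimono convex_on_autocorr f) auto
      finally show ?case using elim(1) by simp
    qed
    then show False using E by (simp add: frequently_def)
  qed
  finally show "Q_form M S (T s f) \<le> E" by (simp add: u_def)
qed

end

text \<open>The bounds hold everywhere, so that the real inequalities apply at each point without
  null sets. It is used with \<open>1 \<le> K\<close>, which makes powers of \<open>K\<close>
  increase with the exponent.\<close>

definition bounded_L1 :: "'a measure \<Rightarrow> real \<Rightarrow> ('a \<Rightarrow> real) \<Rightarrow> bool" where
  "bounded_L1 M K u \<longleftrightarrow> integrable M u \<and> (\<forall>x. 0 \<le> u x \<and> u x \<le> K)"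

lemma bounded_L1D:
  assumes "bounded_L1 M K u"
  shows "integrable M u" "u \<in> borel_measurable M" "0 \<le> u x" "u x \<le> K"
  using assms by (auto simp: bounded_L1_def)

lemma bounded_L1_integrable:
  assumes u: "bounded_L1 M K u" and g: "(\<lambda>x. g (u x)) \<in> borel_measurable M"
    and le: "\<And>x. 0 \<le> x \<Longrightarrow> x \<le> K \<Longrightarrow> \<bar>g x\<bar> \<le> C * x"
  shows "integrable M (\<lambda>x. g (u x))"
proof (rule Bochner_Integration.integrable_bound)
  show "integrable M (\<lambda>x. C * u x)" using bounded_L1D(1)[OF u] by simp
  show "AE x in M. norm (g (u x)) \<le> norm (C * u x)"
    using le bounded_L1D(3,4)[OF u] by (intro AE_I2) (metis abs_ge_self order_trans real_norm_def)
qed (rule g)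

lemma bounded_L1_powr_integrable:
  assumes u: "bounded_L1 M K u" and K: "1 \<le> K" and p: "1 \<le> p"
  shows "integrable M (\<lambda>x. u x powr p)"
proof (rule bounded_L1_integrable[OF u, where C = "K powr p"])
  show "(\<lambda>x. u x powr p) \<in> borel_measurable M" using bounded_L1D(2)[OF u] by measurable
  fix x assume x: "0 \<le> x" "x \<le> K"
  have "x powr p = x powr (p - 1) * x"
    using x powr_add[of x "p - 1" 1] by (cases "x = 0") auto
  also have "\<dots> \<le> K powr p * x"
    using x p K by (intro mult_right_mono powr_le_powr_bound) auto
  finally show "\<bar>x powr p\<bar> \<le> K powr p * x" by simp
qed

lemma bounded_L1_Lp:
  assumes u: "bounded_L1 M K u" and K: "1 \<le> K" and p: "1 \<le> p"
  shows "u \<in> Lp_space M p"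
  using bounded_L1_powr_integrable[OF assms] bounded_L1D[OF u] by (simp add: Lp_space_def)

lemma bounded_L1_powr_L2:
  assumes u: "bounded_L1 M K u" and K: "1 \<le> K" and p: "1/2 \<le> p"
  shows "(\<lambda>x. u x powr p) \<in> Lp_space M 2"
  unfolding Lp_space_2_iff
proof
  show "(\<lambda>x. u x powr p) \<in> borel_measurable M" using bounded_L1D(2)[OF u] by measurable
  have "(u x powr p)\<^sup>2 = u x powr (2 * p)" for x
    by (simp add: power2_eq_square flip: powr_add)
  then show "integrable M (\<lambda>x. (u x powr p)\<^sup>2)"
    using bounded_L1_powr_integrable[OF u K, of "2 * p"] p by simp
qed

lemma bounded_L1_L2: "bounded_L1 M K u \<Longrightarrow> 1 \<le> K \<Longrightarrow> u \<in> Lp_space M 2"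
  by (rule bounded_L1_Lp) auto

lemma bounded_L1_powr:
  assumes u: "bounded_L1 M K u" and K: "1 \<le> K" and p: "1 \<le> p"
  shows "bounded_L1 M (K powr p) (\<lambda>x. u x powr p)"
  using bounded_L1_powr_integrable[OF assms] bounded_L1D[OF u] p
  by (auto simp: bounded_L1_def intro!: powr_mono2)

lemma Linf_norm_le_iff:
  assumes "f \<in> borel_measurable M" "0 \<le> c"
  shows "Linf_norm M f \<le> ennreal c \<longleftrightarrow> (AE x in M. \<bar>f x\<bar> \<le> c)"
proof
  assume "Linf_norm M f \<le> ennreal c"
  then show "AE x in M. \<bar>f x\<bar> \<le> c"
    using esssup_AE[of "\<lambda>x. ennreal \<bar>f x\<bar>" M] unfolding Linf_norm_def
    by (auto elim!: eventually_mono dest: order_trans simp: ennreal_le_iff assms)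
next
  assume "AE x in M. \<bar>f x\<bar> \<le> c"
  then show "Linf_norm M f \<le> ennreal c"
    unfolding Linf_norm_def using assms
    by (intro esssup_I) (auto intro: ennreal_leI elim!: eventually_mono)
qed

lemma Linf_spaceI:
  assumes "f \<in> borel_measurable M" "AE x in M. \<bar>f x\<bar> \<le> c" "0 \<le> c"
  shows "f \<in> Linf_space M"
  using assms Linf_norm_le_iff[of f M c] le_less_trans[OF _ ennreal_less_top, of "Linf_norm M f" c]
  by (simp add: Linf_space_def)

lemma square_ln_integrable:
  assumes u: "bounded_L1 M K u" and K: "1 \<le> K"
  shows "integrable M (\<lambda>x. (u x)\<^sup>2 * ln (u x))"
proof (rule bounded_L1_integrable[OF u, where C = "8 * K powr 2"])
  show "(\<lambda>x. (u x)\<^sup>2 * ln (u x)) \<in> borel_measurable M" using bounded_L1D(2)[OF u] by measurable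
  fix x assume x: "0 \<le> x" "x \<le> K"
  then have "x powr 2 = x\<^sup>2" by (cases "x = 0") auto
  then show "\<bar>x\<^sup>2 * ln x\<bar> \<le> 8 * K powr 2 * x"
    using powr_mult_abs_ln_le_linear[OF K x, of 2 2] by simp
qed

text \<open>Cauchy-Schwarz with the factors \<open>sqrt (u x)\<close> and \<open>sqrt (v x)\<close>,
  whose L^2 norms are controlled by L^1 norms. As the semigroup does not increase the latter, the
  entropy of \<open>T d g\<close> tends to that of \<open>g\<close> as \<open>d\<close> tends to
  0.\<close>

lemma entropy_diff_le:
  assumes u: "bounded_L1 M K u" and v: "bounded_L1 M K v" and K: "1 \<le> K"
  shows "\<bar>(LINT x|M. (u x)\<^sup>2 * ln (u x)) - (LINT x|M. (v x)\<^sup>2 * ln (v x))\<bar>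
    \<le> 17 * K * ((sqrt (LINT x|M. u x) + sqrt (LINT x|M. v x)) * Lp_norm M 2 (\<lambda>x. u x - v x))"
proof -
  note uD = bounded_L1D[OF u] and vD = bounded_L1D[OF v]
  have sqrt_L2: "(\<lambda>x. sqrt (w x)) \<in> Lp_space M 2" if "bounded_L1 M K w" for w
    using bounded_L1D[OF that] by (simp add: Lp_space_2_iff)
  have sqrt_norm: "Lp_norm M 2 (\<lambda>x. sqrt (w x)) = sqrt (LINT x|M. w x)" if "bounded_L1 M K w" for w
    using bounded_L1D[OF that] by (simp add: Lp_norm_2 L2_inner_def)
  have diff_L2: "(\<lambda>x. \<bar>u x - v x\<bar>) \<in> Lp_space M 2"
    using L2_diff[OF bounded_L1_L2[OF u K] bounded_L1_L2[OF v K]]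
    using uD(2) vD(2) by (simp add: Lp_space_2_iff)
  have diff_norm: "Lp_norm M 2 (\<lambda>x. \<bar>u x - v x\<bar>) = Lp_norm M 2 (\<lambda>x. u x - v x)"
    by (simp add: Lp_norm_2 L2_inner_def)
  have sum_L2: "(\<lambda>x. sqrt (u x) + sqrt (v x)) \<in> Lp_space M 2"
    by (intro L2_add sqrt_L2 u v)
  have "\<bar>(LINT x|M. (u x)\<^sup>2 * ln (u x)) - (LINT x|M. (v x)\<^sup>2 * ln (v x))\<bar>
      = \<bar>LINT x|M. (u x)\<^sup>2 * ln (u x) - (v x)\<^sup>2 * ln (v x)\<bar>"
    using square_ln_integrable[OF u K] square_ln_integrable[OF v K] by simp
  also have "\<dots> \<le> (LINT x|M. \<bar>(u x)\<^sup>2 * ln (u x) - (v x)\<^sup>2 * ln (v x)\<bar>)"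
    by (rule integral_abs_bound)
  also have "\<dots> \<le> (LINT x|M. 17 * K * ((sqrt (u x) + sqrt (v x)) * \<bar>u x - v x\<bar>))"
    using square_ln_integrable[OF u K] square_ln_integrable[OF v K] uD vD
    by (intro integral_mono square_ln_diff_le K integrable_mult_right L2_integrable_mult sum_L2 diff_L2) auto
  also have "\<dots> = 17 * K * L2_inner M (\<lambda>x. sqrt (u x) + sqrt (v x)) (\<lambda>x. \<bar>u x - v x\<bar>)"
    by (simp add: L2_inner_def)
  also have "\<dots> \<le> 17 * K * ((sqrt (LINT x|M. u x) + sqrt (LINT x|M. v x)) * Lp_norm M 2 (\<lambda>x. u x - v x))"
  proof (intro mult_left_mono)
    have "L2_inner M (\<lambda>x. sqrt (u x) + sqrt (v x)) (\<lambda>x. \<bar>u x - v x\<bar>)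
        \<le> Lp_norm M 2 (\<lambda>x. sqrt (u x) + sqrt (v x)) * Lp_norm M 2 (\<lambda>x. u x - v x)"
      using Cauchy_Schwarz_L2[OF sum_L2 diff_L2] by (simp add: diff_norm)
    also have "\<dots> \<le> (sqrt (LINT x|M. u x) + sqrt (LINT x|M. v x)) * Lp_norm M 2 (\<lambda>x. u x - v x)"
      using Lp_norm_2_add_le[OF sqrt_L2[OF u] sqrt_L2[OF v]] sqrt_norm[OF u] sqrt_norm[OF v]
      by (intro mult_right_mono Lp_norm_2_nonneg) auto
    finally show "L2_inner M (\<lambda>x. sqrt (u x) + sqrt (v x)) (\<lambda>x. \<bar>u x - v x\<bar>)
      \<le> (sqrt (LINT x|M. u x) + sqrt (LINT x|M. v x)) * Lp_norm M 2 (\<lambda>x. u x - v x)" .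
  qed (use K in simp)
  finally show ?thesis .
qed

section \<open>Orbits of bounded integrable functions\<close>

context symmetric_markov_semigroup
begin

lemma T_le_const:
  assumes t: "0 \<le> t" and f: "f \<in> Lp_space M 2" and c: "0 \<le> c" "AE x in M. \<bar>f x\<bar> \<le> c"
  shows "AE x in M. \<bar>T t f x\<bar> \<le> c"
proof -
  have "f \<in> Linf_space M" using f c by (intro Linf_spaceI L2_measurable) auto
  then have "Linf_norm M (T t f) \<le> Linf_norm M f" using contractive_Linf[OF t, of f] f by auto
  also have "\<dots> \<le> ennreal c" using f c by (subst Linf_norm_le_iff) (auto intro: L2_measurable)
  finally show ?thesis using t f c by (subst (asm) Linf_norm_le_iff) (auto intro: T_measurable)
qed

text \<open>A representative of \<open>T s f\<close> that takes values in $[0, K]$ everywhere, not only almost everywhere.\<close>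

definition evolve :: "real \<Rightarrow> ('a \<Rightarrow> real) \<Rightarrow> real \<Rightarrow> 'a \<Rightarrow> real" where
  "evolve K f s x = max 0 (min K (T s f x))"

lemma evolve_AE:
  assumes f: "bounded_L1 M K f" and K: "1 \<le> K" and s: "0 \<le> s"
  shows "AE x in M. evolve K f s x = T s f x"
proof -
  have f2: "f \<in> Lp_space M 2" by (rule bounded_L1_L2[OF f K])
  have "AE x in M. 0 \<le> T s f x"
    by (rule positivity_preserving[OF s f2]) (use bounded_L1D[OF f] in auto)
  moreover have "AE x in M. \<bar>T s f x\<bar> \<le> K"
    by (rule T_le_const[OF s f2]) (use bounded_L1D[OF f] K in auto)
  ultimately show ?thesis by eventually_elim (auto simp: evolve_def)
qed

lemma evolve_measurable:
  assumes f: "bounded_L1 M K f" and K: "1 \<le> K" and s: "0 \<le> s"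
  shows "evolve K f s \<in> borel_measurable M"
  unfolding evolve_def using T_measurable[OF s bounded_L1_L2[OF f K]] by simp

lemma evolve_L1:
  assumes f: "bounded_L1 M K f" and K: "1 \<le> K" and s: "0 \<le> s"
  shows "bounded_L1 M K (evolve K f s)" and "(LINT x|M. evolve K f s x) \<le> (LINT x|M. f x)"
proof -
  have f12: "f \<in> Lp_space M 2 \<inter> Lp_space M 1"
    using bounded_L1_Lp[OF f K] by auto
  have T1: "T s f \<in> Lp_space M 1" "Lp_norm M 1 (T s f) \<le> Lp_norm M 1 f"
    using contractive_Lp[OF s _ f12] by auto
  have i: "integrable M (T s f)"
  proof (rule integrable_abs_cancel)
    show "integrable M (\<lambda>x. \<bar>T s f x\<bar>)" using T1(1) by (simp add: Lp_space_def)
    show "T s f \<in> borel_measurable M" using T1(1) by (simp add: Lp_space_def)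
  qed
  have ie: "integrable M (evolve K f s)"
    using i integrable_cong_AE[of "evolve K f s" M "T s f"] evolve_AE[OF assms] evolve_measurable[OF assms]
    by (auto simp: borel_measurable_integrable)
  then show "bounded_L1 M K (evolve K f s)"
    using K by (auto simp: bounded_L1_def evolve_def)
  have "(LINT x|M. evolve K f s x) = (LINT x|M. T s f x)"
    using evolve_AE[OF assms] evolve_measurable[OF assms] i
    by (intro integral_cong_AE) auto
  also have "\<dots> \<le> (LINT x|M. \<bar>T s f x\<bar>)" using i by (intro integral_mono) auto
  also have "\<dots> \<le> (LINT x|M. \<bar>f x\<bar>)" using T1(2) by (simp add: Lp_norm_def)
  finally show "(LINT x|M. evolve K f s x) \<le> (LINT x|M. f x)"
    using bounded_L1D[OF f] by simp
qed

lemma evolve_diff_norm: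
  assumes f: "bounded_L1 M K f" and K: "1 \<le> K" and "0 \<le> s" "0 \<le> r"
  shows "Lp_norm M 2 (\<lambda>x. evolve K f s x - evolve K f r x) = Lp_norm M 2 (\<lambda>x. T s f x - T r f x)"
proof (rule Lp_norm_2_cong_AE)
  show "AE x in M. evolve K f s x - evolve K f r x = T s f x - T r f x"
    using evolve_AE[OF f K \<open>0 \<le> s\<close>] evolve_AE[OF f K \<open>0 \<le> r\<close>] by eventually_elim simp
qed (intro borel_measurable_diff evolve_measurable T_measurable bounded_L1_L2[OF f K] assms)+

lemma evolve_0:
  assumes f: "bounded_L1 M K f" and K: "1 \<le> K"
  shows "AE x in M. evolve K f 0 x = f x"
  using evolve_AE[OF f K order_refl] T_zero[OF bounded_L1_L2[OF f K]] by eventually_elim simp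

end

locale log_sobolev_semigroup = symmetric_markov_semigroup +
  fixes S :: "'a L2_graph" and \<beta> :: "real \<Rightarrow> real"
  assumes sqrt_generator: "is_sqrt_operator M (semigroup_generator M T) S"
    and log_sobolev: "\<lbrakk>0 < \<epsilon>; f \<in> Quad S \<inter> Lp_space M 1 \<inter> Linf_space M; AE x in M. 0 \<le> f x\<rbrakk> \<Longrightarrow>
      (LINT x|M. (f x)\<^sup>2 * ln (f x)) \<le> \<epsilon> * Q_form M S f + \<beta> \<epsilon> * (Lp_norm M 2 f)\<^sup>2
        + (Lp_norm M 2 f)\<^sup>2 * ln (Lp_norm M 2 f)"
begin

text \<open>A substitute for the logarithmic Sobolev inequality when \<open>g\<close> is not known
  to lie in \<open>Quad S\<close>. If the difference quotients were frequently at most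
  \<open>X - e\<close>, that number would bound the form of every \<open>T d g\<close> with
  \<open>d > 0\<close>; applying the inequality to \<open>T d g\<close> and letting \<open>d\<close>
  tend to 0 would put the entropy of \<open>g\<close> below itself by
  \<open>\<epsilon> * e\<close>.\<close>

lemma log_sobolev_increment:
  assumes g: "bounded_L1 M K g" and K: "1 \<le> K" and \<epsilon>: "0 < \<epsilon>" and e: "0 < e"
    and N: "N = Lp_norm M 2 g" "0 < N"
  shows "\<forall>\<^sub>F h in at_right 0.
    ((LINT x|M. (g x)\<^sup>2 * ln (g x)) - \<beta> \<epsilon> * N\<^sup>2 - N\<^sup>2 * ln N) / \<epsilon> - e
      \<le> (autocorr g 0 - autocorr g h) / h"
proof (rule ccontr)
  define X where "X = ((LINT x|M. (g x)\<^sup>2 * ln (g x)) - \<beta> \<epsilon> * N\<^sup>2 - N\<^sup>2 * ln N) / \<epsilon>"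
  assume "\<not> ?thesis"
  then have "\<exists>\<^sub>F h in at_right 0. \<not> X - e \<le> (autocorr g 0 - autocorr g h) / h"
    by (simp add: not_eventually X_def)
  then have E: "\<exists>\<^sub>F h in at_right 0. (autocorr g 0 - autocorr g h) / h \<le> X - e"
    by (rule frequently_mono[rotated]) auto
  have g2: "g \<in> Lp_space M 2" by (rule bounded_L1_L2[OF g K])
  define U where "U = evolve K g"
  have U: "bounded_L1 M K (U d)" if "0 \<le> d" for d
    unfolding U_def by (rule evolve_L1[OF g K that])
  define n where "n d = Lp_norm M 2 (U d)" for d
  have conv: "((\<lambda>d. Lp_norm M 2 (\<lambda>x. U d x - g x)) \<longlongrightarrow> 0) (at_right 0)"
  proof (rule Lim_transform_eventually)
    show "((\<lambda>d. Lp_norm M 2 (\<lambda>x. T d g x - g x)) \<longlongrightarrow> 0) (at_right 0)"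
      by (rule strongly_continuous[OF g2])
    show "\<forall>\<^sub>F d in at_right 0. Lp_norm M 2 (\<lambda>x. T d g x - g x) = Lp_norm M 2 (\<lambda>x. U d x - g x)"
      using eventually_at_right_less[of "0::real"]
    proof eventually_elim
      case (elim d)
      then show ?case unfolding U_def
        using evolve_AE[OF g K, of d] g2 evolve_measurable[OF g K, of d] T_measurable[of d g] L2_measurable[OF g2]
        by (intro Lp_norm_2_cong_AE) auto
    qed
  qed
  have lsi: "(LINT x|M. (U d x)\<^sup>2 * ln (U d x)) \<le> \<epsilon> * (X - e) + \<beta> \<epsilon> * (n d)\<^sup>2 + (n d)\<^sup>2 * ln (n d)"
    if d: "0 < d" for d
  proof -
    have AE: "AE x in M. U d x = T d g x" unfolding U_def by (rule evolve_AE[OF g K]) (use d in simp)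
    have m: "U d \<in> borel_measurable M" "T d g \<in> borel_measurable M"
      using bounded_L1D(2)[OF U] T_measurable[OF _ g2] d by auto
    have "T d g \<in> Lp_space M 1"
      using contractive_Lp[of d 1 g] bounded_L1_Lp[OF g K, of 1] g2 d by auto
    moreover have "g \<in> Linf_space M"
      by (rule Linf_spaceI[of g M K]) (use bounded_L1D[OF g] K in auto)
    then have "T d g \<in> Linf_space M"
      using contractive_Linf[of d g] g2 d by auto
    moreover have "T d g \<in> Quad S"
      by (rule generator_in_sqrt_domain(1)[OF sqrt_generator g2 d E])
    moreover have "AE x in M. 0 \<le> T d g x"
      using AE bounded_L1D(3)[OF U[of d]] d by (auto elim!: eventually_mono) (metis less_imp_le)
    ultimately have "(LINT x|M. (T d g x)\<^sup>2 * ln (T d g x)) \<le> \<epsilon> * Q_form M S (T d g)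
        + \<beta> \<epsilon> * (Lp_norm M 2 (T d g))\<^sup>2 + (Lp_norm M 2 (T d g))\<^sup>2 * ln (Lp_norm M 2 (T d g))"
      by (intro log_sobolev \<epsilon>) auto
    also have "\<epsilon> * Q_form M S (T d g) \<le> \<epsilon> * (X - e)"
      using generator_in_sqrt_domain(2)[OF sqrt_generator g2 d E] \<epsilon> by simp
    also have "Lp_norm M 2 (T d g) = n d"
      unfolding n_def using AE m by (intro Lp_norm_2_cong_AE) (auto elim: eventually_mono)
    also have "(LINT x|M. (T d g x)\<^sup>2 * ln (T d g x)) = (LINT x|M. (U d x)\<^sup>2 * ln (U d x))"
      using AE m by (intro integral_cong_AE) (auto elim!: eventually_mono)
    finally show ?thesis by simp
  qed
  have "((\<lambda>d. n d) \<longlongrightarrow> N) (at_right 0)"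
  proof (rule LIM_zero_cancel, rule Lim_null_comparison[OF _ conv])
    show "\<forall>\<^sub>F d in at_right 0. norm (n d - N) \<le> Lp_norm M 2 (\<lambda>x. U d x - g x)"
      using eventually_at_right_less[of "0::real"]
    proof eventually_elim
      case (elim d)
      have u2: "U d \<in> Lp_space M 2" using U[of d] elim K by (intro bounded_L1_L2) auto
      show ?case
        using Lp_norm_2_add_le[OF L2_diff[OF u2 g2] g2] Lp_norm_2_add_le[OF L2_diff[OF g2 u2] u2]
        by (simp add: n_def N Lp_norm_2_minus_commute[of M g])
    qed
  qed
  then have "((\<lambda>d. \<epsilon> * (X - e) + \<beta> \<epsilon> * (n d)\<^sup>2 + (n d)\<^sup>2 * ln (n d))
      \<longlongrightarrow> \<epsilon> * (X - e) + \<beta> \<epsilon> * N\<^sup>2 + N\<^sup>2 * ln N) (at_right 0)"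
    using N by (intro tendsto_intros) auto
  moreover have "((\<lambda>d. LINT x|M. (U d x)\<^sup>2 * ln (U d x)) \<longlongrightarrow> (LINT x|M. (g x)\<^sup>2 * ln (g x))) (at_right 0)"
  proof (rule LIM_zero_cancel, rule Lim_null_comparison)
    define C where "C = 17 * K * (sqrt (LINT x|M. g x) + sqrt (LINT x|M. g x))"
    show "((\<lambda>d. C * Lp_norm M 2 (\<lambda>x. U d x - g x)) \<longlongrightarrow> 0) (at_right 0)"
      using tendsto_mult_left[OF conv, of C] by simp
    show "\<forall>\<^sub>F d in at_right 0. norm ((LINT x|M. (U d x)\<^sup>2 * ln (U d x)) - (LINT x|M. (g x)\<^sup>2 * ln (g x)))
      \<le> C * Lp_norm M 2 (\<lambda>x. U d x - g x)"
      using eventually_at_right_less[of "0::real"]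
    proof eventually_elim
      case (elim d)
      then have d: "0 \<le> d" by simp
      have "17 * K * ((sqrt (LINT x|M. U d x) + sqrt (LINT x|M. g x)) * Lp_norm M 2 (\<lambda>x. U d x - g x))
          \<le> 17 * K * ((sqrt (LINT x|M. g x) + sqrt (LINT x|M. g x)) * Lp_norm M 2 (\<lambda>x. U d x - g x))"
        using K evolve_L1(2)[OF g K d] unfolding U_def
        by (intro mult_left_mono mult_right_mono add_right_mono real_sqrt_le_mono Lp_norm_2_nonneg) auto
      then show ?case using entropy_diff_le[OF U[OF d] g K] by (simp add: C_def mult.assoc)
    qed
  qed
  ultimately have "(LINT x|M. (g x)\<^sup>2 * ln (g x)) \<le> \<epsilon> * (X - e) + \<beta> \<epsilon> * N\<^sup>2 + N\<^sup>2 * ln N"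
    using lsi by (intro tendsto_le[OF trivial_limit_at_right_real])
      (auto simp: eventually_at_filter)
  also have "\<dots> = (LINT x|M. (g x)\<^sup>2 * ln (g x)) - \<epsilon> * e"
    using \<epsilon> by (simp add: X_def field_simps)
  finally show False using mult_pos_pos[OF \<epsilon> e] by simp
qed

end

section \<open>The Stroock-Varopoulos inequality\<close>

lemma continuous_le_0_from_rationals:
  fixes F :: "real \<Rightarrow> real"
  assumes cont: "continuous_on {0..} F" and rat: "\<And>q. q \<in> \<rat> \<Longrightarrow> 0 \<le> q \<Longrightarrow> F q \<le> 0" and a: "0 \<le> a"
  shows "F a \<le> 0"
proof (rule ccontr)
  assume "\<not> F a \<le> 0"
  then have "\<forall>\<^sub>F b in at a within {0..}. 0 < F b"
    using cont a by (intro order_tendstoD(1)[where a = 0]) (auto simp: continuous_on_def)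
  then obtain d where d: "0 < d" "\<And>b. 0 \<le> b \<Longrightarrow> b \<noteq> a \<Longrightarrow> dist b a < d \<Longrightarrow> 0 < F b"
    by (auto simp: eventually_at)
  obtain q where "q \<in> \<rat>" "a < q" "q < a + d"
    using Rats_dense_in_real[of a "a + d"] d(1) by auto
  then show False using d(2)[of q] rat[of q] a by (simp add: dist_real_def)
qed

context symmetric_markov_semigroup
begin

lemma T_cmult_add:
  "0 \<le> t \<Longrightarrow> f \<in> Lp_space M 2 \<Longrightarrow> g \<in> Lp_space M 2 \<Longrightarrow>
    AE x in M. T t (\<lambda>y. a * f y + g y) x = a * T t f x + T t g x"
  using linear[of t f g a 1] by simp

lemma T_cmult: "0 \<le> t \<Longrightarrow> f \<in> Lp_space M 2 \<Longrightarrow> AE x in M. T t (\<lambda>y. a * f y) x = a * T t f x"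
  using linear[of t f f a 0] by simp

lemma T_integral_le:
  assumes f: "bounded_L1 M K f" and K: "1 \<le> K" and s: "0 \<le> s"
  shows "integrable M (T s f)" and "(LINT x|M. T s f x) \<le> (LINT x|M. f x)"
proof -
  note e = evolve_L1[OF assms] and m = evolve_measurable[OF assms] and ae = evolve_AE[OF assms]
  have Tm: "T s f \<in> borel_measurable M" by (rule T_measurable[OF s bounded_L1_L2[OF f K]])
  show "integrable M (T s f)"
    using integrable_cong_AE[THEN iffD1, OF m Tm ae bounded_L1D(1)[OF e(1)]] .
  show "(LINT x|M. T s f x) \<le> (LINT x|M. f x)"
    using e(2) integral_cong_AE[OF m Tm ae] by simp
qed

text \<open>
  No kernel for \<open>T t\<close> is available. Instead \<open>T t\<close> is applied, for each fixed rational \<open>a\<close>, to the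
  pointwise inequality between \<open>a\<close> and \<open>u y\<close>, and then \<open>a\<close> is replaced by \<open>u x\<close>. The cutoff puts
  the terms that are constant in \<open>y\<close> into $L^2$.
\<close>

lemma Stroock_Varopoulos_cutoff:
  assumes u: "bounded_L1 M K u" and K: "1 \<le> K" and c: "1 \<le> c" and t: "0 \<le> t" and d: "0 < d"
  defines "\<theta> \<equiv> (\<lambda>x. if d \<le> u x then 1 else 0 :: real)"
  shows "2 * (1 - c) * (LINT x|M. u x powr (2 * c))
    - 2 * (LINT x|M. \<theta> x * (u x powr c * T t (\<lambda>y. u y powr c) x))
    + c * (LINT x|M. \<theta> x * (u x powr (2 * c - 1) * T t u x))
    + c * (LINT x|M. \<theta> x * (u x * T t (\<lambda>y. u y powr (2 * c - 1)) x)) \<le> 0"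
proof -
  note um[measurable] = bounded_L1D(2)[OF u] and u0 = bounded_L1D(3)[OF u]
  have u2: "u \<in> Lp_space M 2" by (rule bounded_L1_L2[OF u K])
  have \<theta>m[measurable]: "\<theta> \<in> borel_measurable M" unfolding \<theta>_def by measurable
  have \<theta>01: "0 \<le> \<theta> x" "\<theta> x \<le> 1" for x by (auto simp: \<theta>_def)
  have \<theta>2: "\<theta> \<in> Lp_space M 2"
  proof (rule L2_bound[OF L2_cmult[OF u2, of "1 / d"]])
    show "AE x in M. \<bar>\<theta> x\<bar> \<le> \<bar>1 / d * u x\<bar>"
      using d u0 by (intro AE_I2) (auto simp: \<theta>_def field_simps)
  qed simp
  define W where "W r x = \<theta> x * u x powr r" for r x
  have pL2: "(\<lambda>x. u x powr r) \<in> Lp_space M 2" if "1 \<le> r" for r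
    by (rule bounded_L1_powr_L2[OF u K]) (use that in simp)
  have W2: "W r \<in> Lp_space M 2" if "1 \<le> r" for r
  proof (rule L2_bound[OF pL2[OF that]])
    show "W r \<in> borel_measurable M" unfolding W_def by measurable
    show "AE x in M. \<bar>W r x\<bar> \<le> \<bar>u x powr r\<bar>"
      by (intro AE_I2) (auto simp: W_def \<theta>_def)
  qed
  have Wc: "W c \<in> Lp_space M 2" "W (2 * c - 1) \<in> Lp_space M 2" "W 1 \<in> Lp_space M 2" "W (2 * c) \<in> Lp_space M 2"
    using c by (auto intro!: W2)
  \<comment> \<open>The expansion of \<open>(a powr c - u y powr c)^2 - c * (a - u y) * (a powr (2 *
    c - 1) - u y powr (2 * c - 1))\<close>, multiplied by \<open>\<theta> y\<close> and sorted by
    functions of \<open>y\<close>; the arguments \<open>k0\<close> to \<open>k4\<close> receive the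
    values at \<open>x\<close> of the images of these functions under \<open>T t\<close>.\<close>
  define F where "F a k0 k1 k2 k3 k4 = (1 - c) * a powr (2 * c) * k0 + ((- 2 * a powr c) * k1
    + (c * a * k2 + (c * a powr (2 * c - 1) * k3 + (1 - c) * k4)))" for a k0 k1 k2 k3 k4
  have TF: "AE x in M. F a (T t \<theta> x) (T t (W c) x) (T t (W (2 * c - 1)) x) (T t (W 1) x) (T t (W (2 * c)) x) \<le> 0"
    if a: "0 \<le> a" for a
  proof -
    define v4 where "v4 y = (1 - c) * W (2 * c) y" for y
    define v3 where "v3 y = c * a powr (2 * c - 1) * W 1 y + v4 y" for y
    define v2 where "v2 y = c * a * W (2 * c - 1) y + v3 y" for y
    define v1 where "v1 y = (- 2 * a powr c) * W c y + v2 y" for y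
    define v0 where "v0 y = (1 - c) * a powr (2 * c) * \<theta> y + v1 y" for y
    have L: "v4 \<in> Lp_space M 2" "v3 \<in> Lp_space M 2" "v2 \<in> Lp_space M 2" "v1 \<in> Lp_space M 2" "v0 \<in> Lp_space M 2"
      unfolding v0_def v1_def v2_def v3_def v4_def using Wc \<theta>2
      by (intro L2_add L2_cmult; simp)+
    have "v0 y \<le> 0" for y
    proof -
      have aa: "a powr (2 * c) = a * a powr (2 * c - 1)" "a powr (2 * c) = (a powr c)\<^sup>2"
        using a c powr_add[of a 1 "2 * c - 1"] powr_add[of a c c]
        by (auto simp: power2_eq_square)
      have uu: "u y powr (2 * c) = u y * u y powr (2 * c - 1)" "u y powr (2 * c) = (u y powr c)\<^sup>2"
        using u0[of y] c powr_add[of "u y" 1 "2 * c - 1"] powr_add[of "u y" c c]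
        by (auto simp: power2_eq_square)
      have "v0 y = \<theta> y * (a powr (2 * c) + u y powr (2 * c) - 2 * a powr c * u y powr c
          - c * (a powr (2 * c) + u y powr (2 * c) - a * u y powr (2 * c - 1) - a powr (2 * c - 1) * u y))"
        using u0[of y] unfolding v0_def v1_def v2_def v3_def v4_def W_def by (simp add: algebra_simps)
      also have "\<dots> = \<theta> y * ((a powr c - u y powr c)\<^sup>2
          - c * ((a - u y) * (a powr (2 * c - 1) - u y powr (2 * c - 1))))"
      proof -
        have "a powr (2 * c) + u y powr (2 * c) - 2 * a powr c * u y powr c = (a powr c - u y powr c)\<^sup>2"
          unfolding aa(2) uu(2) by (simp add: power2_eq_square algebra_simps)
        moreover have "a powr (2 * c) + u y powr (2 * c) - a * u y powr (2 * c - 1) - a powr (2 * c - 1) * u y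
            = (a - u y) * (a powr (2 * c - 1) - u y powr (2 * c - 1))"
          unfolding aa(1) uu(1) by (simp add: algebra_simps)
        ultimately show ?thesis by simp
      qed
      also have "\<dots> \<le> 0"
        using powr_square_diff_le[OF a u0[of y] c] \<theta>01(1)[of y] by (intro mult_nonneg_nonpos) auto
      finally show ?thesis .
    qed
    then have "AE x in M. 0 \<le> T t (\<lambda>y. (- 1) * v0 y) x"
      by (intro positivity_preserving t L2_cmult L) simp
    moreover have "AE x in M. T t (\<lambda>y. (- 1) * v0 y) x = (- 1) * T t v0 x"
      by (rule T_cmult[OF t L(5)])
    moreover have "AE x in M. T t v0 x = (1 - c) * a powr (2 * c) * T t \<theta> x + T t v1 x"
      unfolding v0_def[abs_def] by (rule T_cmult_add[OF t \<theta>2 L(4)])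
    moreover have "AE x in M. T t v1 x = (- 2 * a powr c) * T t (W c) x + T t v2 x"
      unfolding v1_def[abs_def] by (rule T_cmult_add[OF t Wc(1) L(3)])
    moreover have "AE x in M. T t v2 x = c * a * T t (W (2 * c - 1)) x + T t v3 x"
      unfolding v2_def[abs_def] by (rule T_cmult_add[OF t Wc(2) L(2)])
    moreover have "AE x in M. T t v3 x = c * a powr (2 * c - 1) * T t (W 1) x + T t v4 x"
      unfolding v3_def[abs_def] by (rule T_cmult_add[OF t Wc(3) L(1)])
    moreover have "AE x in M. T t v4 x = (1 - c) * T t (W (2 * c)) x"
      unfolding v4_def[abs_def] by (rule T_cmult[OF t Wc(4)])
    ultimately show ?thesis
      unfolding F_def by eventually_elim simp
  qed
  have "countable {a\<in>\<rat>. 0 \<le> (a::real)}"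
    by (rule countable_subset[OF _ countable_rat]) auto
  then have "AE x in M. \<forall>a\<in>{a\<in>\<rat>. 0 \<le> a}.
      F a (T t \<theta> x) (T t (W c) x) (T t (W (2 * c - 1)) x) (T t (W 1) x) (T t (W (2 * c)) x) \<le> 0"
    by (rule AE_ball_countable[THEN iffD2]) (use TF in auto)
  moreover have "AE x in M. \<bar>T t \<theta> x\<bar> \<le> 1"
    by (rule T_le_const[OF t \<theta>2]) (use \<theta>01 in auto)
  ultimately have AE_le: "AE x in M. (1 - c) * u x powr (2 * c) - 2 * (u x powr c * T t (W c) x)
      + c * (u x * T t (W (2 * c - 1)) x) + c * (u x powr (2 * c - 1) * T t (W 1) x)
      + (1 - c) * T t (W (2 * c)) x \<le> 0"
  proof eventually_elim
    case (elim x)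
    have "F (u x) (T t \<theta> x) (T t (W c) x) (T t (W (2 * c - 1)) x) (T t (W 1) x) (T t (W (2 * c)) x) \<le> 0"
    proof (rule continuous_le_0_from_rationals[OF _ _ u0])
      show "continuous_on {0..} (\<lambda>a. F a (T t \<theta> x) (T t (W c) x) (T t (W (2 * c - 1)) x) (T t (W 1) x) (T t (W (2 * c)) x))"
      proof -
        have pw: "continuous_on {0..} (\<lambda>a::real. a powr r)" if "0 < r" for r
          by (rule continuous_on_powr') (use that in \<open>auto intro: continuous_on_id continuous_on_const\<close>)
        show ?thesis
          unfolding F_def using c
          by (intro continuous_on_add continuous_on_mult continuous_on_const continuous_on_id pw) auto
      qed
    qed (use elim(1) in auto)
    \<comment> \<open>Here \<open>T t \<theta> \<le> 1\<close> enters: since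
      \<open>1 - c \<le> 0\<close>, replacing \<open>T t \<theta> x\<close> by 1 can only lower the
      left side.\<close>
    moreover have "(1 - c) * u x powr (2 * c) * 1 \<le> (1 - c) * u x powr (2 * c) * T t \<theta> x"
      using elim(2) c by (intro mult_left_mono_neg) (auto intro: mult_nonpos_nonneg)
    ultimately show ?case by (simp add: F_def algebra_simps)
  qed
  have WK: "bounded_L1 M (K powr (2 * c)) (W (2 * c))"
    unfolding bounded_L1_def
  proof (intro conjI allI)
    have "bounded_L1 M (K powr (2 * c)) (\<lambda>x. u x powr (2 * c))"
      using c by (intro bounded_L1_powr u K) auto
    note D = bounded_L1D[OF this]
    show "integrable M (W (2 * c))"
      by (rule Bochner_Integration.integrable_bound[OF D(1)])
        (use L2_measurable[OF Wc(4)] in \<open>auto simp: W_def \<theta>_def\<close>)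
    show "0 \<le> W (2 * c) x" "W (2 * c) x \<le> K powr (2 * c)" for x
      using D(4)[of x] by (auto simp: W_def \<theta>_def)
  qed
  have K': "1 \<le> K powr (2 * c)" using K c by (simp add: ge_one_powr_ge_zero)
  have I: "integrable M (\<lambda>x. u x powr (2 * c))"
    using c by (intro bounded_L1_powr_integrable[OF u K]) auto
  \<comment> \<open>The counterpart of \<open>T t \<theta> \<le> 1\<close> for the other variable:
    contractivity on L^1 removes \<open>T t\<close> from the last term, again in the direction given
    by the sign of \<open>1 - c\<close>.\<close>
  have TW: "(LINT x|M. T t (W (2 * c)) x) \<le> (LINT x|M. u x powr (2 * c))"
  proof -
    have "(LINT x|M. T t (W (2 * c)) x) \<le> (LINT x|M. W (2 * c) x)"
      by (rule T_integral_le(2)[OF WK K' t])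
    also have "\<dots> \<le> (LINT x|M. u x powr (2 * c))"
      by (rule integral_mono[OF bounded_L1D(1)[OF WK] I]) (auto simp: W_def \<theta>_def)
    finally show ?thesis .
  qed
  have c': "1 \<le> 2 * c - 1" using c by simp
  have int: "integrable M (\<lambda>x. u x powr r * T t (W r') x)" if "1 \<le> r" "1 \<le> r'" for r r'
    by (intro L2_integrable_mult pL2 maps_L2 t W2 that)
  have int1: "integrable M (\<lambda>x. u x * T t (W r') x)" if "1 \<le> r'" for r'
    by (intro L2_integrable_mult u2 maps_L2 t W2 that)
  define Z where "Z x = (1 - c) * u x powr (2 * c) - 2 * (u x powr c * T t (W c) x)
      + c * (u x * T t (W (2 * c - 1)) x) + c * (u x powr (2 * c - 1) * T t (W 1) x)
      + (1 - c) * T t (W (2 * c)) x" for x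
  have "AE x in M. 0 \<le> - Z x" using AE_le by eventually_elim (simp add: Z_def)
  then have "0 \<le> (LINT x|M. - Z x)" by (rule integral_nonneg_AE)
  then have "(LINT x|M. Z x) \<le> 0" by simp
  then have "(LINT x|M. (1 - c) * u x powr (2 * c) - 2 * (u x powr c * T t (W c) x)
      + c * (u x * T t (W (2 * c - 1)) x) + c * (u x powr (2 * c - 1) * T t (W 1) x)
      + (1 - c) * T t (W (2 * c)) x) \<le> 0"
    unfolding Z_def .
  then have "(1 - c) * (LINT x|M. u x powr (2 * c)) - 2 * L2_inner M (\<lambda>x. u x powr c) (T t (W c))
      + c * L2_inner M u (T t (W (2 * c - 1))) + c * L2_inner M (\<lambda>x. u x powr (2 * c - 1)) (T t (W 1))
      + (1 - c) * (LINT x|M. T t (W (2 * c)) x) \<le> 0"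
    unfolding L2_inner_def using I int[of c c] int1[of "2 * c - 1"] int[of "2 * c - 1" 1]
      T_integral_le(1)[OF WK K' t] c c' by simp
  moreover have "(1 - c) * (LINT x|M. u x powr (2 * c)) \<le> (1 - c) * (LINT x|M. T t (W (2 * c)) x)"
    using TW c by (intro mult_left_mono_neg) auto
  ultimately have "2 * (1 - c) * (LINT x|M. u x powr (2 * c)) - 2 * L2_inner M (\<lambda>x. u x powr c) (T t (W c))
      + c * L2_inner M u (T t (W (2 * c - 1))) + c * L2_inner M (\<lambda>x. u x powr (2 * c - 1)) (T t (W 1)) \<le> 0"
    by (simp add: algebra_simps)
  \<comment> \<open>Symmetry lets \<open>T t\<close> act on the uncut function and leaves the cutoff
    outside, where dominated convergence can remove it.\<close>
  moreover have "L2_inner M w (T t (W r)) = (LINT x|M. \<theta> x * (u x powr r * T t w x))"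
    if "w \<in> Lp_space M 2" "1 \<le> r" for w r
    unfolding symmetric[OF t that(1) W2[OF that(2)], symmetric]
    by (simp add: L2_inner_def W_def mult_ac)
  ultimately show ?thesis
    using pL2[OF c] pL2[OF c'] u2 c c' u0 by simp
qed

text \<open>The cutoff level \<open>1 / (n + 1)\<close> tends to 0 and dominated convergence removes
  the cutoff; the side condition in \<open>lim\<close> is there because the cutoffs never reach the
  set where \<open>u\<close> vanishes. By symmetry the two mixed terms coincide.\<close>

lemma Stroock_Varopoulos:
  assumes u: "bounded_L1 M K u" and K: "1 \<le> K" and c: "1 \<le> c" and t: "0 \<le> t"
  shows "autocorr (\<lambda>x. u x powr c) 0 - autocorr (\<lambda>x. u x powr c) t
    \<le> c * (L2_inner M (\<lambda>x. u x powr (2 * c - 1)) u - L2_inner M (\<lambda>x. u x powr (2 * c - 1)) (T t u))"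
proof -
  note um[measurable] = bounded_L1D(2)[OF u] and u0 = bounded_L1D(3)[OF u]
  have u2: "u \<in> Lp_space M 2" by (rule bounded_L1_L2[OF u K])
  have pL2: "(\<lambda>x. u x powr r) \<in> Lp_space M 2" if "1 \<le> r" for r
    by (rule bounded_L1_powr_L2[OF u K]) (use that in simp)
  define \<theta> where "\<theta> n x = (if inverse (real (Suc n)) \<le> u x then 1 else 0 :: real)" for n x
  have lim: "(\<lambda>n. LINT x|M. \<theta> n x * (v x * w x)) \<longlonglongrightarrow> L2_inner M v w"
    if v: "v \<in> Lp_space M 2" and w: "w \<in> Lp_space M 2" and 0: "\<And>x. u x = 0 \<Longrightarrow> v x = 0" for v w
    unfolding L2_inner_def
  proof (rule integral_dominated_convergence)
    show i: "integrable M (\<lambda>x. \<bar>v x * w x\<bar>)" using L2_integrable_mult[OF v w] by simp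
    show m: "(\<lambda>x. v x * w x) \<in> borel_measurable M" using L2_integrable_mult[OF v w] by simp
    show "(\<lambda>x. \<theta> n x * (v x * w x)) \<in> borel_measurable M" for n
      unfolding \<theta>_def by (intro borel_measurable_times m) measurable
    show "AE x in M. norm (\<theta> n x * (v x * w x)) \<le> \<bar>v x * w x\<bar>" for n
      by (intro AE_I2) (auto simp: \<theta>_def)
    show "AE x in M. (\<lambda>n. \<theta> n x * (v x * w x)) \<longlonglongrightarrow> v x * w x"
    proof (intro AE_I2)
      fix x
      show "(\<lambda>n. \<theta> n x * (v x * w x)) \<longlonglongrightarrow> v x * w x"
      proof (cases "u x = 0")
        case False
        then have "0 < u x" using u0[of x] by simp
        then have "\<forall>\<^sub>F n in sequentially. inverse (real (Suc n)) < u x"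
          by (intro order_tendstoD(2)[OF LIMSEQ_inverse_real_of_nat])
        then have "\<forall>\<^sub>F n in sequentially. v x * w x = \<theta> n x * (v x * w x)"
          by eventually_elim (simp add: \<theta>_def)
        then show ?thesis by (rule Lim_transform_eventually[OF tendsto_const])
      qed (simp add: 0)
    qed
  qed
  have c': "1 \<le> 2 * c - 1" using c by simp
  have "(\<lambda>n. 2 * (1 - c) * (LINT x|M. u x powr (2 * c))
    - 2 * (LINT x|M. \<theta> n x * (u x powr c * T t (\<lambda>y. u y powr c) x))
    + c * (LINT x|M. \<theta> n x * (u x powr (2 * c - 1) * T t u x))
    + c * (LINT x|M. \<theta> n x * (u x * T t (\<lambda>y. u y powr (2 * c - 1)) x)))
    \<longlonglongrightarrow> 2 * (1 - c) * (LINT x|M. u x powr (2 * c))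
    - 2 * L2_inner M (\<lambda>x. u x powr c) (T t (\<lambda>y. u y powr c))
    + c * L2_inner M (\<lambda>x. u x powr (2 * c - 1)) (T t u)
    + c * L2_inner M u (T t (\<lambda>y. u y powr (2 * c - 1)))"
    by (intro tendsto_intros lim maps_L2 t pL2 u2 c c') auto
  then have "2 * (1 - c) * (LINT x|M. u x powr (2 * c))
    - 2 * L2_inner M (\<lambda>x. u x powr c) (T t (\<lambda>y. u y powr c))
    + c * L2_inner M (\<lambda>x. u x powr (2 * c - 1)) (T t u)
    + c * L2_inner M u (T t (\<lambda>y. u y powr (2 * c - 1))) \<le> 0"
  proof (rule LIMSEQ_le_const2, intro exI allI impI)
    fix n
    show "2 * (1 - c) * (LINT x|M. u x powr (2 * c))
      - 2 * (LINT x|M. \<theta> n x * (u x powr c * T t (\<lambda>y. u y powr c) x))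
      + c * (LINT x|M. \<theta> n x * (u x powr (2 * c - 1) * T t u x))
      + c * (LINT x|M. \<theta> n x * (u x * T t (\<lambda>y. u y powr (2 * c - 1)) x)) \<le> 0"
      unfolding \<theta>_def by (rule Stroock_Varopoulos_cutoff[OF u K c t]) simp
  qed
  moreover have "L2_inner M u (T t (\<lambda>y. u y powr (2 * c - 1))) = L2_inner M (\<lambda>x. u x powr (2 * c - 1)) (T t u)"
    using symmetric[OF t u2 pL2[OF c']] by (simp add: L2_inner_commute)
  moreover have "L2_inner M (\<lambda>x. u x powr (2 * c - 1)) u = (LINT x|M. u x powr (2 * c))"
  proof -
    have "u x powr (2 * c - 1) * u x = u x powr (2 * c)" for x
      using u0[of x] powr_add[of "u x" "2 * c - 1" 1] by (cases "u x = 0") auto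
    then show ?thesis by (simp add: L2_inner_def)
  qed
  moreover have "autocorr (\<lambda>x. u x powr c) 0 = (LINT x|M. u x powr (2 * c))"
    unfolding autocorr_0[OF pL2[OF c]] L2_inner_def by (simp flip: powr_add)
  ultimately show ?thesis by (simp add: autocorr_def algebra_simps)
qed

end

section \<open>Evolution of the $L^{p(s)}$ norm\<close>

text \<open>The derivative estimate for the norms is proved only at positive times, as the Lipschitz
  constant \<open>||f|| / s\<close> of the orbit blows up at 0; continuity at \<open>a\<close> makes
  up for the endpoint.\<close>

lemma Dini_nonincreasing_interior:
  fixes G :: "real \<Rightarrow> real"
  assumes ab: "a < b" and cont: "continuous_on {a..b} G"
    and Dini: "\<And>s e. a < s \<Longrightarrow> s < b \<Longrightarrow> 0 < e \<Longrightarrow> \<forall>\<^sub>F h in at_right 0. G (s + h) \<le> G s + e * h"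
  shows "G b \<le> G a"
proof (rule tendsto_lowerbound)
  have "(G \<longlongrightarrow> G a) (at a within {a..b})"
    using cont ab by (auto simp: continuous_on_def)
  then show "(G \<longlongrightarrow> G a) (at_right a)"
    using at_within_Icc_at_right[OF ab] by simp
  show "\<forall>\<^sub>F s in at_right a. G b \<le> G s"
    using eventually_at_right_real[OF ab]
  proof eventually_elim
    case (elim s)
    then show ?case
      by (intro Dini_nonincreasing[of s b] continuous_on_subset[OF cont] Dini) auto
  qed
qed simp

text \<open>The function changes at the fixed exponent \<open>p\<close>, then the exponent changes
  at the fixed function \<open>v\<close>; the factors \<open>u + v\<close> and \<open>v\<close> keep
  the two majorants integrable.\<close>

lemma power_integral_diff_le:
  assumes u: "bounded_L1 M K u" and v: "bounded_L1 M K v" and K: "1 \<le> K"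
    and p: "2 \<le> p" "p \<le> P" and q: "2 \<le> q" "q \<le> P"
  shows "\<bar>(LINT x|M. u x powr p) - (LINT x|M. v x powr q)\<bar>
    \<le> P * K powr P * ((Lp_norm M 2 u + Lp_norm M 2 v) * Lp_norm M 2 (\<lambda>x. u x - v x))
      + 8 * K powr P * \<bar>p - q\<bar> * (LINT x|M. v x)"
proof -
  note uD = bounded_L1D[OF u] and vD = bounded_L1D[OF v]
  have u2: "u \<in> Lp_space M 2" and v2: "v \<in> Lp_space M 2"
    by (intro bounded_L1_L2[OF _ K] u v)+
  have d2: "(\<lambda>x. \<bar>u x - v x\<bar>) \<in> Lp_space M 2"
    by (rule L2_bound[OF L2_diff[OF u2 v2]]) (use uD(2) vD(2) in auto)
  have dn: "Lp_norm M 2 (\<lambda>x. \<bar>u x - v x\<bar>) = Lp_norm M 2 (\<lambda>x. u x - v x)"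
    by (simp add: Lp_norm_2 L2_inner_def)
  have up: "integrable M (\<lambda>x. u x powr p)" and vp: "integrable M (\<lambda>x. v x powr p)"
    and vq: "integrable M (\<lambda>x. v x powr q)"
    using p q by (auto intro!: bounded_L1_powr_integrable[OF u K] bounded_L1_powr_integrable[OF v K])
  have "\<bar>(LINT x|M. u x powr p) - (LINT x|M. v x powr p)\<bar> \<le> (LINT x|M. \<bar>u x powr p - v x powr p\<bar>)"
    using up vp integral_abs_bound[of M "\<lambda>x. u x powr p - v x powr p"] by simp
  also have "\<dots> \<le> (LINT x|M. P * K powr P * ((u x + v x) * \<bar>u x - v x\<bar>))"
    using up vp uD vD p
    by (intro integral_mono powr_diff_le(1) K integrable_mult_right L2_integrable_mult L2_add u2 v2 d2) auto
  also have "\<dots> = P * K powr P * L2_inner M (\<lambda>x. u x + v x) (\<lambda>x. \<bar>u x - v x\<bar>)"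
    by (simp add: L2_inner_def)
  also have "\<dots> \<le> P * K powr P * ((Lp_norm M 2 u + Lp_norm M 2 v) * Lp_norm M 2 (\<lambda>x. u x - v x))"
  proof (rule mult_left_mono)
    have "L2_inner M (\<lambda>x. u x + v x) (\<lambda>x. \<bar>u x - v x\<bar>)
        \<le> Lp_norm M 2 (\<lambda>x. u x + v x) * Lp_norm M 2 (\<lambda>x. u x - v x)"
      using Cauchy_Schwarz_L2[OF L2_add[OF u2 v2] d2] by (simp add: dn)
    also have "\<dots> \<le> (Lp_norm M 2 u + Lp_norm M 2 v) * Lp_norm M 2 (\<lambda>x. u x - v x)"
      by (intro mult_right_mono Lp_norm_2_add_le u2 v2 Lp_norm_2_nonneg)
    finally show "L2_inner M (\<lambda>x. u x + v x) (\<lambda>x. \<bar>u x - v x\<bar>)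
      \<le> (Lp_norm M 2 u + Lp_norm M 2 v) * Lp_norm M 2 (\<lambda>x. u x - v x)" .
  qed (use p in simp)
  finally have 1: "\<bar>(LINT x|M. u x powr p) - (LINT x|M. v x powr p)\<bar>
      \<le> P * K powr P * ((Lp_norm M 2 u + Lp_norm M 2 v) * Lp_norm M 2 (\<lambda>x. u x - v x))" .
  have "\<bar>v x powr p - v x powr q\<bar> \<le> 8 * K powr P * \<bar>p - q\<bar> * v x" for x
    using powr_exponent_diff_le[OF K vD(3,4), of p q P x] powr_exponent_diff_le[OF K vD(3,4), of q p P x] p q
    by (cases "p \<le> q") (auto simp: abs_minus_commute)
  then have "(LINT x|M. \<bar>v x powr p - v x powr q\<bar>) \<le> (LINT x|M. 8 * K powr P * \<bar>p - q\<bar> * v x)"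
    using vp vq vD(1) by (intro integral_mono) auto
  moreover have "\<bar>(LINT x|M. v x powr p) - (LINT x|M. v x powr q)\<bar> \<le> (LINT x|M. \<bar>v x powr p - v x powr q\<bar>)"
    using vp vq integral_abs_bound[of M "\<lambda>x. v x powr p - v x powr q"] by simp
  ultimately have 2: "\<bar>(LINT x|M. v x powr p) - (LINT x|M. v x powr q)\<bar> \<le> 8 * K powr P * \<bar>p - q\<bar> * (LINT x|M. v x)"
    by simp
  show ?thesis using 1 2 by linarith
qed

context symmetric_markov_semigroup
begin

lemma evolve_add_AE:
  assumes f: "bounded_L1 M K f" and K: "1 \<le> K" and s: "0 \<le> s" and h: "0 \<le> h"
  shows "AE x in M. T h (evolve K f s) x = evolve K f (s + h) x"
proof -
  have f2: "f \<in> Lp_space M 2" by (rule bounded_L1_L2[OF f K])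
  have "AE x in M. T h (evolve K f s) x = T h (T s f) x"
    by (rule respects_AE[OF h bounded_L1_L2[OF evolve_L1(1)[OF f K s] K] maps_L2[OF s f2] evolve_AE[OF f K s]])
  moreover have "AE x in M. T (h + s) f x = T h (T s f) x"
    by (rule T_add[OF h s f2])
  moreover have "AE x in M. evolve K f (s + h) x = T (s + h) f x"
    by (rule evolve_AE[OF f K]) (use s h in simp)
  ultimately show ?thesis by eventually_elim (simp add: add.commute)
qed

definition power_integral :: "real \<Rightarrow> ('a \<Rightarrow> real) \<Rightarrow> real \<Rightarrow> real \<Rightarrow> real" where
  "power_integral K f p s = (LINT x|M. evolve K f s x powr p)"

lemma power_integral_nonneg: "0 \<le> power_integral K f p s"
  by (simp add: power_integral_def)

text \<open>Contractivity on L^p raised to the power \<open>p\<close>. It carries a bound with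
  exponent \<open>p s\<close> at a time \<open>s < t\<close> over to the fixed time
  \<open>t\<close>, at which the path of exponents has run off to infinity.\<close>

lemma power_integral_antimono:
  assumes f: "bounded_L1 M K f" and K: "1 \<le> K" and s: "0 \<le> s" "s \<le> t" and p: "1 \<le> p"
  shows "power_integral K f p t \<le> power_integral K f p s"
proof -
  define u where "u = evolve K f s"
  have u: "bounded_L1 M K u" unfolding u_def by (rule evolve_L1[OF f K s(1)])
  have u2: "u \<in> Lp_space M 2" by (rule bounded_L1_L2[OF u K])
  have AE: "AE x in M. T (t - s) u x = evolve K f t x"
    using evolve_add_AE[OF f K s(1), of "t - s"] s by (simp add: u_def)
  have "Lp_norm M p (T (t - s) u) \<le> Lp_norm M p u"
    using contractive_Lp[of "t - s" p u] u2 bounded_L1_Lp[OF u K p] s p by auto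
  then have "(LINT x|M. \<bar>T (t - s) u x\<bar> powr p) powr (1 / p) \<le> (LINT x|M. \<bar>u x\<bar> powr p) powr (1 / p)"
    by (simp add: Lp_norm_def)
  then have "((LINT x|M. \<bar>T (t - s) u x\<bar> powr p) powr (1 / p)) powr p \<le> ((LINT x|M. \<bar>u x\<bar> powr p) powr (1 / p)) powr p"
    using p by - (rule powr_mono2, auto)
  moreover have "((LINT x|M. \<bar>w x\<bar> powr p) powr (1 / p)) powr p = (LINT x|M. \<bar>w x\<bar> powr p)" for w
    using p by (simp add: powr_powr)
  ultimately have "(LINT x|M. \<bar>T (t - s) u x\<bar> powr p) \<le> (LINT x|M. \<bar>u x\<bar> powr p)"
    by (simp only:)
  also have "(LINT x|M. \<bar>T (t - s) u x\<bar> powr p) = power_integral K f p t"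
    unfolding power_integral_def
  proof (rule integral_cong_AE)
    have [measurable]: "T (t - s) u \<in> borel_measurable M" "evolve K f t \<in> borel_measurable M"
      using s by (auto intro!: T_measurable u2 evolve_measurable[OF f K])
    show "(\<lambda>x. \<bar>T (t - s) u x\<bar> powr p) \<in> borel_measurable M" by measurable
    show "(\<lambda>x. evolve K f t x powr p) \<in> borel_measurable M" by measurable
    show "AE x in M. \<bar>T (t - s) u x\<bar> powr p = evolve K f t x powr p"
      using AE by eventually_elim (simp add: evolve_def)
  qed
  finally show ?thesis
    using bounded_L1D(3)[OF u] by (simp add: power_integral_def u_def)
qed

lemma evolve_norm_le:
  assumes f: "bounded_L1 M K f" and K: "1 \<le> K" and s: "0 \<le> s"
  shows "Lp_norm M 2 (evolve K f s) \<le> Lp_norm M 2 f"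
proof -
  have f2: "f \<in> Lp_space M 2" by (rule bounded_L1_L2[OF f K])
  have "Lp_norm M 2 (evolve K f s) = Lp_norm M 2 (T s f)"
    by (intro Lp_norm_2_cong_AE evolve_measurable evolve_AE T_measurable f K s f2)
  then show ?thesis using T_contraction[OF s f2] by simp
qed

lemma continuous_on_power_integral:
  assumes f: "bounded_L1 M K f" and K: "1 \<le> K" and p: "continuous_on {0..b} p"
    and pP: "\<And>r. 0 \<le> r \<Longrightarrow> r \<le> b \<Longrightarrow> 2 \<le> p r \<and> p r \<le> P"
  shows "continuous_on {0..b} (\<lambda>r. power_integral K f (p r) r)"
  unfolding continuous_on_def
proof
  fix r0 assume "r0 \<in> {0..b}"
  then have r0: "0 \<le> r0" "r0 \<le> b" by auto
  have f2: "f \<in> Lp_space M 2" by (rule bounded_L1_L2[OF f K])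
  define D where "D r = Lp_norm M 2 (\<lambda>x. T r f x - T r0 f x)" for r
  have D: "(D \<longlongrightarrow> 0) (at r0 within {0..b})"
    unfolding D_def by (rule tendsto_within_subset[OF T_continuous[OF f2 r0(1)]]) auto
  have "(p \<longlongrightarrow> p r0) (at r0 within {0..b})" using p r0 by (auto simp: continuous_on_def)
  then have "((\<lambda>r. P * K powr P * ((Lp_norm M 2 f + Lp_norm M 2 f) * D r)
      + 8 * K powr P * \<bar>p r - p r0\<bar> * (LINT x|M. f x)) \<longlongrightarrow>
    P * K powr P * ((Lp_norm M 2 f + Lp_norm M 2 f) * 0)
      + 8 * K powr P * \<bar>p r0 - p r0\<bar> * (LINT x|M. f x)) (at r0 within {0..b})"
    by (intro tendsto_intros D)
  then have lim: "((\<lambda>r. P * K powr P * ((Lp_norm M 2 f + Lp_norm M 2 f) * D r)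
      + 8 * K powr P * \<bar>p r - p r0\<bar> * (LINT x|M. f x)) \<longlongrightarrow> 0) (at r0 within {0..b})"
    by simp
  show "((\<lambda>r. power_integral K f (p r) r) \<longlongrightarrow> power_integral K f (p r0) r0) (at r0 within {0..b})"
  proof (rule LIM_zero_cancel, rule Lim_null_comparison[OF _ lim])
    have "norm (power_integral K f (p r) r - power_integral K f (p r0) r0)
      \<le> P * K powr P * ((Lp_norm M 2 f + Lp_norm M 2 f) * D r)
        + 8 * K powr P * \<bar>p r - p r0\<bar> * (LINT x|M. f x)" if r: "r \<in> {0..b}" for r
    proof -
      have r': "0 \<le> r" "r \<le> b" using r by auto
      have "norm (power_integral K f (p r) r - power_integral K f (p r0) r0)
        \<le> P * K powr P * ((Lp_norm M 2 (evolve K f r) + Lp_norm M 2 (evolve K f r0)) * D r)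
        + 8 * K powr P * \<bar>p r - p r0\<bar> * (LINT x|M. evolve K f r0 x)"
        using power_integral_diff_le[OF evolve_L1(1)[OF f K r'(1)] evolve_L1(1)[OF f K r0(1)] K, of "p r" P "p r0"]
          pP[OF r'] pP[OF r0]
        by (simp add: power_integral_def D_def evolve_diff_norm[OF f K r'(1) r0(1)])
      also have "\<dots> \<le> P * K powr P * ((Lp_norm M 2 f + Lp_norm M 2 f) * D r)
        + 8 * K powr P * \<bar>p r - p r0\<bar> * (LINT x|M. f x)"
        using pP[OF r0] evolve_norm_le[OF f K r'(1)] evolve_norm_le[OF f K r0(1)] evolve_L1(2)[OF f K r0(1)]
        by (intro add_mono mult_left_mono mult_right_mono) (auto simp: D_def Lp_norm_2_nonneg)
      finally show ?thesis .
    qed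
    then show "\<forall>\<^sub>F r in at r0 within {0..b}. norm (power_integral K f (p r) r - power_integral K f (p r0) r0)
      \<le> P * K powr P * ((Lp_norm M 2 f + Lp_norm M 2 f) * D r)
        + 8 * K powr P * \<bar>p r - p r0\<bar> * (LINT x|M. f x)"
      by (simp add: eventually_at_filter)
  qed
qed

end

context log_sobolev_semigroup
begin

text \<open>With \<open>v\<close> at time \<open>s + h\<close> and \<open>q = p (s + h)\<close>, the
  tangent inequality at \<open>v\<close> bounds \<open>v^q - u^q\<close> by
  \<open>q v^(q-1) (v - u)\<close>, so no pointwise differentiability in time enters. Replacing
  \<open>v^(q-1)\<close> by \<open>u^(p-1)\<close> costs terms of order \<open>h^2\<close>, since
  \<open>v - u\<close> is of order \<open>h\<close> in L^2. The first-order terms left are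
  \<open>q (u^(p-1), v - u)\<close>, controlled by Stroock-Varopoulos and the logarithmic Sobolev
  inequality, and \<open>q - p\<close> times the entropy.\<close>

lemma power_integral_Dini:
  assumes f: "bounded_L1 M K f" and K: "1 \<le> K" and s: "0 < s"
    and p: "(p has_real_derivative p') (at s)" and p': "0 < p'" and p2: "2 \<le> p s"
    and N: "N = power_integral K f (p s) s" "0 < N" and e: "0 < e"
  shows "\<forall>\<^sub>F h in at_right 0. power_integral K f (p (s + h)) (s + h)
    \<le> N + h * (p' * (2 * \<beta> (p s / p') / p s + ln N / p s) * N + e)"
proof -
  define u where "u = evolve K f s"
  have s0: "0 \<le> s" using s by simp
  have u: "bounded_L1 M K u" unfolding u_def by (rule evolve_L1[OF f K s0])
  note uD = bounded_L1D[OF u]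
  have f2: "f \<in> Lp_space M 2" by (rule bounded_L1_L2[OF f K])
  have u2: "u \<in> Lp_space M 2" by (rule bounded_L1_L2[OF u K])
  \<comment> \<open>The \<open>+ 1\<close> leaves room for \<open>p (s + h)\<close> at small
    \<open>h\<close>, so that the constants do not depend on \<open>h\<close>.\<close>
  define P where "P = p s + 1"
  define c where "c = p s / 2"
  define L where "L = Lp_norm M 2 f / s"
  define g where "g x = u x powr c" for x
  define ent where "ent = (LINT x|M. u x powr p s * ln (u x))"
  define S1 where "S1 = Lp_norm M 2 (\<lambda>x. sqrt (u x))"
  define S0 where "S0 = (LINT x|M. u x)"
  define C where "C = 8 * K powr P"
  define \<epsilon> where "\<epsilon> = p s / p'"
  have c: "1 \<le> c" using p2 by (simp add: c_def)
  have L0: "0 \<le> L" using s by (simp add: L_def Lp_norm_2_nonneg)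
  have \<epsilon>: "0 < \<epsilon>" using p2 p' by (simp add: \<epsilon>_def)
  have g: "bounded_L1 M (K powr c) g"
    unfolding g_def[abs_def] by (rule bounded_L1_powr[OF u K c])
  have Kc: "1 \<le> K powr c" using K c by (simp add: ge_one_powr_ge_zero)
  have g2: "g \<in> Lp_space M 2" by (rule bounded_L1_L2[OF g Kc])
  have gg: "(g x)\<^sup>2 = u x powr p s" for x
    unfolding g_def c_def power2_eq_square by (simp flip: powr_add)
  have Nu: "N = (LINT x|M. u x powr p s)" by (simp add: N power_integral_def u_def)
  have Ng: "(Lp_norm M 2 g)\<^sup>2 = N"
    unfolding Lp_norm_2_sq unfolding L2_inner_def Nu by (simp add: power2_eq_square flip: gg)
  then have Ng0: "0 < Lp_norm M 2 g"
    using N(2) Lp_norm_2_nonneg[of M g] by (metis less_eq_real_def power_zero_numeral less_irrefl)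
  have lnNg: "ln (Lp_norm M 2 g) = ln N / 2"
    using Ng0 by (simp add: Ng[symmetric] ln_realpow)
  have entg: "(LINT x|M. (g x)\<^sup>2 * ln (g x)) = c * ent"
  proof -
    have "(g x)\<^sup>2 * ln (g x) = c * (u x powr p s * ln (u x))" for x
      unfolding gg using uD(3)[of x] by (cases "u x = 0") (auto simp: g_def ln_powr)
    then show ?thesis by (simp add: ent_def)
  qed
  define X where "X = (c * ent - \<beta> \<epsilon> * N - N * (ln N / 2)) / \<epsilon>"
  have ev1: "\<forall>\<^sub>F h in at_right 0. X - e / 8 \<le> (autocorr g 0 - autocorr g h) / h"
    using log_sobolev_increment[OF g Kc \<epsilon>, of "e / 8" "Lp_norm M 2 g"] Ng0 e
    by (simp add: entg Ng lnNg X_def)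
  have ev2: "\<forall>\<^sub>F h in at_right 0. p s \<le> p (s + h)"
  proof -
    obtain d where "0 < d" "\<forall>h>0. h < d \<longrightarrow> p s < p (s + h)"
      using has_real_derivative_pos_inc_right[OF p p'] by auto
    then show ?thesis by (auto simp: eventually_at_right_field intro!: exI[of _ d] less_imp_le)
  qed
  have plim: "((\<lambda>h. p (s + h)) \<longlongrightarrow> p s) (at_right 0)"
    using DERIV_isCont[OF p] by (simp add: isCont_def LIM_offset_zero_iff tendsto_within_subset[of _ _ 0 UNIV])
  have plim': "((\<lambda>h. (p (s + h) - p s) / h) \<longlongrightarrow> p') (at_right 0)"
    using p by (simp add: DERIV_def tendsto_within_subset[of _ _ 0 UNIV])
  have ev3: "\<forall>\<^sub>F h in at_right 0. p (s + h) < P"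
    by (rule order_tendstoD(2)[OF plim]) (simp add: P_def)
  \<comment> \<open>\<open>h * R h\<close> will bound the increment. The terms with an extra factor
    \<open>h\<close> or \<open>p (s + h) - p s\<close> vanish in the limit; those with the entropy
    and \<open>X\<close> survive.\<close>
  define R where "R h = P * (P * K powr P) * (h * L\<^sup>2) + P * C * (p (s + h) - p s) * (S1 * L)
    + (p (s + h) - p s) / h * ent + C\<^sup>2 * ((p (s + h) - p s) / h) * (p (s + h) - p s) * S0
    - 2 * (X - e / 8)" for h
  have "(R \<longlongrightarrow> P * (P * K powr P) * (0 * L\<^sup>2) + P * C * (p s - p s) * (S1 * L)
    + p' * ent + C\<^sup>2 * p' * (p s - p s) * S0 - 2 * (X - e / 8)) (at_right 0)"
    unfolding R_def[abs_def] by (intro tendsto_intros plim plim')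
  then have R: "(R \<longlongrightarrow> p' * ent - (2 * X - e / 4)) (at_right 0)" by simp
  \<comment> \<open>Since \<open>2 * c / \<epsilon> = p'\<close>, the entropy cancels; this is the
    reason for the choice of \<epsilon>.\<close>
  have "p' * ent - 2 * X = p' * (2 * \<beta> (p s / p') / p s + ln N / p s) * N"
    using p2 p' unfolding X_def \<epsilon>_def c_def by (simp add: field_simps)
  then have "p' * ent - (2 * X - e / 4) = p' * (2 * \<beta> (p s / p') / p s + ln N / p s) * N + e / 4"
    by linarith
  with R have "(R \<longlongrightarrow> p' * (2 * \<beta> (p s / p') / p s + ln N / p s) * N + e / 4) (at_right 0)"
    by (simp only:)
  then have ev4: "\<forall>\<^sub>F h in at_right 0. R h < p' * (2 * \<beta> (p s / p') / p s + ln N / p s) * N + e"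
    by (rule order_tendstoD(2)) (use e in simp)
  show ?thesis
    using ev1 ev2 ev3 ev4 eventually_at_right_less[of "0::real"]
  proof eventually_elim
    case (elim h)
    define q where "q = p (s + h)"
    have h: "0 < h" "0 \<le> h" and q: "p s \<le> q" "q \<le> P" using elim by (auto simp: q_def)
    define v where "v = evolve K f (s + h)"
    have v: "bounded_L1 M K v" unfolding v_def by (rule evolve_L1[OF f K]) (use s h in simp)
    note vD = bounded_L1D[OF v]
    have v2: "v \<in> Lp_space M 2" by (rule bounded_L1_L2[OF v K])
    have d2: "(\<lambda>x. v x - u x) \<in> Lp_space M 2" by (rule L2_diff[OF v2 u2])
    have a2: "(\<lambda>x. \<bar>v x - u x\<bar>) \<in> Lp_space M 2"
      by (rule L2_bound[OF d2]) (use uD(2) vD(2) in auto)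
    have r2: "(\<lambda>x. sqrt (u x)) \<in> Lp_space M 2" using uD by (simp add: Lp_space_2_iff)
    have w2: "(\<lambda>x. u x powr (p s - 1)) \<in> Lp_space M 2"
      by (rule bounded_L1_powr_L2[OF u K]) (use p2 in simp)
    have dist: "Lp_norm M 2 (\<lambda>x. v x - u x) \<le> h * L"
    proof -
      have "Lp_norm M 2 (\<lambda>x. v x - u x) = Lp_norm M 2 (\<lambda>x. T s f x - T (s + h) f x)"
        unfolding u_def v_def using s h
        by (subst evolve_diff_norm[OF f K]) (auto simp: Lp_norm_2_minus_commute[of M "T (s + h) f"])
      also have "\<dots> \<le> h * L"
        using T_increment_norm_le[OF f2 s h(1)] by (simp add: L_def)
      finally show ?thesis .
    qed
    have i1: "integrable M (\<lambda>x. (v x - u x)\<^sup>2)" using d2 by (simp add: Lp_space_2_iff)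
    have i2: "integrable M (\<lambda>x. sqrt (u x) * \<bar>v x - u x\<bar>)" by (rule L2_integrable_mult[OF r2 a2])
    have i3: "integrable M (\<lambda>x. u x powr (p s - 1) * (v x - u x))" by (rule L2_integrable_mult[OF w2 d2])
    have i4: "integrable M (\<lambda>x. u x powr p s * ln (u x))"
    proof (rule bounded_L1_integrable[OF u, where C = "8 * K powr P"])
      show "(\<lambda>x. u x powr p s * ln (u x)) \<in> borel_measurable M" using uD(2) by measurable
      show "\<bar>x powr p s * ln x\<bar> \<le> 8 * K powr P * x" if "0 \<le> x" "x \<le> K" for x
        by (rule powr_mult_abs_ln_le_linear[OF K that p2]) (simp add: P_def)
    qed
    have iv: "integrable M (\<lambda>x. v x powr q)" and iu: "integrable M (\<lambda>x. u x powr p s)"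
      using p2 q by (auto intro!: bounded_L1_powr_integrable[OF v K] bounded_L1_powr_integrable[OF u K])
    have "v x powr q - u x powr p s \<le> P * (P * K powr P) * (v x - u x)\<^sup>2
      + P * (C * (q - p s)) * (sqrt (u x) * \<bar>v x - u x\<bar>) + q * (u x powr (p s - 1) * (v x - u x))
      + (q - p s) * (u x powr p s * ln (u x)) + C\<^sup>2 * (q - p s)\<^sup>2 * u x" for x
    proof -
      have le: "a * b \<le> P * (B * \<bar>b\<bar>)" if "\<bar>a\<bar> \<le> q * B" for a b B
      proof -
        have "a * b \<le> \<bar>a\<bar> * \<bar>b\<bar>" by (metis abs_ge_self abs_mult)
        also have "\<dots> \<le> (q * B) * \<bar>b\<bar>" using that by (intro mult_right_mono) auto
        also have "\<dots> \<le> (P * B) * \<bar>b\<bar>"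
        proof -
          have "0 \<le> q * B" using that by linarith
          then have "0 \<le> B" using q p2 by (simp add: zero_le_mult_iff)
          then show ?thesis using q by (intro mult_right_mono) auto
        qed
        finally show ?thesis by simp
      qed
      have "v x powr q - u x powr q \<le> q * v x powr (q - 1) * (v x - u x)"
        using q p2 uD(3)[of x] vD(3)[of x] by (intro powr_tangent_le) auto
      also have "\<dots> = (q * (v x powr (q - 1) - u x powr (q - 1))) * (v x - u x)
          + (q * (u x powr (q - 1) - u x powr (p s - 1))) * (v x - u x)
          + q * (u x powr (p s - 1) * (v x - u x))"
        by (simp add: algebra_simps)
      also have "(q * (v x powr (q - 1) - u x powr (q - 1))) * (v x - u x)
          \<le> P * (P * K powr P * \<bar>v x - u x\<bar> * \<bar>v x - u x\<bar>)"
        using powr_diff_le(2)[OF K vD(3,4), of q P "u x" x] uD(3,4)[of x] q p2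
        by (intro le) (auto simp: abs_mult)
      also have "(q * (u x powr (q - 1) - u x powr (p s - 1))) * (v x - u x)
          \<le> P * (C * (q - p s) * sqrt (u x) * \<bar>v x - u x\<bar>)"
        using powr_exponent_diff_le_sqrt[OF K uD(3,4) p2 q, of x] q p2
        by (intro le) (auto simp: abs_mult C_def)
      finally have "v x powr q - u x powr q \<le> P * (P * K powr P * \<bar>v x - u x\<bar> * \<bar>v x - u x\<bar>)
          + P * (C * (q - p s) * sqrt (u x) * \<bar>v x - u x\<bar>) + q * (u x powr (p s - 1) * (v x - u x))"
        by simp
      moreover have "u x powr q - u x powr p s \<le> (q - p s) * (u x powr p s * ln (u x)) + C\<^sup>2 * (q - p s)\<^sup>2 * u x"
        using powr_exponent_Taylor[OF K uD(3,4) p2 q, of x] by (simp add: C_def)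
      moreover have "\<bar>v x - u x\<bar> * \<bar>v x - u x\<bar> = (v x - u x)\<^sup>2"
        by (simp add: power2_eq_square)
      ultimately show ?thesis by (simp add: mult_ac)
    qed
    then have "(LINT x|M. v x powr q - u x powr p s) \<le> (LINT x|M. P * (P * K powr P) * (v x - u x)\<^sup>2
      + P * (C * (q - p s)) * (sqrt (u x) * \<bar>v x - u x\<bar>) + q * (u x powr (p s - 1) * (v x - u x))
      + (q - p s) * (u x powr p s * ln (u x)) + C\<^sup>2 * (q - p s)\<^sup>2 * u x)"
      using i1 i2 i3 i4 iv iu uD(1) by (intro integral_mono) auto
    then have 1: "(LINT x|M. v x powr q) - N \<le> P * (P * K powr P) * (LINT x|M. (v x - u x)\<^sup>2)
      + P * (C * (q - p s)) * (LINT x|M. sqrt (u x) * \<bar>v x - u x\<bar>) + q * (LINT x|M. u x powr (p s - 1) * (v x - u x))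
      + (q - p s) * ent + C\<^sup>2 * (q - p s)\<^sup>2 * S0"
      unfolding Nu ent_def S0_def using i1 i2 i3 i4 iv iu uD(1) by simp
    have P0: "0 \<le> P" "0 \<le> C" using p2 by (auto simp: P_def C_def)
    have 2: "(LINT x|M. (v x - u x)\<^sup>2) \<le> (h * L)\<^sup>2"
    proof -
      have "(LINT x|M. (v x - u x)\<^sup>2) = (Lp_norm M 2 (\<lambda>x. v x - u x))\<^sup>2"
        unfolding Lp_norm_2_sq L2_inner_def by (simp add: power2_eq_square)
      also have "\<dots> \<le> (h * L)\<^sup>2" by (intro power_mono dist Lp_norm_2_nonneg)
      finally show ?thesis .
    qed
    have 3: "(LINT x|M. sqrt (u x) * \<bar>v x - u x\<bar>) \<le> S1 * (h * L)"
    proof -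
      have "(LINT x|M. sqrt (u x) * \<bar>v x - u x\<bar>) \<le> S1 * Lp_norm M 2 (\<lambda>x. \<bar>v x - u x\<bar>)"
        using Cauchy_Schwarz_L2[OF r2 a2] by (simp add: L2_inner_def S1_def)
      also have "Lp_norm M 2 (\<lambda>x. \<bar>v x - u x\<bar>) = Lp_norm M 2 (\<lambda>x. v x - u x)"
        by (simp add: Lp_norm_2 L2_inner_def)
      also have "S1 * \<dots> \<le> S1 * (h * L)"
        by (intro mult_left_mono dist) (simp add: S1_def Lp_norm_2_nonneg)
      finally show ?thesis .
    qed
    have 4: "q * (LINT x|M. u x powr (p s - 1) * (v x - u x)) \<le> - 2 * h * (X - e / 8)"
    proof -
      define I where "I = (LINT x|M. u x powr (p s - 1) * (v x - u x))"
      have "I = L2_inner M (\<lambda>x. u x powr (p s - 1)) v - L2_inner M (\<lambda>x. u x powr (p s - 1)) u"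
        using L2_inner_diff_right[OF v2 u2 w2] by (simp add: I_def L2_inner_def)
      also have "L2_inner M (\<lambda>x. u x powr (p s - 1)) v = L2_inner M (\<lambda>x. u x powr (p s - 1)) (T h u)"
        using evolve_add_AE[OF f K s0 h(2)] L2_measurable[OF w2] vD(2) T_measurable[OF h(2) u2]
        by (intro L2_inner_cong_AE) (auto simp: u_def v_def elim!: eventually_mono)
      finally have "autocorr g 0 - autocorr g h \<le> c * (- I)"
        using Stroock_Varopoulos[OF u K c h(2)] by (simp add: g_def[abs_def] c_def)
      moreover have "0 \<le> autocorr g 0 - autocorr g h"
        using autocorr_decreasing[OF g2 order_refl h(2)] by simp
      moreover have "h * (X - e / 8) \<le> autocorr g 0 - autocorr g h"
        using elim(1) h(1) by (simp add: field_simps)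
      ultimately have I: "h * (X - e / 8) \<le> c * (- I)" "0 \<le> c * (- I)" by auto
      \<comment> \<open>The sign matters: since \<open>I \<le> 0\<close>, the factor
        \<open>q\<close> may be replaced by the smaller \<open>p s = 2 * c\<close>, which is the one
        Stroock-Varopoulos speaks of.\<close>
      then have "I \<le> 0" using c by (simp add: mult_le_0_iff)
      then have "q * I \<le> p s * I" using q by (intro mult_right_mono_neg) auto
      also have "\<dots> = - 2 * (c * (- I))" by (simp add: c_def)
      also have "\<dots> \<le> - 2 * (h * (X - e / 8))"
        by (rule mult_left_mono_neg[OF I(1)]) simp
      finally show ?thesis by (simp add: I_def)
    qed
    have "(LINT x|M. v x powr q) - N \<le> P * (P * K powr P) * (h * L)\<^sup>2
      + P * (C * (q - p s)) * (S1 * (h * L)) + - 2 * h * (X - e / 8)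
      + (q - p s) * ent + C\<^sup>2 * (q - p s)\<^sup>2 * S0"
      by (rule order_trans[OF 1], intro add_mono mult_left_mono 2 3 4 order_refl)
        (use P0 q in auto)
    also have "\<dots> = h * R h"
      unfolding R_def q_def[symmetric] using h(1)
      by (simp add: field_simps power2_eq_square)
    also have "\<dots> \<le> h * (p' * (2 * \<beta> (p s / p') / p s + ln N / p s) * N + e)"
      using elim(4) h by (intro mult_left_mono) auto
    finally show ?case by (simp add: power_integral_def v_def q_def)
  qed
qed

text \<open>The logarithm of the L^p norm of \<open>evolve K f s\<close> for
  \<open>p = p s\<close>.\<close>

definition log_norm :: "real \<Rightarrow> ('a \<Rightarrow> real) \<Rightarrow> (real \<Rightarrow> real) \<Rightarrow> real \<Rightarrow> real" where
  "log_norm K f p s = ln (power_integral K f (p s) s) / p s"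

text \<open>The one-sided bound survives the logarithm because
  \<open>ln J \<le> ln N + (J / N - 1)\<close>. The resulting majorant
  \<open>(ln N + h * Y) / p (s + h)\<close> is differentiable at \<open>h = 0\<close>; in its
  derivative the terms with \<open>ln N\<close> cancel, and the strict inequality comes from
  \<open>e / p s < e\<close>.\<close>

lemma log_norm_Dini:
  assumes f: "bounded_L1 M K f" and K: "1 \<le> K" and s: "0 < s"
    and p: "(p has_real_derivative p') (at s)" and p': "0 < p'" and p2: "2 \<le> p s"
    and pos: "0 < power_integral K f (p s) s"
    and pos': "\<forall>\<^sub>F h in at_right 0. 0 < power_integral K f (p (s + h)) (s + h) \<and> 0 < p (s + h)"
    and e: "0 < e"
  shows "\<forall>\<^sub>F h in at_right 0.
    log_norm K f p (s + h) \<le> log_norm K f p s + h * (2 * \<beta> (p s / p') * p' / (p s)\<^sup>2 + e)"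
proof -
  define N where "N = power_integral K f (p s) s"
  define Y where "Y = p' * (2 * \<beta> (p s / p') / p s + ln N / p s) + e"
  have N: "0 < N" using pos by (simp add: N_def)
  have ev1: "\<forall>\<^sub>F h in at_right 0. power_integral K f (p (s + h)) (s + h)
    \<le> N + h * (p' * (2 * \<beta> (p s / p') / p s + ln N / p s) * N + e * N)"
    by (rule power_integral_Dini[OF f K s p p' p2 N_def N]) (use e N in simp)
  have d1: "((\<lambda>h. ln N + h * Y) has_real_derivative Y) (at 0)"
    by (auto intro!: derivative_eq_intros)
  have d2: "((\<lambda>h. p (s + h)) has_real_derivative p') (at 0)"
    using p DERIV_shift[of p p' 0 s] by (simp add: add.commute)
  have "((\<lambda>h. (ln N + h * Y) / p (s + h)) has_real_derivative
      (Y * p s - ln N * p') / (p s * p s)) (at 0)"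
    using DERIV_divide[OF d1 d2] p2 by simp
  then have "((\<lambda>h. ((ln N + h * Y) / p (s + h) - ln N / p s) / h) \<longlongrightarrow>
      (Y * p s - ln N * p') / (p s * p s)) (at_right 0)"
    by (simp add: DERIV_def tendsto_within_subset[of _ _ 0 UNIV])
  moreover have "(Y * p s - ln N * p') / (p s * p s) < 2 * \<beta> (p s / p') * p' / (p s)\<^sup>2 + e"
  proof -
    have "(Y * p s - ln N * p') / (p s * p s) = 2 * \<beta> (p s / p') * p' / (p s)\<^sup>2 + e / p s"
      using p2 by (simp add: Y_def field_simps power2_eq_square)
    also have "e / p s < e" using p2 e by (simp add: field_simps)
    finally show ?thesis by simp
  qed
  ultimately have ev2: "\<forall>\<^sub>F h in at_right 0. ((ln N + h * Y) / p (s + h) - ln N / p s) / h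
      < 2 * \<beta> (p s / p') * p' / (p s)\<^sup>2 + e"
    by (rule order_tendstoD(2))
  show ?thesis
    using ev1 ev2 pos' eventually_at_right_less[of "0::real"]
  proof eventually_elim
    case (elim h)
    define J where "J = power_integral K f (p (s + h)) (s + h)"
    have J: "0 < J" "J \<le> N + h * (Y * N)" using elim by (auto simp: J_def Y_def algebra_simps)
    have "ln J = ln N + ln (J / N)" using J N by (simp add: ln_div)
    also have "ln (J / N) \<le> J / N - 1" using J N by (intro ln_le_minus_one) auto
    also have "J / N - 1 \<le> h * Y" using J N by (simp add: field_simps)
    finally have "log_norm K f p (s + h) \<le> (ln N + h * Y) / p (s + h)"
      using elim by (auto simp: log_norm_def J_def intro!: divide_right_mono)
    also have "\<dots> = log_norm K f p s + h * (((ln N + h * Y) / p (s + h) - ln N / p s) / h)"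
      using elim by (simp add: log_norm_def N_def)
    also have "\<dots> \<le> log_norm K f p s + h * (2 * \<beta> (p s / p') * p' / (p s)\<^sup>2 + e)"
      using elim by (intro add_left_mono mult_left_mono) auto
    finally show ?case .
  qed
qed

end

section \<open>Ultracontractivity\<close>

context symmetric_markov_semigroup
begin

lemma T_AE_zero:
  assumes t: "0 \<le> t" and f: "f \<in> Lp_space M 2" and z: "AE x in M. f x = 0"
  shows "AE x in M. T t f x = 0"
proof -
  have z2: "(\<lambda>x. 0) \<in> Lp_space M 2" by (simp add: Lp_space_2_iff)
  have "AE x in M. T t f x = T t (\<lambda>x. 0) x" by (rule respects_AE[OF t f z2 z])
  moreover have "AE x in M. T t (\<lambda>x. 0) x = 0" using linear[OF t z2 z2, of 0 0] by simp
  ultimately show ?thesis by eventually_elim simp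
qed

text \<open>This settles the degenerate case, where the logarithm of the norm carries no
  information: an orbit that vanishes at time \<open>s\<close> remains zero.\<close>

lemma power_integral_eq_0_AE:
  assumes f: "bounded_L1 M K f" and K: "1 \<le> K" and s: "0 \<le> s" "s \<le> t" and p: "1 \<le> p"
    and 0: "power_integral K f p s = 0"
  shows "AE x in M. T t f x = 0"
proof -
  define u where "u = evolve K f s"
  have u: "bounded_L1 M K u" unfolding u_def by (rule evolve_L1[OF f K s(1)])
  have "AE x in M. u x powr p = 0"
    using 0 integral_nonneg_eq_0_iff_AE[OF bounded_L1_powr_integrable[OF u K p]]
    by (simp add: power_integral_def u_def)
  then have "AE x in M. u x = 0" by eventually_elim simp
  then have "AE x in M. T (t - s) u x = 0"
    using s by (intro T_AE_zero bounded_L1_L2[OF u K]) auto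
  moreover have "AE x in M. T (t - s) u x = evolve K f t x"
    using evolve_add_AE[OF f K s(1), of "t - s"] s by (simp add: u_def)
  moreover have "AE x in M. evolve K f t x = T t f x"
    by (rule evolve_AE[OF f K]) (use s in simp)
  ultimately show ?thesis by eventually_elim simp
qed

end

text \<open>For \<open>B < b < l\<close>, Chebyshev's inequality bounds \<open>l^p\<close> times the
  measure of the set where \<open>u > l\<close> by \<open>b^p\<close>, for arbitrarily large
  \<open>p\<close>; as \<open>(l / b)^p\<close> is unbounded, that set is null.\<close>

lemma AE_le_of_power_integral_bounds:
  assumes u: "bounded_L1 M K u" and K: "1 \<le> K" and B: "0 < B"
    and bound: "\<And>b. B < b \<Longrightarrow> \<exists>\<^sub>F p in at_top. (LINT x|M. u x powr p) \<le> b powr p"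
  shows "AE x in M. u x \<le> B"
proof -
  note uD = bounded_L1D[OF u]
  have *: "AE x in M. u x \<le> l" if l: "B < l" for l
  proof -
    define b where "b = (B + l) / 2"
    have b: "B < b" "b < l" "0 < b" using l B by (auto simp: b_def)
    define A where "A = {x \<in> space M. l < u x}"
    have A[measurable]: "A \<in> sets M" using uD(2) unfolding A_def by measurable
    \<comment> \<open>\<open>measure\<close> returns 0 on sets of infinite \<open>emeasure\<close>,
      so finiteness is what allows \<open>measure M A = 0\<close> to be read as nullity.\<close>
    have fin: "emeasure M A < \<infinity>"
    proof -
      have "integrable M (\<lambda>x. indicator A x :: real)"
        by (rule Bochner_Integration.integrable_bound[of M "\<lambda>x. u x / l"])
          (use uD(1,3) b B l in \<open>auto simp: A_def indicator_def\<close>)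
      then show ?thesis by (simp add: integrable_indicator_iff A)
    qed
    have le: "l powr p * measure M A \<le> (LINT x|M. u x powr p)" if "1 \<le> p" for p
    proof -
      have i: "integrable M (\<lambda>x. u x powr p)" by (rule bounded_L1_powr_integrable[OF u K that])
      have "l powr p * measure M A = (LINT x|M. l powr p * indicator A x)"
        using A sets.sets_into_space[OF A] by (simp add: Int_absorb2)
      also have "\<dots> \<le> (LINT x|M. u x powr p)"
      proof (rule integral_mono[OF _ i])
        show "integrable M (\<lambda>x. l powr p * indicator A x :: real)"
          using fin A by (intro integrable_mult_right integrable_real_indicator) auto
        show "l powr p * indicator A x \<le> u x powr p" for x
          using l B that by (auto simp: A_def indicator_def intro!: powr_mono2)
      qed
      finally show ?thesis .
    qed
    have "measure M A = 0"
    proof (rule ccontr)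
      assume "measure M A \<noteq> 0"
      then have m: "0 < measure M A" using measure_nonneg[of M A] by linarith
      have "filterlim (\<lambda>p. (l / b) powr p) at_top at_top"
        using b by real_asymp
      then have "\<forall>\<^sub>F p in at_top. 1 / measure M A < (l / b) powr p"
        by (simp add: filterlim_at_top_dense)
      moreover have "\<forall>\<^sub>F p::real in at_top. 1 \<le> p" by (rule eventually_ge_at_top)
      ultimately have "\<forall>\<^sub>F p in at_top. \<not> (LINT x|M. u x powr p) \<le> b powr p"
      proof eventually_elim
        case (elim p)
        have "b powr p < l powr p * measure M A"
          using elim(1) m b B by (simp add: powr_divide field_simps)
        then show ?case using le[OF elim(2)] by linarith
      qed
      then show False using bound[OF b(1)] by (simp add: frequently_def)
    qed
    then have "emeasure M A = 0" using fin by (auto simp: measure_def enn2real_eq_0_iff)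
    then have "AE x in M. \<not> l < u x"
      using A by (intro AE_I[of _ _ A]) (auto simp: A_def)
    then show ?thesis by (simp add: not_less)
  qed
  have "AE x in M. \<forall>n. u x \<le> B + inverse (real (Suc n))"
    unfolding AE_all_countable by (intro allI *) simp
  then show ?thesis
  proof eventually_elim
    case (elim x)
    have "(\<lambda>n. B + inverse (real (Suc n))) \<longlonglongrightarrow> B"
      by (rule LIMSEQ_inverse_real_of_nat_add)
    then show ?case by (rule LIMSEQ_le_const) (use elim in auto)
  qed
qed

context log_sobolev_semigroup
begin

lemma ultracontractive_bounded_L1:
  assumes f: "bounded_L1 M K f" and K: "1 \<le> K" and \<beta>: "continuous_on {0<..} \<beta>"
    and \<eta>: "-1 < \<eta>" and t: "0 < t" and fin: "M_fun_finite \<beta> \<eta> t"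
  shows "AE x in M. T t f x \<le> exp (M_fun \<beta> \<eta> t) * Lp_norm M 2 f"
proof (cases "\<exists>r p. 0 \<le> r \<and> r < t \<and> 1 \<le> p \<and> power_integral K f p r = 0")
  case True
  then obtain r p where rp: "0 \<le> r" "r < t" "1 \<le> p" "power_integral K f p r = 0" by blast
  have "AE x in M. T t f x = 0"
    by (rule power_integral_eq_0_AE[OF f K rp(1) _ rp(3,4)]) (use rp in simp)
  then show ?thesis by eventually_elim (simp add: Lp_norm_2_nonneg)
next
  case False
  then have pos: "0 < power_integral K f p r" if "0 \<le> r" "r < t" "1 \<le> p" for p r
    using that power_integral_nonneg[of K f p r] by (metis less_eq_real_def)
  define a where "a = \<eta> + 1"
  have a: "0 < a" using \<eta> by (simp add: a_def)
  define p where "p s = 2 * (t / (t - s)) powr a" for s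
  define p' where "p' s = a * p s / (t - s)" for s
  have p2: "2 \<le> p s" if "0 \<le> s" "s < t" for s
    using that a t by (auto simp: p_def intro!: ge_one_powr_ge_zero)
  have pder: "(p has_real_derivative p' s) (at s)" if "s < t" for s
  proof -
    have "t / (t - s) > 0" using that t by simp
    then have "(p has_real_derivative 2 * (a * (t / (t - s)) powr (a - 1) * (t / (t - s)\<^sup>2))) (at s)"
      unfolding p_def[abs_def] using that t
      by (auto intro!: derivative_eq_intros simp: power2_eq_square)
    moreover have "2 * (a * (t / (t - s)) powr (a - 1) * (t / (t - s)\<^sup>2)) = p' s"
    proof -
      define q where "q = t / (t - s)"
      have "q powr (a - 1) * q = q powr a"
        using that t powr_add[of q "a - 1" 1] by (simp add: q_def)
      moreover have "t / (t - s)\<^sup>2 = q / (t - s)" by (simp add: q_def power2_eq_square)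
      ultimately show ?thesis by (simp add: p'_def p_def q_def[symmetric] mult_ac)
    qed
    ultimately show ?thesis by simp
  qed
  have p'pos: "0 < p' s" if "0 \<le> s" "s < t" for s
    using that a p2[OF that] by (simp add: p'_def)
  have pcont: "continuous_on {..<t} p"
    by (intro continuous_at_imp_continuous_on ballI DERIV_isCont[OF pder]) auto
  define k where "k x = x powr \<eta> * \<beta> (x / a)" for x
  \<comment> \<open>The gauge integral, for which indefinite integrals are continuous and
    differentiable where \<open>k\<close> is continuous. It agrees with the Lebesgue integral in
    \<open>M_fun\<close>, and the endpoints 0 and \<open>t\<close> do not affect it.\<close>
  define H where "H r = integral {0..r} k" for r
  have ki: "set_integrable lborel {0<..<t} k"
    using fin by (simp add: M_fun_finite_def k_def[abs_def] a_def)
  have kint: "k integrable_on {0..t}"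
    using set_borel_integral_eq_integral(1)[OF ki] integrable_on_open_interval[of k 0 t]
    by (simp add: box_real)
  have Hcont: "continuous_on {0..t} H"
    unfolding H_def by (rule indefinite_integral_continuous_1[OF kint])
  have Ht: "H t = (LBINT s:{0<..<t}. k s)"
    using set_borel_integral_eq_integral(2)[OF ki] integral_open_interval[of 0 t k]
    by (simp add: H_def box_real)
  have Hder: "(H has_real_derivative k r) (at r)" if r: "0 < r" "r < t" for r
  proof -
    have "continuous_on {0<..} k"
      unfolding k_def using a
      by (intro continuous_on_mult continuous_on_powr' continuous_on_id continuous_on_const
          continuous_on_compose2[OF \<beta>] continuous_on_divide) auto
    then have "isCont k r" using r by (simp add: continuous_on_eq_continuous_at)
    then have "(H has_vector_derivative k r) (at r within {0..t})"
      unfolding H_def using integral_has_vector_derivative_continuous_at[OF kint, of r "{}"] r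
      by (simp add: continuous_at_imp_continuous_at_within)
    then show ?thesis
      using r by (simp add: at_within_Icc_at has_real_derivative_iff_has_vector_derivative)
  qed
  \<comment> \<open>An antiderivative of the rate \<open>2 * \<beta> (p / p') * p' / p^2\<close>.
    The argument \<open>t - s\<close> takes the place of a substitution in the integral, and the
    factor \<open>a * t powr (- a)\<close> comes from
    \<open>p s = 2 * t powr a / (t - s) powr a\<close>.\<close>
  define W where "W s = - (a * t powr (- a)) * H (t - s)" for s
  have Wcont: "continuous_on {0..t} W"
    unfolding W_def using Hcont
    by (intro continuous_on_mult continuous_on_const continuous_on_compose2[OF Hcont] continuous_on_diff continuous_on_id) auto
  have Wder: "(W has_real_derivative 2 * \<beta> (p s / p' s) * p' s / (p s)\<^sup>2) (at s)"
    if s: "0 < s" "s < t" for s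
  proof -
    have "((\<lambda>s. H (t - s)) has_real_derivative k (t - s) * (- 1)) (at s)"
      using s by (intro DERIV_chain2[OF Hder]) (auto intro!: derivative_eq_intros)
    then have "(W has_real_derivative - (a * t powr (- a)) * (k (t - s) * (- 1))) (at s)"
      unfolding W_def[abs_def] by (rule DERIV_cmult)
    moreover have "- (a * t powr (- a)) * (k (t - s) * (- 1)) = 2 * \<beta> (p s / p' s) * p' s / (p s)\<^sup>2"
    proof -
      have ps: "p s = 2 * t powr a / (t - s) powr a"
        using s t by (simp add: p_def powr_divide)
      have ratio: "p s / p' s = (t - s) / a"
        using s p2[of s] a by (simp add: p'_def)
      have eta: "(t - s) powr \<eta> = (t - s) powr a / (t - s)"
        using s by (simp add: a_def powr_add)
      have "2 * \<beta> (p s / p' s) * p' s / (p s)\<^sup>2 = 2 * \<beta> ((t - s) / a) * (a / ((t - s) * p s))"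
        unfolding ratio using p2[of s] s by (simp add: p'_def power2_eq_square)
      also have "\<dots> = a * t powr (- a) * ((t - s) powr \<eta> * \<beta> ((t - s) / a))"
        unfolding ps eta using s t by (simp add: powr_minus field_simps)
      finally show ?thesis by (simp add: k_def)
    qed
    ultimately show ?thesis by simp
  qed
  have Wt: "W t - W 0 = M_fun \<beta> \<eta> t"
  proof -
    have "H 0 = 0" by (simp add: H_def)
    then show ?thesis by (simp add: W_def Ht M_fun_def k_def a_def)
  qed
  define \<Phi> where "\<Phi> = log_norm K f p"
  \<comment> \<open>The comparison stops at \<open>b < t\<close>, since the exponents are unbounded
    near \<open>t\<close> and the estimates are uniform only for bounded exponents.\<close>
  have \<Phi>_le: "\<Phi> b - W b \<le> \<Phi> 0 - W 0" if b: "0 < b" "b < t" for b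
  proof (rule Dini_nonincreasing_interior[OF b(1), of "\<lambda>s. \<Phi> s - W s"])
    have pb: "p r \<le> p b" if "0 \<le> r" "r \<le> b" for r
      using that b t a unfolding p_def
      by (intro mult_left_mono powr_mono2 divide_left_mono) auto
    have cp: "continuous_on {0..b} p" by (rule continuous_on_subset[OF pcont]) (use b in auto)
    have pr: "2 \<le> p r \<and> p r \<le> p b" if "0 \<le> r" "r \<le> b" for r
      using pb[OF that] p2[of r] that b by simp
    have cJ: "continuous_on {0..b} (\<lambda>r. power_integral K f (p r) r)"
      by (rule continuous_on_power_integral[OF f K cp pr])
    have ne: "power_integral K f (p r) r \<noteq> 0" "p r \<noteq> 0" if "r \<in> {0..b}" for r
      using pos[of r "p r"] pr[of r] that b by auto
    have "continuous_on {0..b} \<Phi>"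
      unfolding \<Phi>_def log_norm_def
      by (intro continuous_on_divide continuous_on_ln cJ cp ballI ne)
    then show "continuous_on {0..b} (\<lambda>s. \<Phi> s - W s)"
      by (intro continuous_on_diff continuous_on_subset[OF Wcont]) (use b in auto)
    fix s e :: real assume s: "0 < s" "s < b" and e: "0 < e"
    define m where "m = 2 * \<beta> (p s / p' s) * p' s / (p s)\<^sup>2"
    have s': "0 \<le> s" "s < t" using s b by auto
    have "\<forall>\<^sub>F h in at_right 0. \<Phi> (s + h) \<le> \<Phi> s + h * (m + e / 2)"
      unfolding \<Phi>_def m_def
    proof (rule log_norm_Dini[OF f K s(1) pder[OF s'(2)] p'pos[OF s'] p2[OF s']])
      show "0 < power_integral K f (p s) s" using pos[OF s', of "p s"] p2[OF s'] by simp
      show "\<forall>\<^sub>F h in at_right 0. 0 < power_integral K f (p (s + h)) (s + h) \<and> 0 < p (s + h)"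
        unfolding eventually_at_right_field
      proof (intro exI[of _ "t - s"] conjI allI impI)
        fix h assume h: "0 < h" "h < t - s"
        then have sh: "0 \<le> s + h" "s + h < t" using s by auto
        show "0 < power_integral K f (p (s + h)) (s + h)" "0 < p (s + h)"
          using p2[OF sh] pos[OF sh, of "p (s + h)"] by auto
      qed (use s' in simp)
    qed (use e in simp)
    moreover have "\<forall>\<^sub>F h in at_right 0. m - e / 2 < (W (s + h) - W s) / h"
    proof (rule order_tendstoD(1))
      show "((\<lambda>h. (W (s + h) - W s) / h) \<longlongrightarrow> m) (at_right 0)"
        using Wder[OF s(1) s'(2)] by (simp add: m_def DERIV_def tendsto_within_subset[of _ _ 0 UNIV])
    qed (use e in simp)
    ultimately show "\<forall>\<^sub>F h in at_right 0. \<Phi> (s + h) - W (s + h) \<le> \<Phi> s - W s + e * h"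
      using eventually_at_right_less[of "0::real"]
    proof eventually_elim
      case (elim h)
      have "h * (m - e / 2) \<le> W (s + h) - W s" using elim(2,3) by (simp add: field_simps)
      then show ?case using elim(1) by (simp add: algebra_simps)
    qed
  qed
  have f2: "f \<in> Lp_space M 2" by (rule bounded_L1_L2[OF f K])
  have p0: "p 0 = 2" using t by (simp add: p_def)
  have \<Phi>0: "\<Phi> 0 = ln (Lp_norm M 2 f)" and fpos: "0 < Lp_norm M 2 f"
  proof -
    have "power_integral K f 2 0 = (LINT x|M. evolve K f 0 x powr 2)" by (simp add: power_integral_def)
    also have "\<dots> = L2_inner M f f"
      unfolding L2_inner_def
    proof (rule integral_cong_AE)
      have [measurable]: "evolve K f 0 \<in> borel_measurable M" by (rule evolve_measurable[OF f K order_refl])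
      show "(\<lambda>x. evolve K f 0 x powr 2) \<in> borel_measurable M" by measurable
      show "(\<lambda>x. f x * f x) \<in> borel_measurable M" using L2_measurable[OF f2] by simp
      show "AE x in M. evolve K f 0 x powr 2 = f x * f x"
        using evolve_0[OF f K]
      proof eventually_elim
        case (elim x)
        then show ?case using bounded_L1D(3)[OF f, of x]
          by (cases "f x = 0") (auto simp: power2_eq_square)
      qed
    qed
    finally have "power_integral K f 2 0 = (Lp_norm M 2 f)\<^sup>2" by (simp add: Lp_norm_2_sq)
    moreover have "0 < power_integral K f 2 0" by (rule pos) (use t in auto)
    ultimately show fpos: "0 < Lp_norm M 2 f"
      using Lp_norm_2_nonneg[of M f] by (metis less_eq_real_def power_zero_numeral less_irrefl)
    show "\<Phi> 0 = ln (Lp_norm M 2 f)"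
      unfolding \<Phi>_def log_norm_def p0 using fpos \<open>power_integral K f 2 0 = (Lp_norm M 2 f)\<^sup>2\<close>
      by (simp add: ln_realpow)
  qed
  have t0: "0 \<le> t" using t by simp
  have "AE x in M. evolve K f t x \<le> exp (M_fun \<beta> \<eta> t) * Lp_norm M 2 f"
  proof (rule AE_le_of_power_integral_bounds[OF evolve_L1(1)[OF f K t0] K])
    show "0 < exp (M_fun \<beta> \<eta> t) * Lp_norm M 2 f" using fpos by simp
    fix b assume b: "exp (M_fun \<beta> \<eta> t) * Lp_norm M 2 f < b"
    then have bpos: "0 < b" using fpos by (smt (verit) exp_gt_zero mult_pos_pos)
    have "W t - W 0 + \<Phi> 0 < ln b"
    proof -
      have "W t - W 0 + \<Phi> 0 = ln (exp (M_fun \<beta> \<eta> t) * Lp_norm M 2 f)"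
        using fpos by (simp add: Wt \<Phi>0 ln_mult)
      also have "\<dots> < ln b" using b bpos fpos by simp
      finally show ?thesis .
    qed
    moreover have "((\<lambda>s. W s - W 0 + \<Phi> 0) \<longlongrightarrow> W t - W 0 + \<Phi> 0) (at_left t)"
    proof -
      have "(W \<longlongrightarrow> W t) (at t within {0..t})" using Wcont t by (auto simp: continuous_on_def)
      then have "(W \<longlongrightarrow> W t) (at_left t)" using at_within_Icc_at_left[OF t] by simp
      then show ?thesis by (intro tendsto_intros)
    qed
    ultimately have ev1: "\<forall>\<^sub>F s in at_left t. W s - W 0 + \<Phi> 0 < ln b"
      by (intro order_tendstoD(2))
    have ev2: "\<forall>\<^sub>F s in at_left t. s \<in> {0<..<t}" by (rule eventually_at_left_real[OF t])
    have plim: "filterlim p at_top (at_left t)"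
      unfolding p_def using a t by real_asymp
    have "\<forall>\<^sub>F s in at_left t. (LINT x|M. evolve K f t x powr p s) \<le> b powr p s"
      using ev1 ev2
    proof eventually_elim
      case (elim s)
      then have s: "0 < s" "0 \<le> s" "s < t" "s \<le> t" by auto
      have ps: "2 \<le> p s" by (rule p2[OF s(2,3)])
      have "(LINT x|M. evolve K f t x powr p s) \<le> power_integral K f (p s) s"
        using power_integral_antimono[OF f K s(2,4), of "p s"] ps by (simp add: power_integral_def)
      also have "\<dots> = exp (p s * \<Phi> s)"
        using pos[OF s(2,3), of "p s"] ps by (simp add: \<Phi>_def log_norm_def)
      also have "\<dots> \<le> exp (p s * ln b)"
        using \<Phi>_le[OF s(1,3)] elim(1) ps by simp
      also have "\<dots> = b powr p s" using bpos by (simp add: powr_def)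
      finally show ?case .
    qed
    then have "\<exists>\<^sub>F s in at_left t. (LINT x|M. evolve K f t x powr p s) \<le> b powr p s"
      by (intro eventually_frequently) auto
    then show "\<exists>\<^sub>F q in at_top. (LINT x|M. evolve K f t x powr q) \<le> b powr q"
      using plim unfolding frequently_def filterlim_iff by blast
  qed
  with evolve_AE[OF f K t0] show ?thesis by eventually_elim simp
qed

text \<open>Positivity reduces \<open>f\<close> to \<open>F = |f|\<close>, approximated from below
  by bounded integrable \<open>g n\<close>. No pointwise limit of \<open>T t (g n)\<close> is taken:
  the excess \<open>D\<close> of \<open>T t F\<close> over \<open>B\<close> has L^2 norm at most
  that of \<open>F - g n\<close> for every \<open>n\<close>, and this tends to 0.\<close>

lemma ultracontractive:
  assumes f: "f \<in> Lp_space M 2" and \<beta>: "continuous_on {0<..} \<beta>"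
    and \<eta>: "-1 < \<eta>" and t: "0 < t" and fin: "M_fun_finite \<beta> \<eta> t"
  shows "AE x in M. \<bar>T t f x\<bar> \<le> exp (M_fun \<beta> \<eta> t) * Lp_norm M 2 f"
proof -
  define B where "B = exp (M_fun \<beta> \<eta> t) * Lp_norm M 2 f"
  have t0: "0 \<le> t" using t by simp
  note fm[measurable] = L2_measurable[OF f]
  define F where "F x = \<bar>f x\<bar>" for x
  have Fm[measurable]: "F \<in> borel_measurable M" unfolding F_def by measurable
  have F2: "F \<in> Lp_space M 2" by (rule L2_bound[OF f Fm]) (simp add: F_def)
  have Fn: "Lp_norm M 2 F = Lp_norm M 2 f" by (simp add: F_def Lp_norm_2 L2_inner_def)
  \<comment> \<open>The upper cut gives boundedness; the lower cut gives integrability, because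
    \<open>F \<le> (n + 1) * F^2\<close> wherever \<open>F \<ge> 1 / (n + 1)\<close>.\<close>
  define g where "g n x = (if inverse (real (Suc n)) \<le> F x then min (F x) (real (Suc n)) else 0)" for n x
  have gm[measurable]: "g n \<in> borel_measurable M" for n unfolding g_def by measurable
  have g0: "0 \<le> g n x" "g n x \<le> F x" "g n x \<le> real (Suc n)" for n x
    by (auto simp: g_def F_def)
  have g: "bounded_L1 M (real (Suc n)) (g n)" for n
    unfolding bounded_L1_def
  proof (intro conjI allI)
    show "integrable M (g n)"
    proof (rule Bochner_Integration.integrable_bound)
      show "integrable M (\<lambda>x. real (Suc n) * (F x)\<^sup>2)" using F2 by (simp add: Lp_space_2_iff)
      have "g n x \<le> real (Suc n) * (F x)\<^sup>2" for x
      proof (cases "inverse (real (Suc n)) \<le> F x")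
        case True
        then have "1 \<le> real (Suc n) * F x" by (simp add: field_simps)
        then have "F x \<le> (real (Suc n) * F x) * F x"
          using mult_right_mono[of 1 "real (Suc n) * F x" "F x"] by (simp add: F_def)
        then show ?thesis using g0(2)[of n x] by (simp add: power2_eq_square mult.assoc)
      qed (simp add: g_def)
      then show "AE x in M. norm (g n x) \<le> norm (real (Suc n) * (F x)\<^sup>2)"
        using g0 by (intro AE_I2) simp
    qed simp
  qed (use g0 in auto)
  have K: "1 \<le> real (Suc n)" for n by simp
  have g2: "g n \<in> Lp_space M 2" for n by (rule bounded_L1_L2[OF g K])
  have Tg: "AE x in M. T t (g n) x \<le> B" for n
  proof -
    have "Lp_norm M 2 (g n) \<le> Lp_norm M 2 F"
      unfolding Lp_norm_2 L2_inner_def real_sqrt_le_iff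
      using g0 by (intro integral_mono L2_integrable_mult g2 F2 mult_mono) (auto simp: F_def)
    then have "exp (M_fun \<beta> \<eta> t) * Lp_norm M 2 (g n) \<le> B"
      by (simp add: B_def Fn)
    then show ?thesis
      using ultracontractive_bounded_L1[OF g K \<beta> \<eta> t fin, of n]
      by (auto elim!: eventually_mono)
  qed
  have TF2: "T t F \<in> Lp_space M 2" by (rule maps_L2[OF t0 F2])
  define D where "D x = max 0 (T t F x - B)" for x
  have [measurable]: "T t F \<in> borel_measurable M" by (rule L2_measurable[OF TF2])
  have Dm: "D \<in> borel_measurable M" unfolding D_def by measurable
  have D2: "D \<in> Lp_space M 2"
  proof (rule L2_bound[OF TF2 Dm], intro AE_I2)
    have "0 \<le> B" by (simp add: B_def Lp_norm_2_nonneg)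
    then show "\<bar>D x\<bar> \<le> \<bar>T t F x\<bar>" for x by (auto simp: D_def)
  qed
  have Dle: "L2_inner M D D \<le> (LINT x|M. (F x - g n x)\<^sup>2)" for n
  proof -
    have d2: "(\<lambda>x. T t F x - T t (g n) x) \<in> Lp_space M 2" by (intro L2_diff maps_L2 t0 F2 g2)
    have "L2_inner M D D = (LINT x|M. (D x)\<^sup>2)" by (simp add: L2_inner_def power2_eq_square)
    also have "\<dots> \<le> (LINT x|M. (T t F x - T t (g n) x)\<^sup>2)"
    proof (rule integral_mono_AE)
      show "integrable M (\<lambda>x. (D x)\<^sup>2)" "integrable M (\<lambda>x. (T t F x - T t (g n) x)\<^sup>2)"
        using D2 d2 by (simp_all add: Lp_space_2_iff)
      \<comment> \<open>As \<open>T t (g n) \<le> B\<close>, the excess over \<open>B\<close> is no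
        larger than the excess over \<open>T t (g n)\<close>.\<close>
      show "AE x in M. (D x)\<^sup>2 \<le> (T t F x - T t (g n) x)\<^sup>2"
        using Tg[of n]
      proof eventually_elim
        case (elim x)
        then have "\<bar>D x\<bar> \<le> \<bar>T t F x - T t (g n) x\<bar>" by (auto simp: D_def)
        then show ?case by (simp only: abs_le_square_iff)
      qed
    qed
    also have "\<dots> = (Lp_norm M 2 (\<lambda>x. T t F x - T t (g n) x))\<^sup>2"
      unfolding Lp_norm_2_sq L2_inner_def by (simp add: power2_eq_square)
    also have "\<dots> \<le> (Lp_norm M 2 (\<lambda>x. F x - g n x))\<^sup>2"
      by (intro power_mono T_norm_diff_le t0 F2 g2 Lp_norm_2_nonneg)
    also have "\<dots> = (LINT x|M. (F x - g n x)\<^sup>2)"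
      unfolding Lp_norm_2_sq L2_inner_def by (simp add: power2_eq_square)
    finally show ?thesis .
  qed
  have "(\<lambda>n. LINT x|M. (F x - g n x)\<^sup>2) \<longlonglongrightarrow> (LINT x|M. 0)"
  proof (rule integral_dominated_convergence)
    show "integrable M (\<lambda>x. (F x)\<^sup>2)" using F2 by (simp add: Lp_space_2_iff)
    show "AE x in M. norm ((F x - g n x)\<^sup>2) \<le> (F x)\<^sup>2" for n
      using g0 by (intro AE_I2) (auto intro!: power_mono)
    show "AE x in M. (\<lambda>n. (F x - g n x)\<^sup>2) \<longlonglongrightarrow> 0"
    proof (intro AE_I2 tendsto_eventually)
      fix x
      show "\<forall>\<^sub>F n in sequentially. (F x - g n x)\<^sup>2 = 0"
      proof (cases "F x = 0")
        case False
        then have "0 < F x" by (simp add: F_def)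
        then have "\<forall>\<^sub>F n in sequentially. inverse (real (Suc n)) < F x"
          by (intro order_tendstoD(2)[OF LIMSEQ_inverse_real_of_nat])
        moreover have "\<forall>\<^sub>F n in sequentially. F x \<le> real n"
          by (rule filterlim_at_top[THEN iffD1, OF filterlim_real_sequentially, rule_format])
        ultimately show ?thesis by eventually_elim (simp add: g_def min_def)
      qed (simp add: g_def)
    qed
  qed simp_all
  then have "(\<lambda>n. LINT x|M. (F x - g n x)\<^sup>2) \<longlonglongrightarrow> 0" by simp
  then have "L2_inner M D D \<le> 0"
    by (rule LIMSEQ_le_const) (use Dle in auto)
  then have "AE x in M. D x = 0"
    using L2_inner_self_nonneg[of M D] by (intro L2_AE_zero[OF D2]) simp
  then have TF: "AE x in M. T t F x \<le> B" by eventually_elim (simp add: D_def max_def split: if_splits)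
  \<comment> \<open>Both \<open>F + f\<close> and \<open>F - f\<close> are nonnegative, so
    positivity yields \<open>|T t f| \<le> T t F\<close>.\<close>
  have "AE x in M. 0 \<le> T t (\<lambda>y. 1 * F y + 1 * f y) x" "AE x in M. 0 \<le> T t (\<lambda>y. 1 * F y + (- 1) * f y) x"
    by (intro positivity_preserving t0 L2_lin F2 f; simp add: F_def; linarith)+
  moreover have "AE x in M. T t (\<lambda>y. 1 * F y + 1 * f y) x = 1 * T t F x + 1 * T t f x"
    "AE x in M. T t (\<lambda>y. 1 * F y + (- 1) * f y) x = 1 * T t F x + (- 1) * T t f x"
    by (rule linear[OF t0 F2 f])+
  ultimately show ?thesis using TF
    unfolding B_def[symmetric] by eventually_elim linarith
qed

end

theorem theorem3p4:
  fixes M :: "'a measure"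
    and T :: "real \<Rightarrow> ('a \<Rightarrow> real) \<Rightarrow> ('a \<Rightarrow> real)"
    and A sqrtA :: "'a L2_graph"
    and \<beta> :: "real \<Rightarrow> real"
  assumes "sigma_finite_measure M"
    and "symmetric_markov_semigroup M T"
    and "A = semigroup_generator M T"
    and "is_sqrt_operator M A sqrtA"
    and "continuous_on {0<..} \<beta>"
    and "\<And>\<epsilon> f. \<lbrakk>0 < \<epsilon>; f \<in> Quad sqrtA \<inter> Lp_space M 1 \<inter> Linf_space M; AE x in M. 0 \<le> f x\<rbrakk> \<Longrightarrow>
      (LINT x|M. (f x)\<^sup>2 * ln (f x)) \<le>
        \<epsilon> * Q_form M sqrtA f + \<beta> \<epsilon> * (Lp_norm M 2 f)\<^sup>2
        + (Lp_norm M 2 f)\<^sup>2 * ln (Lp_norm M 2 f)"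
  shows "\<forall>\<eta> > -1. (\<forall>t > 0. M_fun_finite \<beta> \<eta> t) \<longrightarrow>
    (\<forall>t > 0. opnorm_2_inf M (T t) \<le> ennreal (exp (M_fun \<beta> \<eta> t)))"
proof (intro allI impI)
  fix \<eta> t :: real
  assume \<eta>: "\<eta> > -1" and fin: "\<forall>t > 0. M_fun_finite \<beta> \<eta> t" and t: "t > 0"
  interpret symmetric_markov_semigroup M T by fact
  interpret log_sobolev_semigroup M T sqrtA \<beta>
    by unfold_locales (use assms(3,4,6) in auto)
  show "opnorm_2_inf M (T t) \<le> ennreal (exp (M_fun \<beta> \<eta> t))"
    unfolding opnorm_2_inf_def
  proof (rule SUP_least)
    fix f assume f: "f \<in> {f \<in> Lp_space M 2. Lp_norm M 2 f \<le> 1}"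
    then have f2: "f \<in> Lp_space M 2" and f1: "Lp_norm M 2 f \<le> 1" by auto
    have le: "exp (M_fun \<beta> \<eta> t) * Lp_norm M 2 f \<le> exp (M_fun \<beta> \<eta> t)" using f1 by simp
    have "AE x in M. \<bar>T t f x\<bar> \<le> exp (M_fun \<beta> \<eta> t) * Lp_norm M 2 f"
      using fin t by (intro ultracontractive f2 assms(5) \<eta>) auto
    then have "AE x in M. \<bar>T t f x\<bar> \<le> exp (M_fun \<beta> \<eta> t)"
      by eventually_elim (use le in linarith)
    then show "Linf_norm M (T t f) \<le> ennreal (exp (M_fun \<beta> \<eta> t))"
      using t f2 by (subst Linf_norm_le_iff) (auto intro!: T_measurable)
  qed
qed

end
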